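(* Let $p\ge2$ and let $f,h:\mathbb{R}^n\to(-\infty,\infty]$ be proper, closed, prox-bounded and prox-regular. Let $x^*\in\mathbb{R}^n$ and $w\in\mathbb{R}^n$ satisfy $-w\in\partial f(x^* )$ and $w\in\partial h(x^* )$, and for $t>0$ set $z^*=x^*+tw$ and $F_{\mathrm{DRS}}(z)=\mathrm{prox}_{th}(z)-\mathrm{prox}_{tf}(2\,\mathrm{prox}_{th}(z)-z)$. Consider the conditions: (B1$'$) $-w\in\mathrm{ri}\,\partial f(x^* )$ and $w\in\mathrm{ri}\,\partial h(x^* )$ (strict complementarity), $f$ is $C^p$-partly smooth at $x^*$ for $-w$ relative to some $C^p$ embedded submanifold $\mathcal{M}^f_{x^*}\ni x^*$, and $h$ is $C^p$-partly smooth at $x^*$ for $w$ relative to some $C^p$ embedded submanifold $\mathcal{M}^h_{x^*}\ni x^*$; (B2$'$) (for the given $t$) $f$ is twice epi-differentiable at $x^*$ for $-w$ and $h$ is twice epi-differentiable at $x^*$ for $w$, both with generalized quadratic second subderivatives; the sets of points where $\mathrm{prox}_{tf}$, respectively $\mathrm{prox}_{th}$, is not differentiable are closed; and $\mathrm{prox}_{tf}$ and $\mathrm{prox}_{th}$ are $C^{p-1}$ on the complements of these sets. Then for all sufficiently small $t>0$: if (B1$'$) holds, or (B2$'$) holds for this $t$, then $F_{\mathrm{DRS}}$ is $C^{p-1}$ on a neighborhood of $z^*$.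
   Context: $\mathrm{prox}_{t\phi}(y)=\arg\min_x\{\phi(x)+\frac1{2t}\|x-y\|^2\}$; prox-bounded: this infimum is $>-\infty$ for some $t>0,y$. Regular subgradients $\hat\partial\phi(x)$: $v$ with $\phi(y)\ge\phi(x)+\langle v,y-x\rangle+o(\|y-x\|)$; limiting subgradients $\partial\phi(x)$: limits of $v_k\in\hat\partial\phi(x_k)$, $x_k\to x$, $\phi(x_k)\to\phi(x)$ (for prox-regular functions these coincide). Prox-regularity at $\bar x$ for $\bar v$ (constants $\varepsilon,\rho$): $\phi(y)\ge\phi(x)+\langle v,y-x\rangle-\frac\rho2\|y-x\|^2$ for $y\in B(\bar x,\varepsilon)$ whenever $v\in\partial\phi(x)$, $\|v-\bar v\|<\varepsilon$, $\|x-\bar x\|<\varepsilon$, $\phi(x)<\phi(\bar x)+\varepsilon$. $\mathrm{ri}$ is relative interior. $C^p$-partial smoothness of $\phi$ at $x$ for $v$ relative to $\mathcal{M}$: (i) $\phi|_{\mathcal{M}}$ is $C^p$ near $x$; (ii) $\phi$ is prox-regular at $x$ for $v$; (iii) $\mathrm{par}\,\hat\partial\phi(x)=N_{\mathcal{M}}(x)$ (subspace parallel to the affine hull equals normal space); (iv) for some neighborhood $V$ of $v$, $x'\mapsto V\cap\partial\phi(x')$ is inner semicontinuous at $x$ relative to $\mathcal{M}$. Second subderivative: $\Delta^2_\tau\phi(x|v)[u]=\frac{\phi(x+\tau u)-\phi(x)-\tau\langle v,u\rangle}{\tau^2/2}$, $\mathrm{d}^2\phi(x|v)[u]=\liminf_{\tau\downarrow0,u'\to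 u}\Delta^2_\tau\phi(x|v)[u']$; twice epi-differentiable means epi-convergence of $\Delta^2_\tau\phi(x|v)$ to $\mathrm{d}^2\phi(x|v)$; generalized quadratic means $\mathrm{d}^2\phi(x|v)[u]=\langle u,Mu\rangle+\delta_S(u)$ for a matrix $M$ and linear subspace $S$. *)

theory Defs
  imports "HOL-Analysis.Analysis"
begin

text \<open>C^k on an (open) set U: there is a family of iterated directional derivatives
  D j y [v_1,...,v_j], each one the Frechet derivative of the previous one, all continuous on U.\<close>
definition Ck_on :: "nat \<Rightarrow> 'a::real_normed_vector set \<Rightarrow> ('a \<Rightarrow> 'b::real_normed_vector) \<Rightarrow> bool" where
  "Ck_on k U g \<longleftrightarrow> (\<exists>D :: nat \<Rightarrow> 'a \<Rightarrow> 'a list \<Rightarrow> 'b.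
      (\<forall>x\<in>U. D 0 x [] = g x) \<and>
      (\<forall>j<k. \<forall>vs. length vs = j \<longrightarrow>
          (\<forall>x\<in>U. ((\<lambda>y. D j y vs) has_derivative (\<lambda>v. D (Suc j) x (v # vs))) (at x))) \<and>
      (\<forall>j\<le>k. \<forall>vs. length vs = j \<longrightarrow> continuous_on U (\<lambda>y. D j y vs)))"

definition Cp_submanifold :: "nat \<Rightarrow> (real^'n) set \<Rightarrow> bool" where
  "Cp_submanifold p M \<longleftrightarrow> (\<forall>m\<in>M. \<exists>V (\<psi>::real^'n \<Rightarrow> real^'n) L.
      open V \<and> m \<in> V \<and> subspace L \<and> Ck_on p V \<psi> \<and> inj_on \<psi> V \<and> open (\<psi> ` V) \<and>
      Ck_on p (\<psi> ` V) (inv_into V \<psi>) \<and> \<psi> ` (M \<inter> V) = \<psi> ` V \<inter> L)"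

text \<open>Tangent cone (= tangent space for a submanifold) and normal space.\<close>
definition tangent_cone :: "(real^'n) set \<Rightarrow> real^'n \<Rightarrow> (real^'n) set" where
  "tangent_cone M x = {v. \<exists>xs ts. (\<forall>k. xs k \<in> M \<and> ts k > 0) \<and> ts \<longlonglongrightarrow> 0 \<and>
      xs \<longlonglongrightarrow> x \<and> (\<lambda>k. (1 / ts k) *\<^sub>R (xs k - x)) \<longlonglongrightarrow> v}"

definition normal_space :: "(real^'n) set \<Rightarrow> real^'n \<Rightarrow> (real^'n) set" where
  "normal_space M x = {u. \<forall>v\<in>tangent_cone M x. u \<bullet> v = 0}"

definition proper_fun :: "(real^'n \<Rightarrow> ereal) \<Rightarrow> bool" where
  "proper_fun \<phi> \<longleftrightarrow> (\<exists>x. \<phi> x \<noteq> \<infinity>) \<and> (\<forall>x. \<phi> x \<noteq> -\<infinity>)"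

definition closed_fun :: "(real^'n \<Rightarrow> ereal) \<Rightarrow> bool" where
  "closed_fun \<phi> \<longleftrightarrow> closed {(x, r::real). \<phi> x \<le> ereal r}"

definition prox_bounded :: "(real^'n \<Rightarrow> ereal) \<Rightarrow> bool" where
  "prox_bounded \<phi> \<longleftrightarrow> (\<exists>t>0. \<exists>y. \<exists>c::real. \<forall>x. ereal c \<le> \<phi> x + ereal (norm (x - y)^2 / (2*t)))"

definition prox_set :: "real \<Rightarrow> (real^'n \<Rightarrow> ereal) \<Rightarrow> real^'n \<Rightarrow> (real^'n) set" where
  "prox_set t \<phi> y = {x. \<forall>x'. \<phi> x + ereal (norm (x - y)^2 / (2*t)) \<le> \<phi> x' + ereal (norm (x' - y)^2 / (2*t))}"

text \<open>The proximal mapping as a (single-valued) function; meaningful where prox_set is a singleton.\<close>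
definition prox :: "real \<Rightarrow> (real^'n \<Rightarrow> ereal) \<Rightarrow> real^'n \<Rightarrow> real^'n" where
  "prox t \<phi> y = (THE x. x \<in> prox_set t \<phi> y)"

definition F_DRS :: "real \<Rightarrow> (real^'n \<Rightarrow> ereal) \<Rightarrow> (real^'n \<Rightarrow> ereal) \<Rightarrow> real^'n \<Rightarrow> real^'n" where
  "F_DRS t f h z = prox t h z - prox t f (2 *\<^sub>R prox t h z - z)"

definition reg_subdiff :: "(real^'n \<Rightarrow> ereal) \<Rightarrow> real^'n \<Rightarrow> (real^'n) set" where
  "reg_subdiff \<phi> x = {v. \<bar>\<phi> x\<bar> \<noteq> \<infinity> \<and> (\<forall>\<epsilon>>0. \<exists>\<delta>>0. \<forall>y. norm (y - x) < \<delta> \<longrightarrow>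
      \<phi> x + ereal (v \<bullet> (y - x) - \<epsilon> * norm (y - x)) \<le> \<phi> y)}"

definition lim_subdiff :: "(real^'n \<Rightarrow> ereal) \<Rightarrow> real^'n \<Rightarrow> (real^'n) set" where
  "lim_subdiff \<phi> x = {v. \<exists>xs vs. (\<forall>k. vs k \<in> reg_subdiff \<phi> (xs k)) \<and> xs \<longlonglongrightarrow> x \<and>
      (\<lambda>k. \<phi> (xs k)) \<longlonglongrightarrow> \<phi> x \<and> vs \<longlonglongrightarrow> v}"

definition prox_regular_at :: "(real^'n \<Rightarrow> ereal) \<Rightarrow> real^'n \<Rightarrow> real^'n \<Rightarrow> bool" where
  "prox_regular_at \<phi> xb vb \<longleftrightarrow> (\<exists>\<epsilon>>0. \<exists>\<rho>::real. \<forall>x v. v \<in> lim_subdiff \<phi> x \<and> norm (v - vb) < \<epsilon> \<and>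
      norm (x - xb) < \<epsilon> \<and> \<phi> x < \<phi> xb + ereal \<epsilon> \<longrightarrow>
      (\<forall>y\<in>ball xb \<epsilon>. \<phi> x + ereal (v \<bullet> (y - x) - \<rho> / 2 * norm (y - x)^2) \<le> \<phi> y))"

definition prox_regular :: "(real^'n \<Rightarrow> ereal) \<Rightarrow> bool" where
  "prox_regular \<phi> \<longleftrightarrow> (\<forall>x v. v \<in> lim_subdiff \<phi> x \<longrightarrow> prox_regular_at \<phi> x v)"

definition par :: "(real^'n) set \<Rightarrow> (real^'n) set" where
  "par S = span {a - b | a b. a \<in> S \<and> b \<in> S}"

definition isc_rel :: "(real^'n) set \<Rightarrow> (real^'n \<Rightarrow> (real^'n) set) \<Rightarrow> real^'n \<Rightarrow> bool" where
  "isc_rel X S x \<longleftrightarrow> (\<forall>u\<in>S x. \<forall>xs. (\<forall>k. xs k \<in> X) \<and> xs \<longlonglongrightarrow> x \<longrightarrow>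
      (\<exists>us. (\<forall>\<^sub>F k in sequentially. us k \<in> S (xs k)) \<and> us \<longlonglongrightarrow> u))"

definition partly_smooth :: "nat \<Rightarrow> (real^'n \<Rightarrow> ereal) \<Rightarrow> real^'n \<Rightarrow> real^'n \<Rightarrow> (real^'n) set \<Rightarrow> bool" where
  "partly_smooth p \<phi> x v M \<longleftrightarrow>
     (\<exists>V g. open V \<and> x \<in> V \<and> Ck_on p V (g :: real^'n \<Rightarrow> real) \<and> (\<forall>y\<in>M \<inter> V. \<phi> y = ereal (g y))) \<and>
     prox_regular_at \<phi> x v \<and>
     par (reg_subdiff \<phi> x) = normal_space M x \<and>
     (\<exists>V. open V \<and> v \<in> V \<and> isc_rel M (\<lambda>x'. V \<inter> lim_subdiff \<phi> x') x)"

definition sec_quot :: "(real^'n \<Rightarrow> ereal) \<Rightarrow> real^'n \<Rightarrow> real^'n \<Rightarrow> real \<Rightarrow> real^'n \<Rightarrow> ereal" where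
  "sec_quot \<phi> x v \<tau> u = ereal (2 / \<tau>^2) * (\<phi> (x + \<tau> *\<^sub>R u) - \<phi> x - ereal (\<tau> * (v \<bullet> u)))"

definition sec_subderiv :: "(real^'n \<Rightarrow> ereal) \<Rightarrow> real^'n \<Rightarrow> real^'n \<Rightarrow> real^'n \<Rightarrow> ereal" where
  "sec_subderiv \<phi> x v u = Liminf (at (0::real, u) within ({0<..} \<times> UNIV)) (\<lambda>(\<tau>, u'). sec_quot \<phi> x v \<tau> u')"

text \<open>Epi-convergence of the second-order difference quotients, sequential form (Rockafellar-Wets 7.2).\<close>
definition twice_epi_diff :: "(real^'n \<Rightarrow> ereal) \<Rightarrow> real^'n \<Rightarrow> real^'n \<Rightarrow> bool" where
  "twice_epi_diff \<phi> x v \<longleftrightarrow> (\<forall>u \<tau>s. (\<forall>k. \<tau>s k > 0) \<and> \<tau>s \<longlonglongrightarrow> 0 \<longrightarrow>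
      (\<forall>us. us \<longlonglongrightarrow> u \<longrightarrow> sec_subderiv \<phi> x v u \<le> liminf (\<lambda>k. sec_quot \<phi> x v (\<tau>s k) (us k))) \<and>
      (\<exists>us. us \<longlonglongrightarrow> u \<and> limsup (\<lambda>k. sec_quot \<phi> x v (\<tau>s k) (us k)) \<le> sec_subderiv \<phi> x v u))"

definition generalized_quadratic_sd :: "(real^'n \<Rightarrow> ereal) \<Rightarrow> real^'n \<Rightarrow> real^'n \<Rightarrow> bool" where
  "generalized_quadratic_sd \<phi> x v \<longleftrightarrow> (\<exists>(A::real^'n^'n) S. subspace S \<and>
      (\<forall>u. sec_subderiv \<phi> x v u = (if u \<in> S then ereal (u \<bullet> (A *v u)) else \<infinity>)))"

definition prox_differentiable_at :: "real \<Rightarrow> (real^'n \<Rightarrow> ereal) \<Rightarrow> real^'n \<Rightarrow> bool" where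
  "prox_differentiable_at t \<phi> y \<longleftrightarrow> (\<exists>U. open U \<and> y \<in> U \<and> (\<forall>z\<in>U. \<exists>!x. x \<in> prox_set t \<phi> z)) \<and>
      prox t \<phi> differentiable (at y)"

definition prox_nondiff_set :: "real \<Rightarrow> (real^'n \<Rightarrow> ereal) \<Rightarrow> (real^'n) set" where
  "prox_nondiff_set t \<phi> = {y. \<not> prox_differentiable_at t \<phi> y}"

end

theory Submission
  imports Defs
begin

text \<open>
  Both conditions force the proximal mapping \<open>P\<close> of each of the two functions to be \<open>C\<^sup>p\<^sup>-\<^sup>1\<close> near
  \<open>x + t v\<close>, where \<open>v\<close> is the given subgradient at \<open>x\<close>; the claim then follows by composition.
  For small \<open>t\<close>, prox-boundedness and prox-regularity give a global quadratic minorant at \<open>x\<close>, so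
  that \<open>P\<close> is nonempty-valued and \<open>P(x + t v) = x\<close>; local hypomonotonicity of the
  subdifferential makes \<open>P(z)\<close>, for \<open>z\<close> near \<open>x + t v\<close>, the unique point \<open>x'\<close> near \<open>x\<close> (in value as
  well) with \<open>(z - x')/t \<in> \<partial>\<phi>(x')\<close>.

  Under second-order epi-differentiability the difference quotients of \<open>P\<close> minimize
  second-order difference quotients of the function plus a quadratic. Their cluster points
  therefore minimize a strictly convex quadratic on a subspace, so they depend linearly on the
  direction, and \<open>P\<close> is differentiable at \<open>x + t v\<close>.

  Under partial smoothness, \<open>\<Phi>(y, \<eta>) = x' + t v'\<close> with \<open>x'\<close> the point of the manifold with
  coordinate \<open>y\<close> and \<open>v' = \<nabla>g(x') + D\<psi>(x')\<^sup>T \<eta>\<close> (\<open>\<psi>\<close> the chart, \<open>g\<close> a smooth extension of the function)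
  is a local \<open>C\<^sup>p\<^sup>-\<^sup>1\<close> diffeomorphism for small \<open>t\<close>. Strict complementarity and inner semicontinuity
  show that \<open>v'\<close> is a subgradient at \<open>x'\<close>, hence \<open>P(\<Phi>(y, \<eta>)) = x'\<close>.
\<close>

section \<open>Calculus of \<open>C\<^sup>k\<close> functions\<close>

lemma Ck_on_0: "Ck_on 0 U g \<longleftrightarrow> continuous_on U g"
proof
  assume "Ck_on 0 U g"
  then obtain D :: "nat \<Rightarrow> 'a \<Rightarrow> 'a list \<Rightarrow> 'b" where
    "\<forall>x\<in>U. D 0 x [] = g x" "continuous_on U (\<lambda>y. D 0 y [])"
    unfolding Ck_on_def by auto
  then show "continuous_on U g"
    by (simp cong: continuous_on_cong)
next
  assume "continuous_on U g"
  then show "Ck_on 0 U g"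
    unfolding Ck_on_def by (intro exI[of _ "\<lambda>j y vs. g y"]) auto
qed

text \<open>With \<open>Ck_on_SucE\<close> this gives a recursion on the order, so that the closure
  properties below are inductions that no longer touch the family of iterated derivatives.\<close>

lemma Ck_on_SucI:
  assumes der: "\<And>x. x \<in> U \<Longrightarrow> (g has_derivative g' x) (at x)"
    and C: "\<And>v. Ck_on k U (\<lambda>x. g' x v)"
  shows "Ck_on (Suc k) U g"
proof -
  from C have "\<forall>v. \<exists>D :: nat \<Rightarrow> 'a \<Rightarrow> 'a list \<Rightarrow> 'b.
      (\<forall>x\<in>U. D 0 x [] = g' x v) \<and>
      (\<forall>j<k. \<forall>vs. length vs = j \<longrightarrow>
          (\<forall>x\<in>U. ((\<lambda>y. D j y vs) has_derivative (\<lambda>v. D (Suc j) x (v # vs))) (at x))) \<and>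
      (\<forall>j\<le>k. \<forall>vs. length vs = j \<longrightarrow> continuous_on U (\<lambda>y. D j y vs))"
    unfolding Ck_on_def by blast
  from choice[OF this] obtain E :: "'a \<Rightarrow> nat \<Rightarrow> 'a \<Rightarrow> 'a list \<Rightarrow> 'b" where E: "\<forall>v.
      (\<forall>x\<in>U. E v 0 x [] = g' x v) \<and>
      (\<forall>j<k. \<forall>vs. length vs = j \<longrightarrow>
          (\<forall>x\<in>U. ((\<lambda>y. E v j y vs) has_derivative (\<lambda>w. E v (Suc j) x (w # vs))) (at x))) \<and>
      (\<forall>j\<le>k. \<forall>vs. length vs = j \<longrightarrow> continuous_on U (\<lambda>y. E v j y vs))" ..
  then have E0: "\<And>v x. x \<in> U \<Longrightarrow> E v 0 x [] = g' x v"
    and Ed: "\<And>v j vs x. j < k \<Longrightarrow> length vs = j \<Longrightarrow> x \<in> U \<Longrightarrow>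
        ((\<lambda>y. E v j y vs) has_derivative (\<lambda>w. E v (Suc j) x (w # vs))) (at x)"
    and Ec: "\<And>v j vs. j \<le> k \<Longrightarrow> length vs = j \<Longrightarrow> continuous_on U (\<lambda>y. E v j y vs)"
    by blast+
  \<comment> \<open>Each new direction goes to the front of the list, so the last entry is the
    direction of the first differentiation. It selects the family belonging to
    \<open>g' x v\<close>; the rest of the list is passed to that family, one order lower.\<close>
  define D where "D = (\<lambda>j y vs. if vs = [] then g y else E (last vs) (j - 1) y (butlast vs))"
  have "continuous_on U g"
    using der by (meson has_derivative_at_withinI has_derivative_continuous_on)
  then have cont: "continuous_on U (\<lambda>y. D j y vs)" if "j \<le> Suc k" "length vs = j" for j vs
    using that Ec[of "j - 1" "butlast vs"] by (cases "vs = []") (auto simp: D_def)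
  have deriv: "((\<lambda>y. D j y vs) has_derivative (\<lambda>v. D (Suc j) x (v # vs))) (at x)"
    if "j < Suc k" "length vs = j" "x \<in> U" for j vs x
  proof (cases "vs = []")
    case True
    then show ?thesis
      using that der[OF that(3)] by (simp add: D_def E0)
  next
    case False
    then have "j - 1 < k" "length (butlast vs) = j - 1" "Suc (j - 1) = j"
      using that by (auto simp: less_Suc_eq_0_disj)
    then show ?thesis
      using Ed[of "j - 1" "butlast vs" x "last vs"] that False by (simp add: D_def)
  qed
  show ?thesis
    unfolding Ck_on_def
    by (intro exI[of _ D]) (use cont deriv in \<open>auto simp: D_def\<close>)
qed

lemma Ck_on_SucE:
  assumes "Ck_on (Suc k) U g" and "open U"
  obtains g' where "\<And>x. x \<in> U \<Longrightarrow> (g has_derivative g' x) (at x)"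
    and "\<And>v. Ck_on k U (\<lambda>x. g' x v)"
proof -
  from assms(1)[unfolded Ck_on_def] obtain D where D: "(\<forall>x\<in>U. D 0 x [] = g x) \<and>
      (\<forall>j<Suc k. \<forall>vs. length vs = j \<longrightarrow>
          (\<forall>x\<in>U. ((\<lambda>y. D j y vs) has_derivative (\<lambda>v. D (Suc j) x (v # vs))) (at x))) \<and>
      (\<forall>j\<le>Suc k. \<forall>vs. length vs = j \<longrightarrow> continuous_on U (\<lambda>y. D j y vs))" ..
  then have D0: "\<And>x. x \<in> U \<Longrightarrow> D 0 x [] = g x"
    and Dd: "\<And>j vs x. j < Suc k \<Longrightarrow> length vs = j \<Longrightarrow> x \<in> U \<Longrightarrow>
        ((\<lambda>y. D j y vs) has_derivative (\<lambda>w. D (Suc j) x (w # vs))) (at x)"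
    and Dc: "\<And>j vs. j \<le> Suc k \<Longrightarrow> length vs = j \<Longrightarrow> continuous_on U (\<lambda>y. D j y vs)"
    by simp_all
  show thesis
  proof
    show "(g has_derivative (\<lambda>v. D 1 x [v])) (at x)" if "x \<in> U" for x
      using has_derivative_transform_within_open[OF Dd[of 0 "[]" x] \<open>open U\<close> that, of g] that D0
      by simp
    show "Ck_on k U (\<lambda>x. D 1 x [v])" for v
      unfolding Ck_on_def
    \<comment> \<open>The first direction \<open>v\<close> stays at the end of the list while the
      further directions accumulate in front of it.\<close>
    proof (intro exI[of _ "\<lambda>j y vs. D (Suc j) y (vs @ [v])"] conjI allI impI ballI)
      fix j and vs :: "'a list" and x assume "j < k" "length vs = j" "x \<in> U"
      then show "((\<lambda>y. D (Suc j) y (vs @ [v])) has_derivative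
          (\<lambda>va. D (Suc (Suc j)) x ((va # vs) @ [v]))) (at x)"
        using Dd[of "Suc j" "vs @ [v]" x] by simp
    qed (simp_all add: Dc)
  qed
qed

lemma Ck_on_mono:
  assumes "Ck_on k U g" "j \<le> k"
  shows "Ck_on j U g"
proof -
  from assms(1)[unfolded Ck_on_def] obtain D where D: "(\<forall>x\<in>U. D 0 x [] = g x) \<and>
      (\<forall>j<k. \<forall>vs. length vs = j \<longrightarrow>
          (\<forall>x\<in>U. ((\<lambda>y. D j y vs) has_derivative (\<lambda>v. D (Suc j) x (v # vs))) (at x))) \<and>
      (\<forall>j\<le>k. \<forall>vs. length vs = j \<longrightarrow> continuous_on U (\<lambda>y. D j y vs))" ..
  then show ?thesis
    unfolding Ck_on_def by (intro exI[of _ D]) (use assms(2) in auto)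
qed

lemma Ck_on_continuous_on: "Ck_on k U g \<Longrightarrow> continuous_on U g"
  using Ck_on_mono[of k U g 0] by (simp add: Ck_on_0)

lemma Ck_on_subset:
  assumes "Ck_on k U g" "V \<subseteq> U"
  shows "Ck_on k V g"
proof -
  from assms(1)[unfolded Ck_on_def] obtain D where D: "(\<forall>x\<in>U. D 0 x [] = g x) \<and>
      (\<forall>j<k. \<forall>vs. length vs = j \<longrightarrow>
          (\<forall>x\<in>U. ((\<lambda>y. D j y vs) has_derivative (\<lambda>v. D (Suc j) x (v # vs))) (at x))) \<and>
      (\<forall>j\<le>k. \<forall>vs. length vs = j \<longrightarrow> continuous_on U (\<lambda>y. D j y vs))" ..
  then show ?thesis
    unfolding Ck_on_def
    by (intro exI[of _ D]) (use assms(2) in \<open>auto intro: continuous_on_subset[of U]\<close>)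
qed

lemma Ck_on_cong:
  assumes "\<And>x. x \<in> U \<Longrightarrow> g x = h x"
  shows "Ck_on k U g \<longleftrightarrow> Ck_on k U h"
  using assms unfolding Ck_on_def by simp

lemma Ck_on_const: "Ck_on k U (\<lambda>x. c)"
proof (induction k arbitrary: c)
  case (Suc k)
  then show ?case by (intro Ck_on_SucI[where g' = "\<lambda>x v. 0"]) auto
qed (simp add: Ck_on_0)

lemma Ck_on_bounded_linear_compose:
  assumes "bounded_linear T" "open U" "Ck_on k U g"
  shows "Ck_on k U (\<lambda>x. T (g x))"
  using assms(3)
proof (induction k arbitrary: g)
  case 0
  then show ?case
    by (simp add: Ck_on_0 assms(1) bounded_linear.continuous_on)
next
  case (Suc k)
  then obtain g' where g': "\<And>x. x \<in> U \<Longrightarrow> (g has_derivative g' x) (at x)"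
    "\<And>v. Ck_on k U (\<lambda>x. g' x v)"
    using Ck_on_SucE[OF Suc.prems \<open>open U\<close>] by blast
  show ?case
    by (rule Ck_on_SucI[where g' = "\<lambda>x v. T (g' x v)"])
      (auto intro: bounded_linear.has_derivative[OF assms(1)] g' Suc.IH)
qed

lemma Ck_on_bounded_linear:
  assumes "bounded_linear T" "open U"
  shows "Ck_on k U T"
proof (cases k)
  case 0
  then show ?thesis
    using assms by (simp add: Ck_on_0 linear_continuous_on)
next
  case (Suc k')
  then show ?thesis
    by (auto intro!: Ck_on_SucI[where g' = "\<lambda>x v. T v"] Ck_on_const
        bounded_linear_imp_has_derivative assms)
qed

lemma Ck_on_add:
  assumes "open U" "Ck_on k U g" "Ck_on k U h"
  shows "Ck_on k U (\<lambda>x. g x + h x)"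
  using assms(2,3)
proof (induction k arbitrary: g h)
  case 0
  then show ?case by (simp add: Ck_on_0 continuous_on_add)
next
  case (Suc k)
  obtain g' where g': "\<And>x. x \<in> U \<Longrightarrow> (g has_derivative g' x) (at x)"
    "\<And>v. Ck_on k U (\<lambda>x. g' x v)"
    using Ck_on_SucE[OF Suc.prems(1) \<open>open U\<close>] by blast
  obtain h' where h': "\<And>x. x \<in> U \<Longrightarrow> (h has_derivative h' x) (at x)"
    "\<And>v. Ck_on k U (\<lambda>x. h' x v)"
    using Ck_on_SucE[OF Suc.prems(2) \<open>open U\<close>] by blast
  show ?case
    by (rule Ck_on_SucI[where g' = "\<lambda>x v. g' x v + h' x v"])
      (auto intro: has_derivative_add g' h' Suc.IH)
qed

lemma Ck_on_sum:
  assumes "open U" "\<And>i. i \<in> I \<Longrightarrow> Ck_on k U (g i)"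
  shows "Ck_on k U (\<lambda>x. \<Sum>i\<in>I. g i x)"
  using assms(2)
proof (induction I rule: infinite_finite_induct)
  case (insert i I)
  then show ?case
    using Ck_on_add[OF \<open>open U\<close>, of k "g i" "\<lambda>x. \<Sum>i\<in>I. g i x"] by simp
qed (simp_all add: Ck_on_const)

lemma Ck_on_scaleR_const:
  assumes "open U" "Ck_on k U g"
  shows "Ck_on k U (\<lambda>x. c *\<^sub>R g x)"
  by (rule Ck_on_bounded_linear_compose[OF bounded_linear_scaleR_right assms])

lemma Ck_on_diff:
  assumes "open U" "Ck_on k U g" "Ck_on k U h"
  shows "Ck_on k U (\<lambda>x. g x - h x)"
  using Ck_on_add[OF assms(1,2) Ck_on_scaleR_const[OF assms(1,3), of "-1"]] by simp

lemma Ck_on_bilinear: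
  assumes B: "bounded_bilinear B" and "open U" "Ck_on k U g" "Ck_on k U h"
  shows "Ck_on k U (\<lambda>x. B (g x) (h x))"
  using assms(3,4)
proof (induction k arbitrary: g h)
  case 0
  then show ?case by (simp add: Ck_on_0 bounded_bilinear.continuous_on[OF B])
next
  case (Suc k)
  obtain g' where g': "\<And>x. x \<in> U \<Longrightarrow> (g has_derivative g' x) (at x)"
    "\<And>v. Ck_on k U (\<lambda>x. g' x v)"
    using Ck_on_SucE[OF Suc.prems(1) \<open>open U\<close>] by blast
  obtain h' where h': "\<And>x. x \<in> U \<Longrightarrow> (h has_derivative h' x) (at x)"
    "\<And>v. Ck_on k U (\<lambda>x. h' x v)"
    using Ck_on_SucE[OF Suc.prems(2) \<open>open U\<close>] by blast
  have "Ck_on k U g" "Ck_on k U h"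
    using Suc.prems Ck_on_mono le_SucI by blast+
  then have "Ck_on k U (\<lambda>x. B (g x) (h' x v))" "Ck_on k U (\<lambda>x. B (g' x v) (h x))" for v
    using Suc.IH g'(2) h'(2) by blast+
  then have "Ck_on k U (\<lambda>x. B (g x) (h' x v) + B (g' x v) (h x))" for v
    using Ck_on_add[OF \<open>open U\<close>] by blast
  moreover have "((\<lambda>x. B (g x) (h x)) has_derivative (\<lambda>v. B (g x) (h' x v) + B (g' x v) (h x))) (at x)"
    if "x \<in> U" for x
    using bounded_bilinear.FDERIV[OF B g'(1)[OF that] h'(1)[OF that]] .
  ultimately show ?case
    by (rule Ck_on_SucI[rotated])
qed

lemmas Ck_on_mult = Ck_on_bilinear[OF bounded_bilinear_mult]
lemmas Ck_on_scaleR = Ck_on_bilinear[OF bounded_bilinear_scaleR]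
lemmas Ck_on_inner = Ck_on_bilinear[OF bounded_bilinear_inner]

lemma Ck_on_prod:
  fixes g :: "'i \<Rightarrow> 'a::real_normed_vector \<Rightarrow> real"
  assumes "open U" "\<And>i. i \<in> I \<Longrightarrow> Ck_on k U (g i)"
  shows "Ck_on k U (\<lambda>x. \<Prod>i\<in>I. g i x)"
  using assms(2)
proof (induction I rule: infinite_finite_induct)
  case (insert i I)
  then show ?case
    using Ck_on_mult[OF \<open>open U\<close>, of k "g i" "\<lambda>x. \<Prod>i\<in>I. g i x"] by simp
qed (simp_all add: Ck_on_const)

lemma Ck_on_compose:
  fixes g :: "'a::real_normed_vector \<Rightarrow> 'b::euclidean_space"
    and f :: "'b \<Rightarrow> 'c::real_normed_vector"
  assumes "open U" "open V" "g ` U \<subseteq> V" "Ck_on k V f" "Ck_on k U g"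
  shows "Ck_on k U (\<lambda>x. f (g x))"
  using assms(4,5)
proof (induction k arbitrary: f)
  case 0
  then show ?case
    using continuous_on_compose2[of V f U g] assms(3) by (simp add: Ck_on_0)
next
  case (Suc k)
  obtain f' where f': "\<And>x. x \<in> V \<Longrightarrow> (f has_derivative f' x) (at x)"
    "\<And>v. Ck_on k V (\<lambda>x. f' x v)"
    using Ck_on_SucE[OF Suc.prems(1) \<open>open V\<close>] by blast
  obtain g' where g': "\<And>x. x \<in> U \<Longrightarrow> (g has_derivative g' x) (at x)"
    "\<And>v. Ck_on k U (\<lambda>x. g' x v)"
    using Ck_on_SucE[OF Suc.prems(2) \<open>open U\<close>] by blast
  have gk: "Ck_on k U g"
    using Suc.prems(2) Ck_on_mono le_SucI by blast
  show ?case
  \<comment> \<open>The chain rule applies \<open>f' (g x)\<close> to \<open>g' x v\<close>, a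
    direction that moves with \<open>x\<close>, whereas \<open>Ck_on\<close> controls derivatives in
    fixed directions. Expanding in the basis leaves fixed directions, to which the induction
    hypothesis, general in \<open>f\<close>, applies.\<close>
  proof (rule Ck_on_SucI[where g' = "\<lambda>x v. \<Sum>b\<in>Basis. (g' x v \<bullet> b) *\<^sub>R f' (g x) b"])
    fix x assume x: "x \<in> U"
    then have gx: "g x \<in> V" using assms(3) by blast
    interpret f': bounded_linear "f' (g x)"
      using f'(1)[OF gx] has_derivative_bounded_linear by blast
    have "(\<lambda>v. \<Sum>b\<in>Basis. (g' x v \<bullet> b) *\<^sub>R f' (g x) b) = (\<lambda>v. f' (g x) (g' x v))"
      by (subst (2) euclidean_representation[symmetric]) (simp only: f'.sum f'.scaleR)
    then show "((\<lambda>x. f (g x)) has_derivative (\<lambda>v. \<Sum>b\<in>Basis. (g' x v \<bullet> b) *\<^sub>R f' (g x) b)) (at x)"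
      using has_derivative_compose[OF g'(1)[OF x] f'(1)[OF gx]] by simp
  next
    show "Ck_on k U (\<lambda>x. \<Sum>b\<in>Basis. (g' x v \<bullet> b) *\<^sub>R f' (g x) b)" for v
      by (intro Ck_on_sum Ck_on_scaleR Ck_on_inner Ck_on_const g' \<open>open U\<close> Suc.IH f' gk)
  qed
qed

lemma Ck_on_inverse: "Ck_on k (- {0}) (inverse :: real \<Rightarrow> real)"
proof (induction k)
  case 0
  then show ?case by (auto simp: Ck_on_0 intro!: continuous_intros)
next
  case (Suc k)
  show ?case
  proof (rule Ck_on_SucI[where g' = "\<lambda>x v. - (inverse x * v * inverse x)"])
    show "(inverse has_derivative (\<lambda>v. - (inverse x * v * inverse x))) (at x)"
      if "x \<in> - {0}" for x :: real
      using that by (intro has_derivative_inverse') auto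
    have "Ck_on k (- {0}) (\<lambda>x::real. (-1) *\<^sub>R (inverse x * v * inverse x))" for v
      by (intro Ck_on_scaleR_const Ck_on_mult Ck_on_const Suc.IH) auto
    then show "Ck_on k (- {0}) (\<lambda>x::real. - (inverse x * v * inverse x))" for v
      by simp
  qed
qed

lemma Ck_on_divide:
  fixes g h :: "'a::real_normed_vector \<Rightarrow> real"
  assumes "open U" "Ck_on k U g" "Ck_on k U h" "\<And>x. x \<in> U \<Longrightarrow> h x \<noteq> 0"
  shows "Ck_on k U (\<lambda>x. g x / h x)"
  unfolding divide_inverse
  by (intro Ck_on_mult assms Ck_on_compose[OF assms(1) _ _ Ck_on_inverse]) (use assms in auto)

lemma Ck_on_euclidean_componentwise:
  fixes g :: "'a::real_normed_vector \<Rightarrow> 'b::euclidean_space"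
  assumes "open U" "\<And>b. b \<in> Basis \<Longrightarrow> Ck_on k U (\<lambda>x. g x \<bullet> b)"
  shows "Ck_on k U g"
proof -
  have "Ck_on k U (\<lambda>x. \<Sum>b\<in>Basis. (g x \<bullet> b) *\<^sub>R b)"
    by (intro Ck_on_sum Ck_on_scaleR Ck_on_const assms)
  then show ?thesis by (simp add: euclidean_representation)
qed

lemma Ck_on_vec_nth:
  fixes g :: "'a::real_normed_vector \<Rightarrow> real^'n"
  assumes "open U" "\<And>i. Ck_on k U (\<lambda>x. g x $ i)"
  shows "Ck_on k U g"
  by (rule Ck_on_euclidean_componentwise[OF assms(1)])
    (use assms in \<open>auto simp: Basis_vec_def inner_axis\<close>)

lemma Ck_on_det:
  fixes A :: "'a::real_normed_vector \<Rightarrow> real^'n^'n"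
  assumes "open U" "\<And>i j. Ck_on k U (\<lambda>x. A x $ i $ j)"
  shows "Ck_on k U (\<lambda>x. det (A x))"
proof -
  have "Ck_on k U (\<lambda>x. \<Prod>i\<in>UNIV. A x $ i $ p i)" for p
    by (rule Ck_on_prod[OF assms])
  then have "Ck_on k U (\<lambda>x. of_int (sign p) * (\<Prod>i\<in>UNIV. A x $ i $ p i))" for p :: "'n \<Rightarrow> 'n"
    by (rule Ck_on_mult[OF assms(1) Ck_on_const])
  then show ?thesis
    unfolding det_def by (intro Ck_on_sum[OF assms(1)])
qed

text \<open>The entries of the inverse Jacobian are rational in those of the Jacobian by Cramer's rule, so
  every order of smoothness of the inverse map yields the next one.\<close>

lemma Ck_on_inverse_function:
  fixes \<Phi> \<Psi> :: "real^'n \<Rightarrow> real^'n"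
  assumes "open U" "open V" and "Ck_on k U \<Phi>" and "\<Psi> ` V \<subseteq> U"
    and d\<Phi>: "\<And>x. x \<in> U \<Longrightarrow> (\<Phi> has_derivative \<Phi>' x) (at x)"
    and d\<Psi>: "\<And>y. y \<in> V \<Longrightarrow> (\<Psi> has_derivative inv (\<Phi>' (\<Psi> y))) (at y)"
    and bij: "\<And>y. y \<in> V \<Longrightarrow> bij (\<Phi>' (\<Psi> y))"
  shows "Ck_on k V \<Psi>"
proof -
  have "Ck_on j V \<Psi>" if "j \<le> k" for j
    using that
  proof (induction j)
    case 0
    show ?case
      unfolding Ck_on_0 by (rule has_derivative_continuous_on[OF has_derivative_at_withinI[OF d\<Psi>]])
  next
    case (Suc j)
    have "Ck_on (Suc j) U \<Phi>"
      by (rule Ck_on_mono[OF assms(3) Suc.prems])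
    then obtain D where D: "\<And>x. x \<in> U \<Longrightarrow> (\<Phi> has_derivative D x) (at x)"
      "\<And>v. Ck_on j U (\<lambda>x. D x v)"
      using Ck_on_SucE[OF _ \<open>open U\<close>] by blast
    have D_eq: "\<Phi>' x = D x" if "x \<in> U" for x
      by (rule has_derivative_unique[OF d\<Phi>[OF that] D(1)[OF that]])
    define J where "J = (\<lambda>y. matrix (\<Phi>' (\<Psi> y)))"
    have Jv: "J y *v w = \<Phi>' (\<Psi> y) w" if "y \<in> V" for y w
    proof -
      have "linear (\<Phi>' (\<Psi> y))"
        using that assms(4) by (intro has_derivative_linear[OF d\<Phi>]) auto
      then show ?thesis
        by (simp add: J_def matrix_works)
    qed
    have det: "det (J y) \<noteq> 0" if "y \<in> V" for y
    proof -
      have "inj ((*v) (J y))"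
        using bij[OF that] Jv[OF that] bij_is_inj by (metis (no_types, lifting) injD injI)
      then show ?thesis
        by (metis invertible_det_nz invertible_left_inverse matrix_left_invertible_injective)
    qed
    have entry: "Ck_on j V (\<lambda>y. J y $ i $ l)" for i l
    proof -
      have "Ck_on j V (\<lambda>y. D (\<Psi> y) (axis l 1))"
        by (rule Ck_on_compose[OF \<open>open V\<close> \<open>open U\<close> assms(4) D(2)]) (use Suc in auto)
      then have "Ck_on j V (\<lambda>y. D (\<Psi> y) (axis l 1) $ i)"
        by (rule Ck_on_bounded_linear_compose[OF bounded_linear_vec_nth \<open>open V\<close>])
      then show ?thesis
        using assms(4) D_eq
        by (subst Ck_on_cong[where h = "\<lambda>y. D (\<Psi> y) (axis l 1) $ i"])
          (auto simp: J_def matrix_def image_subset_iff)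
    qed
    have Suc': "Ck_on j V (\<lambda>y. inv (\<Phi>' (\<Psi> y)) v)" for v
    proof (rule Ck_on_vec_nth[OF \<open>open V\<close>])
      fix i
      define N where "N = (\<lambda>y. \<chi> a b. if b = i then v $ a else J y $ a $ b)"
      have eq: "inv (\<Phi>' (\<Psi> y)) v $ i = det (N y) / det (J y)" if "y \<in> V" for y
      proof -
        have "J y *v inv (\<Phi>' (\<Psi> y)) v = v"
          using Jv[OF that] bij[OF that] by (simp add: bij_is_surj surj_f_inv_f)
        then show ?thesis
          using cramer[OF det[OF that], of "inv (\<Phi>' (\<Psi> y)) v" v] by (simp add: N_def)
      qed
      have "Ck_on j V (\<lambda>y. N y $ a $ b)" for a b
        by (cases "b = i") (auto simp: N_def Ck_on_const entry)
      then have "Ck_on j V (\<lambda>y. det (N y) / det (J y))"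
        by (intro Ck_on_divide Ck_on_det \<open>open V\<close> entry det)
      then show "Ck_on j V (\<lambda>y. inv (\<Phi>' (\<Psi> y)) v $ i)"
        using eq by (subst Ck_on_cong) auto
    qed
    show ?case
      by (rule Ck_on_SucI[OF d\<Psi> Suc'])
  qed
  then show ?thesis by simp
qed

text \<open>An injective linear endomorphism of a finite-dimensional space has a left inverse, so
  the inverse function theorem of first order applies; \<open>Ck_on_inverse_function\<close> then
  raises the order of the local inverse to \<open>k\<close>.\<close>

lemma Ck_inverse_function_theorem:
  fixes \<Phi> :: "real^'n \<Rightarrow> real^'n"
  assumes "open U" "u0 \<in> U" "k \<ge> 1" "Ck_on k U \<Phi>"
    and d\<Phi>: "(\<Phi> has_derivative D) (at u0)" and inj: "\<And>d. D d = 0 \<Longrightarrow> d = 0"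
  obtains U' V \<Psi> where "open U'" "U' \<subseteq> U" "u0 \<in> U'" "open V" "\<Phi> u0 \<in> V"
    "\<And>z. z \<in> V \<Longrightarrow> \<Psi> z \<in> U' \<and> \<Phi> (\<Psi> z) = z" "\<Psi> (\<Phi> u0) = u0" "Ck_on k V \<Psi>"
proof -
  obtain k' where k': "k = Suc k'"
    using assms(3) by (cases k) auto
  then obtain \<Phi>' where \<Phi>': "\<And>x. x \<in> U \<Longrightarrow> (\<Phi> has_derivative \<Phi>' x) (at x)"
      "\<And>v. Ck_on k' U (\<lambda>x. \<Phi>' x v)"
    using Ck_on_SucE assms(1,4) by blast
  define B where "B = (\<lambda>x. Blinfun (\<Phi>' x))"
  have B: "blinfun_apply (B x) = \<Phi>' x" if "x \<in> U" for x
    using \<Phi>'(1)[OF that] by (simp add: B_def has_derivative_bounded_linear bounded_linear_Blinfun_apply)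
  have der: "\<And>x. x \<in> U \<Longrightarrow> (\<Phi> has_derivative blinfun_apply (B x)) (at x)"
    using \<Phi>'(1) B by simp
  have "continuous_on U (\<lambda>x. \<Phi>' x i)" for i
    using \<Phi>'(2) Ck_on_continuous_on by blast
  \<comment> \<open>In finite dimension, continuity in every fixed direction gives continuity in the
    operator norm.\<close>
  then have cB: "continuous_on U B"
    by (intro continuous_on_blinfun_componentwise) (simp add: B cong: continuous_on_cong)
  have D: "\<Phi>' u0 = D"
    by (rule has_derivative_unique[OF \<Phi>'(1)[OF assms(2)] d\<Phi>])
  have linD: "linear D"
    by (rule has_derivative_linear[OF d\<Phi>])
  then have "inj D"
    using inj linear_injective_0 by blast
  then obtain D' where D': "linear D'" "D' \<circ> D = id"
    using linear_injective_left_inverse[OF linD] by blast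
  have "Blinfun D' o\<^sub>L B u0 = id_blinfun"
    using D' B[OF assms(2)] D
    by (intro blinfun_eqI)
      (simp add: bounded_linear_Blinfun_apply linear_conv_bounded_linear pointfree_idE)
  from inverse_function_theorem[OF \<open>open U\<close> der cB \<open>u0 \<in> U\<close> this]
  obtain U' V \<Psi> g' where *: "open U'" "U' \<subseteq> U" "u0 \<in> U'" "open V" "\<Phi> u0 \<in> V"
    "homeomorphism U' V \<Phi> \<Psi>"
    and g: "\<And>y. y \<in> V \<Longrightarrow> (\<Psi> has_derivative (g' y)) (at y)"
    "\<And>y. y \<in> V \<Longrightarrow> g' y = inv (blinfun_apply (B (\<Psi> y)))"
    "\<And>y. y \<in> V \<Longrightarrow> bij (blinfun_apply (B (\<Psi> y)))"
    by metis
  have im: "\<Psi> ` V = U'"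
    using *(6) by (simp add: homeomorphism_def)
  then have \<Psi>U: "\<Psi> y \<in> U" if "y \<in> V" for y
    using that *(2) by blast
  show thesis
  proof (rule that[OF *(1-5)])
    show "\<Psi> z \<in> U' \<and> \<Phi> (\<Psi> z) = z" if "z \<in> V" for z
      using *(6) that im by (auto simp: homeomorphism_def)
    show "\<Psi> (\<Phi> u0) = u0"
      using *(3,6) by (auto simp: homeomorphism_def)
    show "Ck_on k V \<Psi>"
      by (rule Ck_on_inverse_function[OF \<open>open U\<close> \<open>open V\<close> assms(4) _ \<Phi>'(1)])
        (use g \<Psi>U B in auto)
  qed
qed

section \<open>Proximal mappings near a point of prox-regularity\<close>

lemma reg_subdiff_subset_lim_subdiff: "reg_subdiff \<phi> x \<subseteq> lim_subdiff \<phi> x"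
proof
  fix v assume "v \<in> reg_subdiff \<phi> x"
  then show "v \<in> lim_subdiff \<phi> x"
    unfolding lim_subdiff_def by (intro CollectI exI[of _ "\<lambda>_. x"] exI[of _ "\<lambda>_. v"]) auto
qed

text \<open>A convex combination of two linear forms is at most their maximum, so at each point one
  of the two lower bounds suffices. Convexity is what later permits a separating hyperplane.\<close>

lemma convex_reg_subdiff:
  fixes \<phi> :: "real^'n \<Rightarrow> ereal"
  shows "convex (reg_subdiff \<phi> x)"
proof (rule convexI)
  fix v w :: "real^'n" and p q :: real
  assume v: "v \<in> reg_subdiff \<phi> x" and w: "w \<in> reg_subdiff \<phi> x"
    and pq: "0 \<le> p" "0 \<le> q" "p + q = 1"
  from v obtain a where a: "\<phi> x = ereal a"
    unfolding reg_subdiff_def by auto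
  show "p *\<^sub>R v + q *\<^sub>R w \<in> reg_subdiff \<phi> x"
    unfolding reg_subdiff_def
  proof (intro CollectI conjI allI impI)
    show "\<bar>\<phi> x\<bar> \<noteq> \<infinity>" by (simp add: a)
    fix e :: real assume e: "e > 0"
    from v e obtain d1 where d1: "d1 > 0" "\<And>y. norm (y - x) < d1 \<Longrightarrow>
      \<phi> x + ereal (v \<bullet> (y - x) - e * norm (y - x)) \<le> \<phi> y"
      unfolding reg_subdiff_def by blast
    from w e obtain d2 where d2: "d2 > 0" "\<And>y. norm (y - x) < d2 \<Longrightarrow>
      \<phi> x + ereal (w \<bullet> (y - x) - e * norm (y - x)) \<le> \<phi> y"
      unfolding reg_subdiff_def by blast
    have "\<phi> x + ereal ((p *\<^sub>R v + q *\<^sub>R w) \<bullet> (y - x) - e * norm (y - x)) \<le> \<phi> y"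
      if y: "norm (y - x) < min d1 d2" for y
    proof -
      have "(p *\<^sub>R v + q *\<^sub>R w) \<bullet> (y - x) \<le> max (v \<bullet> (y - x)) (w \<bullet> (y - x))"
        unfolding inner_add_left inner_scaleR_left
        using convex_bound_le[of "v \<bullet> (y - x)" "max (v \<bullet> (y - x)) (w \<bullet> (y - x))" "w \<bullet> (y - x)" p q] pq
        by simp
      then show ?thesis
        using d1(2)[of y] d2(2)[of y] y a
        by (cases "\<phi> y") (auto simp: max_def split: if_splits)
    qed
    then show "\<exists>\<delta>>0. \<forall>y. norm (y - x) < \<delta> \<longrightarrow>
      \<phi> x + ereal ((p *\<^sub>R v + q *\<^sub>R w) \<bullet> (y - x) - e * norm (y - x)) \<le> \<phi> y"
      using d1(1) d2(1) by (intro exI[of _ "min d1 d2"]) auto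
  qed
qed

text \<open>The definition of limiting subgradients does not ask for a finite value: prox-regularity
  excludes an infinite one, because the lower bounds at the approximating points
  would force all values nearby to be infinite.\<close>

lemma lim_subdiff_finite:
  assumes "proper_fun \<phi>" "v \<in> lim_subdiff \<phi> x" "prox_regular_at \<phi> x v"
  shows "\<bar>\<phi> x\<bar> \<noteq> \<infinity>"
proof -
  have "\<phi> x \<noteq> \<infinity>"
  proof
    assume inf: "\<phi> x = \<infinity>"
    from assms(3) obtain e \<rho> where e: "e > 0" and reg: "\<And>y u z. u \<in> lim_subdiff \<phi> y \<Longrightarrow>
      norm (u - v) < e \<Longrightarrow> norm (y - x) < e \<Longrightarrow> \<phi> y < \<phi> x + ereal e \<Longrightarrow> z \<in> ball x e \<Longrightarrow>
      \<phi> y + ereal (u \<bullet> (z - y) - \<rho> / 2 * norm (z - y)^2) \<le> \<phi> z"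
      unfolding prox_regular_at_def by blast
    from assms(2) obtain ys us where ys: "\<And>k. us k \<in> reg_subdiff \<phi> (ys k)" "ys \<longlonglongrightarrow> x"
      "(\<lambda>k. \<phi> (ys k)) \<longlonglongrightarrow> \<phi> x" "us \<longlonglongrightarrow> v"
      unfolding lim_subdiff_def by blast
    have fin: "\<bar>\<phi> (ys k)\<bar> \<noteq> \<infinity>" for k
      using ys(1)[of k] by (auto simp: reg_subdiff_def)
    have near: "\<forall>\<^sub>F k in sequentially. norm (ys k - x) < e \<and> norm (us k - v) < e"
      using tendstoD[OF ys(2) e] tendstoD[OF ys(4) e] by eventually_elim (simp add: dist_norm)
    then obtain j where j: "norm (ys j - x) < e"
      using eventually_happens by fastforce
    from fin obtain a where a: "\<phi> (ys j) = ereal a"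
      by (metis abs_ereal.simps(2,3) ereal_cases)
    define c where "c = (\<lambda>k. us k \<bullet> (ys j - ys k) - \<rho> / 2 * norm (ys j - ys k)^2)"
    define c0 where "c0 = v \<bullet> (ys j - x) - \<rho> / 2 * norm (ys j - x)^2"
    have "c \<longlonglongrightarrow> c0"
      unfolding c_def c0_def by (intro tendsto_intros ys)
    then have "\<forall>\<^sub>F k in sequentially. c k > c0 - 1"
      by (rule order_tendstoD) simp
    moreover have "\<forall>\<^sub>F k in sequentially. \<phi> (ys k) > ereal (a - c0 + 1)"
      using ys(3) inf by (simp add: tendsto_PInfty)
    ultimately have "\<forall>\<^sub>F k in sequentially. False"
      using near
    proof eventually_elim
      case (elim k)
      have "\<phi> (ys k) + ereal (c k) \<le> \<phi> (ys j)"
        unfolding c_def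
        using elim ys(1)[of k] reg_subdiff_subset_lim_subdiff fin[of k] inf j
        by (intro reg) (auto simp: dist_norm norm_minus_commute)
      then show False
        using elim a fin[of k] by (cases "\<phi> (ys k)") auto
    qed
    then show False by simp
  qed
  then show ?thesis
    using assms(1) by (auto simp: proper_fun_def)
qed

text \<open>The prox-regularity inequality based at \<open>x\<close> itself has a quadratic error,
  which is of smaller order than the distance.\<close>

lemma prox_regular_lim_subdiff_eq:
  assumes "proper_fun \<phi>" "prox_regular \<phi>"
  shows "lim_subdiff \<phi> x = reg_subdiff \<phi> x"
proof (rule subset_antisym[OF _ reg_subdiff_subset_lim_subdiff], rule subsetI)
  fix v assume v: "v \<in> lim_subdiff \<phi> x"
  then have pr: "prox_regular_at \<phi> x v"
    using assms(2) by (simp add: prox_regular_def)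
  have fin: "\<bar>\<phi> x\<bar> \<noteq> \<infinity>"
    using lim_subdiff_finite[OF assms(1) v pr] .
  then obtain a where a: "\<phi> x = ereal a" by auto
  from pr v a obtain e \<rho> where e: "e > 0" and reg: "\<And>z. z \<in> ball x e \<Longrightarrow>
      \<phi> x + ereal (v \<bullet> (z - x) - \<rho> / 2 * norm (z - x)^2) \<le> \<phi> z"
    unfolding prox_regular_at_def by force
  show "v \<in> reg_subdiff \<phi> x"
    unfolding reg_subdiff_def
  proof (intro CollectI conjI allI impI fin)
    fix r :: real assume r: "r > 0"
    \<comment> \<open>Within this radius the quadratic error is at most
      \<open>r * norm (y - x)\<close>; the summand 1 keeps the denominator positive when
      \<open>\<rho> = 0\<close>.\<close>
    define d where "d = min e (2 * r / (\<bar>\<rho>\<bar> + 1))"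
    have d: "d > 0" using e r by (auto simp: d_def)
    have "\<phi> x + ereal (v \<bullet> (y - x) - r * norm (y - x)) \<le> \<phi> y" if y: "norm (y - x) < d" for y
    proof -
      have "norm (y - x) * (\<bar>\<rho>\<bar> + 1) \<le> 2 * r"
        using y by (simp add: d_def pos_less_divide_eq)
      moreover have "norm (y - x) * \<rho> \<le> norm (y - x) * (\<bar>\<rho>\<bar> + 1)"
        by (intro mult_left_mono) auto
      ultimately have "norm (y - x) * \<rho> / 2 \<le> r" by simp
      then have "norm (y - x) * (norm (y - x) * \<rho> / 2) \<le> norm (y - x) * r"
        by (intro mult_left_mono) auto
      then have "\<rho> / 2 * norm (y - x)^2 \<le> r * norm (y - x)"
        by (simp add: power2_eq_square algebra_simps)
      moreover have "\<phi> x + ereal (v \<bullet> (y - x) - \<rho> / 2 * norm (y - x)^2) \<le> \<phi> y"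
        using y by (intro reg) (auto simp: d_def dist_norm norm_minus_commute)
      ultimately show ?thesis
        unfolding a plus_ereal.simps
        by (meson add_left_mono diff_left_mono ereal_less_eq(3) order_trans)
    qed
    then show "\<exists>\<delta>>0. \<forall>y. norm (y - x) < \<delta> \<longrightarrow> \<phi> x + ereal (v \<bullet> (y - x) - r * norm (y - x)) \<le> \<phi> y"
      using d by blast
  qed
qed

text \<open>Near \<open>x\<close> the local bound serves. Elsewhere the distance to \<open>x\<close>
  is at least \<open>e\<close>, so the constant, linear and quadratic terms left over from
  prox-boundedness can all be absorbed into a multiple of the squared distance.\<close>

lemma prox_bounded_global_minorant:
  assumes "prox_bounded \<phi>" "e > 0"
    and loc: "\<And>y. y \<in> ball x e \<Longrightarrow> ereal (a + v \<bullet> (y - x) - \<rho> / 2 * norm (y - x)^2) \<le> \<phi> y"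
  obtains R where "R > 0" "\<rho> \<le> R"
    "\<And>y. ereal (a + v \<bullet> (y - x) - R / 2 * norm (y - x)^2) \<le> \<phi> y"
proof -
  from assms(1) obtain T y0 c where T: "T > 0"
    and c: "\<And>y. ereal c \<le> \<phi> y + ereal (norm (y - y0)^2 / (2*T))"
    unfolding prox_bounded_def by blast
  define D where "D = norm (x - y0)"
  define W where "W = \<bar>a - c\<bar> + D^2 / T"
  have W0: "W \<ge> 0" using T by (simp add: W_def)
  \<comment> \<open>The first summand ensures \<open>\<rho> \<le> R\<close>. For a distance
    \<open>s \<ge> e\<close> the others dominate the constants collected in \<open>W\<close> (by
    \<open>1 \<le> s^2 / e^2\<close>), the linear term (by \<open>s \<le> s^2 / e\<close>) and the
    quadratic loss \<open>s^2 / T\<close>.\<close>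
  define R where "R = \<bar>\<rho>\<bar> + 2 * (W / e^2 + norm v / e + 1 / T)"
  have R0: "R > 0"
    using T W0 \<open>e > 0\<close> unfolding R_def by (simp add: add_nonneg_pos)
  have \<rho>R: "\<rho> \<le> R"
    using T W0 \<open>e > 0\<close> unfolding R_def by (simp add: add_increasing2)
  have bound: "ereal (a + v \<bullet> (y - x) - R / 2 * norm (y - x)^2) \<le> \<phi> y" for y
  proof (cases "y \<in> ball x e")
    case True
    have "\<rho> / 2 * norm (y - x)^2 \<le> R / 2 * norm (y - x)^2"
      using \<rho>R by (intro mult_right_mono) auto
    then have "ereal (a + v \<bullet> (y - x) - R / 2 * norm (y - x)^2)
        \<le> ereal (a + v \<bullet> (y - x) - \<rho> / 2 * norm (y - x)^2)"
      by simp
    then show ?thesis using loc[OF True] by (rule order_trans)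
  next
    case False
    define s where "s = norm (y - x)"
    have s: "s \<ge> e" using False by (simp add: s_def dist_norm norm_minus_commute)
    then have s0: "s > 0" using \<open>e > 0\<close> by simp
    have "norm (y - y0) \<le> s + D"
      unfolding s_def D_def using norm_triangle_ineq[of "y - x" "x - y0"] by simp
    then have "norm (y - y0)^2 \<le> (s + D)^2"
      by (simp add: power_mono)
    also have "\<dots> \<le> 2 * s^2 + 2 * D^2"
      using zero_le_power2[of "s - D"] by (simp add: power2_eq_square algebra_simps)
    finally have "norm (y - y0)^2 / (2*T) \<le> (2 * s^2 + 2 * D^2) / (2*T)"
      using T by (intro divide_right_mono) auto
    also have "\<dots> = s^2 / T + D^2 / T" using T by (simp add: field_simps)
    finally have 1: "norm (y - y0)^2 / (2*T) \<le> s^2 / T + D^2 / T" .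
    have 2: "v \<bullet> (y - x) \<le> norm v * s"
      unfolding s_def by (rule norm_cauchy_schwarz)
    have es: "1 \<le> s^2 / e^2" "s \<le> s^2 / e"
      using s \<open>e > 0\<close> s0 by (auto simp: power2_eq_square field_simps mult_mono)
    have "W * 1 \<le> W * (s^2 / e^2)"
      using es W0 by (intro mult_left_mono)
    moreover have "norm v * s \<le> norm v * (s^2 / e)"
      using es by (intro mult_left_mono) auto
    moreover have "0 \<le> \<bar>\<rho>\<bar> * s^2" by simp
    moreover have "R / 2 * s^2 = \<bar>\<rho>\<bar> * s^2 / 2 + W * (s^2 / e^2)
        + norm v * (s^2 / e) + s^2 / T"
      unfolding R_def by (simp add: distrib_right add_divide_distrib)
    ultimately have "W + norm v * s + s^2 / T \<le> R / 2 * s^2"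
      by linarith
    then have "a + v \<bullet> (y - x) - R / 2 * s^2 + norm (y - y0)^2 / (2*T) \<le> c"
      using 1 2 unfolding W_def by linarith
    moreover have "ereal c \<le> \<phi> y + ereal (norm (y - y0)^2 / (2*T))" by (rule c)
    ultimately show ?thesis
      unfolding s_def[symmetric] by (cases "\<phi> y") auto
  qed
  show thesis by (rule that[OF R0 \<rho>R bound])
qed

text \<open>A single \<open>R\<close> bounds the curvature both in the global minorant at
  \<open>xb\<close> and in the local inequality at nearby subgradients. Under
  \<open>t * R < 1\<close> the proximal quadratic outweighs both: the first yields existence and
  localization of proximal points, the second uniqueness.\<close>

locale prox_regular_point =
  fixes \<phi> :: "real^'n \<Rightarrow> ereal" and xb vb :: "real^'n" and a R e :: real
  assumes closed: "closed_fun \<phi>" and val: "\<phi> xb = ereal a" and R: "R > 0" and e: "e > 0"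
    and glob: "\<And>y. ereal (a + vb \<bullet> (y - xb) - R / 2 * norm (y - xb)^2) \<le> \<phi> y"
    and loc: "\<And>x v y. v \<in> lim_subdiff \<phi> x \<Longrightarrow> norm (v - vb) < e \<Longrightarrow> norm (x - xb) < e \<Longrightarrow>
        \<phi> x < ereal (a + e) \<Longrightarrow> norm (y - xb) < e \<Longrightarrow>
        \<phi> x + ereal (v \<bullet> (y - x) - R / 2 * norm (y - x)^2) \<le> \<phi> y"

lemma prox_regular_pointI:
  assumes "proper_fun \<phi>" "closed_fun \<phi>" "prox_bounded \<phi>" "prox_regular_at \<phi> xb vb"
    "vb \<in> lim_subdiff \<phi> xb"
  shows "\<exists>a R e. prox_regular_point \<phi> xb vb a R e"
proof -
  obtain a where a: "\<phi> xb = ereal a"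
    using lim_subdiff_finite[OF assms(1,5,4)] by auto
  from assms(4) a obtain e \<rho> where e: "e > 0" and reg: "\<And>y u z. u \<in> lim_subdiff \<phi> y \<Longrightarrow>
      norm (u - vb) < e \<Longrightarrow> norm (y - xb) < e \<Longrightarrow> \<phi> y < ereal (a + e) \<Longrightarrow> z \<in> ball xb e \<Longrightarrow>
      \<phi> y + ereal (u \<bullet> (z - y) - \<rho> / 2 * norm (z - y)^2) \<le> \<phi> z"
    unfolding prox_regular_at_def by (metis plus_ereal.simps(1))
  have "ereal (a + vb \<bullet> (y - xb) - \<rho> / 2 * norm (y - xb)^2) \<le> \<phi> y" if "y \<in> ball xb e" for y
    using reg[OF assms(5), of y] e a that by (simp add: add_diff_eq)
  from prox_bounded_global_minorant[OF assms(3) e this] obtain R where R: "R > 0" "\<rho> \<le> R"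
    "\<And>y. ereal (a + vb \<bullet> (y - xb) - R / 2 * norm (y - xb)^2) \<le> \<phi> y"
    by blast
  have "prox_regular_point \<phi> xb vb a R e"
  proof
    fix x v y
    assume *: "v \<in> lim_subdiff \<phi> x" "norm (v - vb) < e" "norm (x - xb) < e"
      "\<phi> x < ereal (a + e)" "norm (y - xb) < e"
    have "\<rho> / 2 * norm (y - x)^2 \<le> R / 2 * norm (y - x)^2"
      using R(2) by (intro mult_right_mono) auto
    then have "\<phi> x + ereal (v \<bullet> (y - x) - R / 2 * norm (y - x)^2)
       \<le> \<phi> x + ereal (v \<bullet> (y - x) - \<rho> / 2 * norm (y - x)^2)"
      by (intro add_left_mono) simp
    also have "\<dots> \<le> \<phi> y"
      using * by (intro reg) (auto simp: dist_norm norm_minus_commute)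
    finally show "\<phi> x + ereal (v \<bullet> (y - x) - R / 2 * norm (y - x)^2) \<le> \<phi> y" .
  qed (use assms a R e in auto)
  then show ?thesis by blast
qed

section \<open>Existence, localization and uniqueness of proximal points\<close>

context prox_regular_point
begin

lemma not_MInf: "\<phi> y \<noteq> -\<infinity>"
  using glob[of y] by auto

lemma prox_set_finite:
  assumes "x \<in> prox_set t \<phi> z"
  obtains b where "\<phi> x = ereal b"
proof -
  have "\<phi> x + ereal (norm (x - z)^2 / (2*t)) \<le> \<phi> xb + ereal (norm (xb - z)^2 / (2*t))"
    using assms by (simp add: prox_set_def)
  then show thesis
    using val not_MInf[of x] that by (cases "\<phi> x") auto
qed

text \<open>Closedness is a property of the epigraph, so the minimization takes place there: a
  continuous function is minimized over the part of the epigraph whose proximal value does not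
  exceed that of \<open>(xb, a)\<close>. The minorant and \<open>t * R < 1\<close> make this part
  compact.\<close>

lemma prox_set_nonempty:
  assumes t: "0 < t" "t * R < 1"
  shows "\<exists>x. x \<in> prox_set t \<phi> z"
proof -
  define lev where "lev = a + norm (xb - z)^2 / (2*t)"
  define E where "E = {(x, r::real). \<phi> x \<le> ereal r}"
  define K where "K = E \<inter> {(x, r). r + norm (x - z)^2 / (2*t) \<le> lev}"
  have "closed E"
    using closed by (simp add: closed_fun_def E_def)
  moreover have "closed {(x::real^'n, r). r + norm (x - z)^2 / (2*t) \<le> lev}"
    unfolding case_prod_unfold by (intro closed_Collect_le continuous_intros) (use t in auto)
  ultimately have clK: "closed K"
    unfolding K_def by (rule closed_Int)
  \<comment> \<open>\<open>\<kappa>\<close> is half the curvature of the minorant plus the proximal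
    term, and \<open>m\<close> is the norm of the gradient of this sum at \<open>xb\<close>. On
    \<open>K\<close> this gives \<open>\<kappa> * s^2 \<le> m * s\<close> for the distance
    \<open>s\<close> to \<open>xb\<close>, hence the radius \<open>B\<close>.\<close>
  define \<kappa> where "\<kappa> = (1 / t - R) / 2"
  have \<kappa>: "\<kappa> > 0" using t by (simp add: \<kappa>_def field_simps)
  define m where "m = norm (vb - (1 / t) *\<^sub>R (z - xb))"
  define B where "B = m / \<kappa>"
  have inK: "norm (x - xb) \<le> B \<and> r \<le> lev \<and> r \<ge> a - norm vb * B - R / 2 * B^2"
    if "(x, r) \<in> K" for x r
  proof -
    define s where "s = norm (x - xb)"
    have "\<phi> x \<le> ereal r" and l: "r + norm (x - z)^2 / (2*t) \<le> lev"
      using that by (auto simp: K_def E_def)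
    with glob[of x] have g: "a + vb \<bullet> (x - xb) - R / 2 * s^2 \<le> r"
      unfolding s_def by (metis ereal_less_eq(3) order_trans)
    have "norm (x - z)^2 = s^2 - 2 * ((z - xb) \<bullet> (x - xb)) + norm (xb - z)^2"
      unfolding s_def power2_norm_eq_inner by (simp add: algebra_simps inner_commute)
    then have "norm (x - z)^2 / (2*t) = s^2 / (2*t) - (1/t) * ((z - xb) \<bullet> (x - xb)) + norm (xb - z)^2 / (2*t)"
      using t by (simp add: field_simps)
    then have "vb \<bullet> (x - xb) - (1/t) * ((z - xb) \<bullet> (x - xb)) + \<kappa> * s^2 \<le> 0"
    proof -
      have "\<kappa> * s^2 = s^2 / (2*t) - R / 2 * s^2"
        by (simp add: \<kappa>_def diff_divide_distrib left_diff_distrib)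
      with g l \<open>norm (x - z)^2 / (2*t) = _\<close> show ?thesis
        unfolding lev_def by linarith
    qed
    moreover have "vb \<bullet> (x - xb) - (1/t) * ((z - xb) \<bullet> (x - xb)) = (vb - (1 / t) *\<^sub>R (z - xb)) \<bullet> (x - xb)"
      by (simp add: inner_diff_left)
    moreover have "- ((vb - (1 / t) *\<^sub>R (z - xb)) \<bullet> (x - xb)) \<le> m * s"
      unfolding m_def s_def
      using norm_cauchy_schwarz[of "- (vb - (1 / t) *\<^sub>R (z - xb))" "x - xb"]
      by (simp only: inner_minus_left norm_minus_cancel)
    ultimately have "\<kappa> * s^2 \<le> m * s" by linarith
    then have "s * (\<kappa> * s) \<le> s * m" by (simp add: power2_eq_square algebra_simps)
    moreover have "s \<ge> 0" "m \<ge> 0" by (auto simp: s_def m_def)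
    ultimately have sB: "s \<le> B"
      using \<kappa> by (cases "s = 0") (auto simp: B_def field_simps)
    have "norm vb * s \<le> norm vb * B" "R / 2 * s^2 \<le> R / 2 * B^2"
      using sB \<open>s \<ge> 0\<close> R by (auto intro!: mult_left_mono power_mono)
    moreover have "- (vb \<bullet> (x - xb)) \<le> norm vb * s"
      unfolding s_def using norm_cauchy_schwarz[of "- vb" "x - xb"] by simp
    moreover have "norm (x - z)^2 / (2*t) \<ge> 0" using t by simp
    ultimately show ?thesis
      using g l sB unfolding s_def by linarith
  qed
  have "K \<subseteq> cball xb B \<times> {a - norm vb * B - R / 2 * B^2..lev}"
    using inK by (auto simp: dist_norm norm_minus_commute)
  moreover have "bounded (cball xb B \<times> {a - norm vb * B - R / 2 * B^2..lev})"
    by (intro bounded_Times) auto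
  ultimately have "bounded K" using bounded_subset by blast
  with clK have "compact K" by (simp add: compact_eq_bounded_closed)
  moreover have xbK: "(xb, a) \<in> K" by (simp add: K_def E_def val lev_def)
  moreover have "continuous_on K (\<lambda>q. snd q + norm (fst q - z)^2 / (2*t))"
    using t by (intro continuous_intros) auto
  ultimately obtain q where q: "q \<in> K"
    "\<And>q'. q' \<in> K \<Longrightarrow> snd q + norm (fst q - z)^2 / (2*t) \<le> snd q' + norm (fst q' - z)^2 / (2*t)"
    using continuous_attains_inf[of K "\<lambda>q. snd q + norm (fst q - z)^2 / (2*t)"] by blast
  obtain x r where xr: "q = (x, r)" by (cases q)
  have xr1: "\<phi> x \<le> ereal r" "r + norm (x - z)^2 / (2*t) \<le> lev"
    using q(1) by (auto simp: xr K_def E_def)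
  have "\<phi> x + ereal (norm (x - z)^2 / (2*t)) \<le> \<phi> x' + ereal (norm (x' - z)^2 / (2*t))" for x'
  proof (cases "\<phi> x'")
    case (real r')
    have "r + norm (x - z)^2 / (2*t) \<le> r' + norm (x' - z)^2 / (2*t)"
    proof (cases "(x', r') \<in> K")
      case True
      then show ?thesis using q(2)[OF True] by (simp add: xr)
    next
      case False
      then show ?thesis using xr1(2) real by (auto simp: K_def E_def)
    qed
    then have "ereal r + ereal (norm (x - z)^2 / (2*t)) \<le> \<phi> x' + ereal (norm (x' - z)^2 / (2*t))"
      by (simp add: real)
    then show ?thesis using xr1(1) by (meson add_right_mono order_trans)
  qed (use not_MInf in auto)
  then show ?thesis unfolding prox_set_def by blast
qed

text \<open>After comparing the minimizer with \<open>xb\<close> and inserting the global minorant,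
  only \<open>s^2 * (1 - t * R)\<close> and the pairing with the displacement \<open>d\<close> of
  \<open>z\<close> from the base point remain. The bound determines the proximal point at the base
  and later bounds the difference quotients.\<close>

lemma prox_set_dist:
  assumes t: "0 < t" "t * R < 1" and x: "x \<in> prox_set t \<phi> z"
  shows "norm (x - xb) \<le> 2 * norm (z - (xb + t *\<^sub>R vb)) / (1 - t * R)"
proof -
  obtain b where b: "\<phi> x = ereal b" using prox_set_finite[OF x] .
  define s where "s = norm (x - xb)"
  define d where "d = z - (xb + t *\<^sub>R vb)"
  have z: "z = xb + t *\<^sub>R vb + d" by (simp add: d_def)
  have "b + norm (x - z)^2 / (2*t) \<le> a + norm (xb - z)^2 / (2*t)"
    using x b val by (auto simp: prox_set_def dest: spec[of _ xb])
  moreover have "a + vb \<bullet> (x - xb) - R / 2 * s^2 \<le> b"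
    using glob[of x] by (simp add: b s_def)
  moreover have "norm (x - z)^2 = s^2 - 2 * t * (vb \<bullet> (x - xb)) - 2 * (d \<bullet> (x - xb)) + norm (xb - z)^2"
    unfolding s_def z power2_norm_eq_inner by (simp add: algebra_simps inner_commute)
  then have "norm (x - z)^2 / (2*t) = s^2 / (2*t) - vb \<bullet> (x - xb) - (d \<bullet> (x - xb)) / t + norm (xb - z)^2 / (2*t)"
    using t by (simp only: diff_divide_distrib add_divide_distrib) simp
  ultimately have "s^2 / (2*t) - (d \<bullet> (x - xb)) / t - R / 2 * s^2 \<le> 0"
    by linarith
  then have "s^2 * (1 - t * R) \<le> 2 * (d \<bullet> (x - xb))"
    using t by (simp add: field_simps)
  also have "\<dots> \<le> 2 * (norm d * s)"
    unfolding s_def using norm_cauchy_schwarz[of d "x - xb"] by simp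
  finally have "s * (s * (1 - t * R)) \<le> s * (2 * norm d)"
    by (simp add: power2_eq_square algebra_simps)
  moreover have "s \<ge> 0" by (simp add: s_def)
  ultimately have "s * (1 - t * R) \<le> 2 * norm d"
    by (cases "s = 0") auto
  then show ?thesis
    using t by (simp add: s_def d_def pos_le_divide_eq)
qed

text \<open>Minimality gives the subgradient inequality up to the error
  \<open>norm (y - x)^2 / (2*t)\<close>, which stays below \<open>r * norm (y - x)\<close> within
  the radius \<open>2 * t * r\<close>.\<close>

lemma prox_set_subgradient:
  assumes t: "0 < t" and x: "x \<in> prox_set t \<phi> z"
  shows "(1 / t) *\<^sub>R (z - x) \<in> reg_subdiff \<phi> x"
proof -
  obtain b where b: "\<phi> x = ereal b" using prox_set_finite[OF x] .
  show ?thesis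
    unfolding reg_subdiff_def
  proof (intro CollectI conjI allI impI)
    show "\<bar>\<phi> x\<bar> \<noteq> \<infinity>" by (simp add: b)
    fix r :: real assume r: "r > 0"
    have "\<phi> x + ereal (((1 / t) *\<^sub>R (z - x)) \<bullet> (y - x) - r * norm (y - x)) \<le> \<phi> y"
      if y: "norm (y - x) < 2 * t * r" for y
    proof -
      have "norm (y - z)^2 = norm (y - x)^2 - 2 * ((z - x) \<bullet> (y - x)) + norm (x - z)^2"
        unfolding power2_norm_eq_inner by (simp add: algebra_simps inner_commute)
      then have "norm (y - z)^2 / (2*t) = norm (y - x)^2 / (2*t) - ((1 / t) *\<^sub>R (z - x)) \<bullet> (y - x)
          + norm (x - z)^2 / (2*t)"
        using t by (simp only: diff_divide_distrib add_divide_distrib inner_scaleR_left) simp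
      moreover have "norm (y - x) * norm (y - x) \<le> norm (y - x) * (2 * t * r)"
        using y by (intro mult_left_mono) auto
      then have "norm (y - x)^2 / (2*t) \<le> r * norm (y - x)"
        using t by (simp add: power2_eq_square field_simps)
      moreover have "\<phi> x + ereal (norm (x - z)^2 / (2*t)) \<le> \<phi> y + ereal (norm (y - z)^2 / (2*t))"
        using x by (simp add: prox_set_def)
      ultimately show ?thesis
        using b by (cases "\<phi> y") auto
    qed
    then show "\<exists>\<delta>>0. \<forall>y. norm (y - x) < \<delta> \<longrightarrow>
        \<phi> x + ereal (((1 / t) *\<^sub>R (z - x)) \<bullet> (y - x) - r * norm (y - x)) \<le> \<phi> y"
      using t r by (intro exI[of _ "2 * t * r"]) auto
  qed
qed

text \<open>The two local inequalities, each based at one point and evaluated at the other, add up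
  to hypomonotonicity, here \<open>1 / t * norm (x - y)^2 \<le> R * norm (x - y)^2\<close>. With
  \<open>t * R < 1\<close> only distance zero is left.\<close>

lemma resolvent_unique:
  assumes t: "0 < t" "t * R < 1"
    and x: "(1 / t) *\<^sub>R (z - x) \<in> lim_subdiff \<phi> x" "norm ((1 / t) *\<^sub>R (z - x) - vb) < e"
      "norm (x - xb) < e" "\<phi> x < ereal (a + e)"
    and y: "(1 / t) *\<^sub>R (z - y) \<in> lim_subdiff \<phi> y" "norm ((1 / t) *\<^sub>R (z - y) - vb) < e"
      "norm (y - xb) < e" "\<phi> y < ereal (a + e)"
  shows "x = y"
proof -
  obtain b where b: "\<phi> x = ereal b" using x(4) not_MInf[of x] by (cases "\<phi> x") auto
  obtain c where c: "\<phi> y = ereal c" using y(4) not_MInf[of y] by (cases "\<phi> y") auto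
  have "b + (((1 / t) *\<^sub>R (z - x)) \<bullet> (y - x) - R / 2 * norm (y - x)^2) \<le> c"
    using loc[OF x y(3)] by (simp add: b c)
  moreover have "c + (((1 / t) *\<^sub>R (z - y)) \<bullet> (x - y) - R / 2 * norm (x - y)^2) \<le> b"
    using loc[OF y x(3)] by (simp add: b c)
  moreover have "((1 / t) *\<^sub>R (z - x)) \<bullet> (y - x) + ((1 / t) *\<^sub>R (z - y)) \<bullet> (x - y)
      = (1 / t) * norm (x - y)^2"
    unfolding power2_norm_eq_inner by (simp add: algebra_simps inner_commute)
  ultimately have "(1 / t) * norm (x - y)^2 \<le> R * norm (x - y)^2"
    by (simp add: norm_minus_commute)
  then have "(1 - t * R) * norm (x - y)^2 \<le> 0"
    using t by (simp add: field_simps)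
  then show ?thesis
    using t by (simp add: mult_le_0_iff)
qed

text \<open>Near the base point every minimizer meets the demands of \<open>resolvent_unique\<close>
  on the point, the subgradient and the value. Hence a nearby solution of the resolvent inclusion is
  already the global minimizer, and two minimizers coincide.\<close>

lemma prox_unique_near:
  assumes t: "0 < t" "t * R < 1"
  obtains \<delta> where "\<delta> > 0"
    "\<And>z x x'. norm (z - (xb + t *\<^sub>R vb)) < \<delta> \<Longrightarrow> x \<in> prox_set t \<phi> z \<Longrightarrow>
       (1 / t) *\<^sub>R (z - x') \<in> lim_subdiff \<phi> x' \<Longrightarrow> norm (x' - xb) < \<delta> \<Longrightarrow>
       \<phi> x' < ereal (a + \<delta>) \<Longrightarrow> x' = x"
    "\<And>z x x'. norm (z - (xb + t *\<^sub>R vb)) < \<delta> \<Longrightarrow> x \<in> prox_set t \<phi> z \<Longrightarrow>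
       x' \<in> prox_set t \<phi> z \<Longrightarrow> x' = x"
proof -
  \<comment> \<open>For \<open>x\<close> within \<open>\<mu> \<le> 1\<close> of \<open>xb\<close>,
    the squared distances of \<open>xb\<close> and \<open>x\<close> to \<open>z\<close> differ by at
    most \<open>\<mu> * (2 * t * norm vb + 3)\<close>, so \<open>\<mu> * C\<close> bounds the excess
    of \<open>\<phi> x\<close> over \<open>a\<close>. The bound \<open>t * e / 2\<close> in
    \<open>\<mu>\<close> keeps the subgradients within \<open>e\<close> of
    \<open>vb\<close>.\<close>
  define C where "C = (2 * t * norm vb + 3) / (2 * t)"
  define \<mu> where "\<mu> = min (min 1 e) (min (t * e / 2) (e / (2 * C)))"
  have C: "C > 0" using t unfolding C_def by (intro divide_pos_pos) (auto simp: add_nonneg_pos)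
  have \<mu>: "\<mu> > 0" "\<mu> \<le> 1" "\<mu> \<le> e" "2 * \<mu> \<le> t * e" "\<mu> * C < e"
  proof -
    show "\<mu> > 0" "\<mu> \<le> 1" "\<mu> \<le> e"
      using t e C by (auto simp: \<mu>_def)
    have "\<mu> \<le> t * e / 2" by (simp add: \<mu>_def)
    then show "2 * \<mu> \<le> t * e" by simp
    have "\<mu> \<le> e / (2 * C)" by (simp add: \<mu>_def)
    then have "\<mu> * C \<le> e / 2" using C by (simp add: field_simps)
    then show "\<mu> * C < e" using e by simp
  qed
  \<comment> \<open>By \<open>prox_set_dist\<close> this radius places every minimizer within
    \<open>\<mu>\<close> of \<open>xb\<close>.\<close>
  define \<delta> where "\<delta> = \<mu> * (1 - t * R) / 2"
  have \<delta>0: "\<delta> > 0" using \<mu> t by (simp add: \<delta>_def)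
  have \<delta>\<mu>: "\<delta> \<le> \<mu>"
  proof -
    have "\<mu> * (1 - t * R) \<le> \<mu> * 1" using \<mu>(1) t R by (intro mult_left_mono) auto
    then show ?thesis using \<mu>(1) unfolding \<delta>_def by simp
  qed
  have subg: "norm ((1 / t) *\<^sub>R (z - x) - vb) < e"
    if "norm (z - (xb + t *\<^sub>R vb)) < \<delta>" "norm (x - xb) < \<mu>" for z x
  proof -
    have "(1 / t) *\<^sub>R (z - x) - vb = (1 / t) *\<^sub>R ((z - (xb + t *\<^sub>R vb)) - (x - xb))"
      using t by (simp add: algebra_simps)
    then have "norm ((1 / t) *\<^sub>R (z - x) - vb) = (1 / t) * norm ((z - (xb + t *\<^sub>R vb)) - (x - xb))"
      using t by simp
    also have "\<dots> \<le> (1 / t) * (norm (z - (xb + t *\<^sub>R vb)) + norm (x - xb))"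
      using t by (intro mult_left_mono norm_triangle_ineq4) auto
    also have "\<dots> < (1 / t) * (2 * \<mu>)"
      using that \<delta>\<mu> t by (intro mult_strict_left_mono) auto
    also have "\<dots> \<le> e" using \<mu>(4) t by (simp add: field_simps)
    finally show ?thesis .
  qed
  have prox: "(1 / t) *\<^sub>R (z - x) \<in> lim_subdiff \<phi> x \<and> norm (x - xb) < \<mu> \<and> \<phi> x < ereal (a + e)"
    if z: "norm (z - (xb + t *\<^sub>R vb)) < \<delta>" and x: "x \<in> prox_set t \<phi> z" for z x
  proof -
    have "norm (x - xb) \<le> 2 * norm (z - (xb + t *\<^sub>R vb)) / (1 - t * R)"
      by (rule prox_set_dist[OF t x])
    also have "\<dots> < 2 * \<delta> / (1 - t * R)"
      using z t by (intro divide_strict_right_mono) auto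
    also have "\<dots> = \<mu>" using t by (simp add: \<delta>_def)
    finally have near: "norm (x - xb) < \<mu>" .
    obtain b where b: "\<phi> x = ereal b" using prox_set_finite[OF x] .
    have 1: "b \<le> a + (norm (xb - z)^2 - norm (x - z)^2) / (2*t)"
      using x b val by (auto simp: prox_set_def diff_divide_distrib dest: spec[of _ xb])
    have n: "norm (xb - z) \<le> t * norm vb + 1"
    proof -
      have "xb - z = - (z - (xb + t *\<^sub>R vb)) - t *\<^sub>R vb" by simp
      then have "norm (xb - z) \<le> norm (z - (xb + t *\<^sub>R vb)) + norm (t *\<^sub>R vb)"
        using norm_triangle_ineq4[of "- (z - (xb + t *\<^sub>R vb))" "t *\<^sub>R vb"] by (simp only: norm_minus_cancel)
      then show ?thesis using z \<delta>\<mu> \<mu>(2) t by simp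
    qed
    have tri: "norm (xb - z) \<le> norm (x - xb) + norm (x - z)" "norm (x - z) \<le> norm (x - xb) + norm (xb - z)"
      using norm_triangle_ineq4[of "x - z" "x - xb"] norm_triangle_ineq[of "x - xb" "xb - z"] by simp_all
    have "norm (xb - z)^2 - norm (x - z)^2 = (norm (xb - z) - norm (x - z)) * (norm (xb - z) + norm (x - z))"
      by (simp add: power2_eq_square algebra_simps)
    also have "\<dots> \<le> norm (x - xb) * (norm (xb - z) + norm (x - z))"
      using tri by (intro mult_right_mono) auto
    also have "\<dots> \<le> norm (x - xb) * (2 * t * norm vb + 3)"
      using tri n near \<mu>(2) by (intro mult_left_mono) auto
    also have "\<dots> \<le> \<mu> * (2 * t * norm vb + 3)"
      using near t by (intro mult_right_mono) auto
    finally have "(norm (xb - z)^2 - norm (x - z)^2) / (2*t) \<le> \<mu> * (2 * t * norm vb + 3) / (2*t)"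
      using t by (intro divide_right_mono) auto
    then have "b < a + e" using 1 \<mu>(5) by (simp add: C_def)
    moreover have "(1 / t) *\<^sub>R (z - x) \<in> lim_subdiff \<phi> x"
      using prox_set_subgradient[OF t(1) x] reg_subdiff_subset_lim_subdiff by blast
    ultimately show ?thesis using near b by simp
  qed
  show thesis
  proof (rule that[OF \<delta>0])
    fix z x x'
    assume z: "norm (z - (xb + t *\<^sub>R vb)) < \<delta>" and x: "x \<in> prox_set t \<phi> z"
    have x1: "(1 / t) *\<^sub>R (z - x) \<in> lim_subdiff \<phi> x" "norm (x - xb) < \<mu>" "norm (x - xb) < e"
        "\<phi> x < ereal (a + e)"
      using prox[OF z x] \<mu>(3) by auto
    show "x' = x" if "(1 / t) *\<^sub>R (z - x') \<in> lim_subdiff \<phi> x'" "norm (x' - xb) < \<delta>"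
      "\<phi> x' < ereal (a + \<delta>)"
    proof (rule resolvent_unique[OF t that(1) subg[OF z] _ _ x1(1) subg[OF z x1(2)] x1(3,4)])
      show "norm (x' - xb) < \<mu>" "norm (x' - xb) < e" using that \<delta>\<mu> \<mu>(3) by auto
      have "ereal (a + \<delta>) \<le> ereal (a + e)" using \<delta>\<mu> \<mu>(3) by simp
      then show "\<phi> x' < ereal (a + e)" using that(3) by (rule less_le_trans[rotated])
    qed
    show "x' = x" if x': "x' \<in> prox_set t \<phi> z"
    proof -
      have x1': "(1 / t) *\<^sub>R (z - x') \<in> lim_subdiff \<phi> x'" "norm (x' - xb) < \<mu>" "norm (x' - xb) < e"
        "\<phi> x' < ereal (a + e)"
        using prox[OF z x'] \<mu>(3) by auto
      show ?thesis
        by (rule resolvent_unique[OF t x1'(1) subg[OF z x1'(2)] x1'(3,4) x1(1) subg[OF z x1(2)] x1(3,4)])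
    qed
  qed
qed

lemma prox_at_base:
  assumes t: "0 < t" "t * R < 1"
  shows "prox_set t \<phi> (xb + t *\<^sub>R vb) = {xb}" and "prox t \<phi> (xb + t *\<^sub>R vb) = xb"
proof -
  obtain x where x: "x \<in> prox_set t \<phi> (xb + t *\<^sub>R vb)"
    using prox_set_nonempty[OF t] by blast
  have "y = xb" if "y \<in> prox_set t \<phi> (xb + t *\<^sub>R vb)" for y
    using prox_set_dist[OF t that] by simp
  with x show *: "prox_set t \<phi> (xb + t *\<^sub>R vb) = {xb}" by blast
  then show "prox t \<phi> (xb + t *\<^sub>R vb) = xb"
    by (simp add: prox_def)
qed

end

section \<open>Differentiability from epi-differentiability\<close>

text \<open>First-order condition at the minimum \<open>r = 0\<close>. The test value
  \<open>- b / (2 * C)\<close> minimizes the majorant with \<open>c\<close> raised to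
  \<open>C\<close>, which is positive whatever the sign of \<open>c\<close>.\<close>

lemma linear_coefficient_zero:
  fixes b c :: real
  assumes "\<And>r. 0 \<le> r * b + r^2 * c"
  shows "b = 0"
proof -
  define C where "C = \<bar>c\<bar> + 1"
  have C: "C > 0" "c \<le> C" by (auto simp: C_def)
  have "0 \<le> (- b / (2 * C)) * b + (- b / (2 * C))^2 * c" by (rule assms)
  also have "\<dots> \<le> (- b / (2 * C)) * b + (- b / (2 * C))^2 * C"
    using C by (intro add_left_mono mult_left_mono) auto
  also have "\<dots> = - (b^2 / (4 * C))"
    using C by (simp add: field_simps power2_eq_square)
  finally have "b^2 \<le> 0"
    using C by (simp add: field_simps)
  then show ?thesis by simp
qed

section \<open>Rescaled proximal problems and second-order quotients\<close>

context prox_regular_point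
begin

lemma sec_quot_eq_infinity:
  assumes "\<tau> > 0" "\<phi> (xb + \<tau> *\<^sub>R u) = \<infinity>"
  shows "sec_quot \<phi> xb vb \<tau> u = \<infinity>"
  using assms by (simp add: sec_quot_def val)

lemma sec_quot_eq_real:
  assumes "\<phi> (xb + \<tau> *\<^sub>R u) = ereal r"
  shows "sec_quot \<phi> xb vb \<tau> u = ereal (2 / \<tau>^2 * (r - a - \<tau> * (vb \<bullet> u)))"
  using assms by (simp add: sec_quot_def val)

lemma sec_quot_ge:
  assumes "\<tau> > 0"
  shows "ereal (- R * norm u^2) \<le> sec_quot \<phi> xb vb \<tau> u"
proof (cases "\<phi> (xb + \<tau> *\<^sub>R u)")
  case (real r)
  have "a + \<tau> * (vb \<bullet> u) - R / 2 * (\<tau>^2 * norm u^2) \<le> r"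
    using glob[of "xb + \<tau> *\<^sub>R u"] real by (simp add: power_mult_distrib)
  then have "- R / 2 * (\<tau>^2 * norm u^2) \<le> r - a - \<tau> * (vb \<bullet> u)" by simp
  then have "2 / \<tau>^2 * (- R / 2 * (\<tau>^2 * norm u^2)) \<le> 2 / \<tau>^2 * (r - a - \<tau> * (vb \<bullet> u))"
    by (intro mult_left_mono) auto
  then show ?thesis
    using assms by (simp add: sec_quot_eq_real[OF real])
qed (use assms not_MInf sec_quot_eq_infinity in auto)

text \<open>This is the proximal inequality in the variable \<open>u\<close>, with constants removed
  and multiplied by \<open>2 / \<tau>^2\<close>. Expanding the square contributes exactly the linear
  term that the second-order quotient subtracts.\<close>

lemma prox_scaled_minimizer:
  assumes "t > 0" "\<tau> > 0" "xb + \<tau> *\<^sub>R u \<in> prox_set t \<phi> (xb + t *\<^sub>R vb + \<tau> *\<^sub>R d)"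
  shows "sec_quot \<phi> xb vb \<tau> u + ereal (norm (u - d)^2 / t)
    \<le> sec_quot \<phi> xb vb \<tau> u' + ereal (norm (u' - d)^2 / t)"
proof (cases "\<phi> (xb + \<tau> *\<^sub>R u')")
  case (real r')
  obtain r where r: "\<phi> (xb + \<tau> *\<^sub>R u) = ereal r"
    using prox_set_finite[OF assms(3)] .
  let ?z = "xb + t *\<^sub>R vb + \<tau> *\<^sub>R d"
  have "\<phi> (xb + \<tau> *\<^sub>R u) + ereal (norm (xb + \<tau> *\<^sub>R u - ?z)^2 / (2*t))
      \<le> \<phi> (xb + \<tau> *\<^sub>R u') + ereal (norm (xb + \<tau> *\<^sub>R u' - ?z)^2 / (2*t))"
    using assms(3) unfolding prox_set_def by blast
  then have 1: "r + norm (xb + \<tau> *\<^sub>R u - ?z)^2 / (2*t) \<le> r' + norm (xb + \<tau> *\<^sub>R u' - ?z)^2 / (2*t)"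
    by (simp only: r real plus_ereal.simps ereal_less_eq)
  have 2: "norm (xb + \<tau> *\<^sub>R w - ?z)^2 / (2*t)
      = \<tau>^2 / 2 * (norm (w - d)^2 / t) - \<tau> * (vb \<bullet> w) + (\<tau> * (vb \<bullet> d) + t / 2 * norm vb^2)" for w
  proof -
    have "norm (xb + \<tau> *\<^sub>R w - ?z)^2
        = \<tau>^2 * norm (w - d)^2 - 2 * t * (\<tau> * (vb \<bullet> w)) + 2 * t * (\<tau> * (vb \<bullet> d)) + t^2 * norm vb^2"
      unfolding power2_norm_eq_inner by (simp add: algebra_simps inner_commute power2_eq_square)
    then show ?thesis
      using assms(1)
      by (simp only: diff_divide_distrib add_divide_distrib) (simp add: power2_eq_square)
  qed
  have "r - a - \<tau> * (vb \<bullet> u) + \<tau>^2 / 2 * (norm (u - d)^2 / t)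
      \<le> r' - a - \<tau> * (vb \<bullet> u') + \<tau>^2 / 2 * (norm (u' - d)^2 / t)"
    using 1 unfolding 2 by linarith
  then have 3: "2 / \<tau>^2 * (r - a - \<tau> * (vb \<bullet> u) + \<tau>^2 / 2 * (norm (u - d)^2 / t))
      \<le> 2 / \<tau>^2 * (r' - a - \<tau> * (vb \<bullet> u') + \<tau>^2 / 2 * (norm (u' - d)^2 / t))"
    by (intro mult_left_mono) auto
  have 4: "2 / \<tau>^2 * (c + \<tau>^2 / 2 * q) = 2 / \<tau>^2 * c + q" for c q
    using assms(2) by (simp add: distrib_left)
  show ?thesis
    using 3 unfolding 4 sec_quot_eq_real[OF r] sec_quot_eq_real[OF real] plus_ereal.simps
    by (simp only: ereal_less_eq)
qed (use assms not_MInf sec_quot_eq_infinity in auto)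

end

locale prox_epi_point = prox_regular_point +
  fixes t :: real and A :: "real^'n^'n" and S :: "(real^'n) set"
  assumes t: "0 < t" "t * R < 1" and epi: "twice_epi_diff \<phi> xb vb" and S: "subspace S"
    and quad: "\<And>u. sec_subderiv \<phi> xb vb u = (if u \<in> S then ereal (u \<bullet> (A *v u)) else \<infinity>)"
begin

lemma recovery_sequence:
  assumes "\<And>k. \<tau> k > 0" "\<tau> \<longlonglongrightarrow> 0" "u \<in> S"
  shows "\<exists>us. us \<longlonglongrightarrow> u \<and>
    (\<forall>r>0. \<forall>\<^sub>F k in sequentially. sec_quot \<phi> xb vb (\<tau> k) (us k) < ereal (u \<bullet> (A *v u) + r))"
proof -
  from epi assms(1,2) obtain us where us: "us \<longlonglongrightarrow> u"
    "limsup (\<lambda>k. sec_quot \<phi> xb vb (\<tau> k) (us k)) \<le> sec_subderiv \<phi> xb vb u"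
    unfolding twice_epi_diff_def by blast
  show ?thesis
  proof (intro exI[of _ us] conjI us(1) allI impI)
    fix r :: real assume "r > 0"
    then have "sec_subderiv \<phi> xb vb u < ereal (u \<bullet> (A *v u) + r)"
      using assms(3) by (simp add: quad)
    with us(2) have "limsup (\<lambda>k. sec_quot \<phi> xb vb (\<tau> k) (us k)) < ereal (u \<bullet> (A *v u) + r)"
      by (rule le_less_trans)
    then show "\<forall>\<^sub>F k in sequentially. sec_quot \<phi> xb vb (\<tau> k) (us k) < ereal (u \<bullet> (A *v u) + r)"
      by (rule Limsup_lessD)
  qed
qed

text \<open>The bound \<open>sec_quot_ge\<close> survives the limit along a recovery sequence. Since
  \<open>R < 1 / t\<close>, adding \<open>norm u^2 / t\<close> makes the quadratic strictly convex
  on \<open>S\<close>.\<close>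

lemma quad_ge:
  assumes "u \<in> S"
  shows "- R * norm u^2 \<le> u \<bullet> (A *v u)"
proof (rule field_le_epsilon)
  fix r :: real assume "r > 0"
  define \<tau> where "\<tau> = (\<lambda>k. inverse (real (Suc k)))"
  have \<tau>: "\<And>k. \<tau> k > 0" "\<tau> \<longlonglongrightarrow> 0"
    unfolding \<tau>_def by (simp, rule LIMSEQ_inverse_real_of_nat)
  obtain us where us: "us \<longlonglongrightarrow> u"
    "\<And>r. r > 0 \<Longrightarrow> \<forall>\<^sub>F k in sequentially. sec_quot \<phi> xb vb (\<tau> k) (us k) < ereal (u \<bullet> (A *v u) + r)"
    using recovery_sequence[OF \<tau> assms] by blast
  have "\<forall>\<^sub>F k in sequentially. - R * norm (us k)^2 \<le> u \<bullet> (A *v u) + r"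
    using us(2)[OF \<open>r > 0\<close>]
  proof eventually_elim
    case (elim k)
    then have "ereal (- R * norm (us k)^2) < ereal (u \<bullet> (A *v u) + r)"
      using sec_quot_ge[OF \<tau>(1)] le_less_trans by blast
    then show ?case by simp
  qed
  moreover have "(\<lambda>k. - R * norm (us k)^2) \<longlonglongrightarrow> - R * norm u^2"
    by (intro tendsto_intros us)
  ultimately show "- R * norm u^2 \<le> u \<bullet> (A *v u) + r"
    by (intro tendsto_upperbound[OF _ _ sequentially_bot])
qed

text \<open>The stationarity condition for minimizing
  \<open>u \<bullet> (A *v u) + norm (u - d)^2 / t\<close> over \<open>S\<close>. Both mixed terms
  appear because \<open>A\<close> may be non-symmetric.\<close>

definition prox_deriv_rel :: "real^'n \<Rightarrow> real^'n \<Rightarrow> bool" where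
  "prox_deriv_rel d u \<longleftrightarrow> u \<in> S \<and>
    (\<forall>s\<in>S. u \<bullet> (A *v s) + s \<bullet> (A *v u) + 2 / t * ((u - d) \<bullet> s) = 0)"

text \<open>Subtracting the two conditions and testing with the difference \<open>w\<close> gives
  \<open>w \<bullet> (A *v w) + 1 / t * norm w^2 = 0\<close>, which \<open>quad_ge\<close> permits
  only for \<open>w = 0\<close>.\<close>

lemma prox_deriv_rel_unique:
  assumes "prox_deriv_rel d u" "prox_deriv_rel d u'"
  shows "u = u'"
proof -
  define w where "w = u - u'"
  have wS: "w \<in> S"
    using assms S by (simp add: w_def prox_deriv_rel_def subspace_diff)
  then have "u \<bullet> (A *v w) + w \<bullet> (A *v u) + 2 / t * ((u - d) \<bullet> w) = 0"
    "u' \<bullet> (A *v w) + w \<bullet> (A *v u') + 2 / t * ((u' - d) \<bullet> w) = 0"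
    using assms by (auto simp: prox_deriv_rel_def)
  then have "(u - u') \<bullet> (A *v w) + w \<bullet> (A *v (u - u')) + 2 / t * ((u - u') \<bullet> w) = 0"
    by (simp add: inner_diff_left inner_diff_right matrix_vector_mult_diff_distrib algebra_simps)
  then have "w \<bullet> (A *v w) + 1 / t * norm w^2 = 0"
    unfolding w_def[symmetric] power2_norm_eq_inner by simp
  with quad_ge[OF wS] have "1 / t * norm w^2 \<le> R * norm w^2" by linarith
  then have "(1 - t * R) * norm w^2 \<le> 0"
    using t by (simp add: field_simps)
  then have "w = 0" using t by (simp add: mult_le_0_iff)
  then show ?thesis by (simp add: w_def)
qed

text \<open>The lower half of epi-convergence bounds the quotients at \<open>us\<close> from below,
  and a recovery sequence for \<open>w \<in> S\<close> bounds the competing ones from above. Hence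
  \<open>u\<close> minimizes the limit quadratic over \<open>S\<close>, and variations of
  \<open>u\<close> along \<open>s \<in> S\<close> give stationarity.\<close>

lemma limit_prox_deriv_rel:
  assumes \<tau>: "\<And>k. \<tau> k > 0" "\<tau> \<longlonglongrightarrow> 0" and d: "ds \<longlonglongrightarrow> d" and u: "us \<longlonglongrightarrow> u"
    and prox: "\<And>k. xb + \<tau> k *\<^sub>R us k \<in> prox_set t \<phi> (xb + t *\<^sub>R vb + \<tau> k *\<^sub>R ds k)"
  shows "prox_deriv_rel d u"
proof -
  have upper: "sec_subderiv \<phi> xb vb u
      \<le> ereal (w \<bullet> (A *v w) + (norm (w - d)^2 / t - norm (u - d)^2 / t))" if w: "w \<in> S" for w
  proof (rule ereal_le_epsilon2)
    fix r :: real assume r: "r > 0"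
    obtain ws where ws: "ws \<longlonglongrightarrow> w"
      "\<And>r. r > 0 \<Longrightarrow> \<forall>\<^sub>F k in sequentially. sec_quot \<phi> xb vb (\<tau> k) (ws k) < ereal (w \<bullet> (A *v w) + r)"
      using recovery_sequence[OF \<tau> w] by blast
    have "(\<lambda>k. norm (ws k - ds k)^2 / t - norm (us k - ds k)^2 / t)
        \<longlonglongrightarrow> norm (w - d)^2 / t - norm (u - d)^2 / t"
      using t by (intro tendsto_intros ws d u) auto
    then have "\<forall>\<^sub>F k in sequentially. norm (ws k - ds k)^2 / t - norm (us k - ds k)^2 / t
        < norm (w - d)^2 / t - norm (u - d)^2 / t + r / 2"
      using r by (intro order_tendstoD) auto
    moreover have "\<forall>\<^sub>F k in sequentially. sec_quot \<phi> xb vb (\<tau> k) (ws k) < ereal (w \<bullet> (A *v w) + r / 2)"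
      using r by (intro ws(2)) simp
    ultimately have "\<forall>\<^sub>F k in sequentially. sec_quot \<phi> xb vb (\<tau> k) (us k)
        \<le> ereal (w \<bullet> (A *v w) + (norm (w - d)^2 / t - norm (u - d)^2 / t)) + ereal r"
    proof eventually_elim
      case (elim k)
      have "sec_quot \<phi> xb vb (\<tau> k) (us k) + ereal (norm (us k - ds k)^2 / t)
        \<le> sec_quot \<phi> xb vb (\<tau> k) (ws k) + ereal (norm (ws k - ds k)^2 / t)"
        by (rule prox_scaled_minimizer[OF t(1) \<tau>(1) prox])
      with elim show ?case
        by (cases "sec_quot \<phi> xb vb (\<tau> k) (us k)"; cases "sec_quot \<phi> xb vb (\<tau> k) (ws k)") auto
    qed
    then have "limsup (\<lambda>k. sec_quot \<phi> xb vb (\<tau> k) (us k))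
        \<le> ereal (w \<bullet> (A *v w) + (norm (w - d)^2 / t - norm (u - d)^2 / t)) + ereal r"
      by (rule Limsup_bounded)
    moreover have "liminf (\<lambda>k. sec_quot \<phi> xb vb (\<tau> k) (us k)) \<le> limsup (\<lambda>k. sec_quot \<phi> xb vb (\<tau> k) (us k))"
      by (rule Liminf_le_Limsup[OF sequentially_bot])
    moreover have "sec_subderiv \<phi> xb vb u \<le> liminf (\<lambda>k. sec_quot \<phi> xb vb (\<tau> k) (us k))"
      using epi \<tau> u unfolding twice_epi_diff_def by blast
    ultimately show "sec_subderiv \<phi> xb vb u
      \<le> ereal (w \<bullet> (A *v w) + (norm (w - d)^2 / t - norm (u - d)^2 / t)) + ereal r"
      by (meson order_trans)
  qed
  \<comment> \<open>The competitor \<open>w = 0\<close> gives a finite upper bound, whereas the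
    second subderivative is infinite off \<open>S\<close>.\<close>
  have uS: "u \<in> S"
    using upper[OF subspace_0[OF S]] by (auto simp: quad split: if_splits)
  show ?thesis
    unfolding prox_deriv_rel_def
  proof (intro conjI ballI uS)
    fix s assume s: "s \<in> S"
    show "u \<bullet> (A *v s) + s \<bullet> (A *v u) + 2 / t * ((u - d) \<bullet> s) = 0"
    proof (rule linear_coefficient_zero[where c = "s \<bullet> (A *v s) + norm s^2 / t"])
      fix r :: real
      have "u + r *\<^sub>R s \<in> S"
        using S uS s by (simp add: subspace_add subspace_scale)
      from upper[OF this] have "u \<bullet> (A *v u) \<le> (u + r *\<^sub>R s) \<bullet> (A *v (u + r *\<^sub>R s))
          + (norm (u + r *\<^sub>R s - d)^2 / t - norm (u - d)^2 / t)"
        by (simp add: quad uS)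
      moreover have "(u + r *\<^sub>R s) \<bullet> (A *v (u + r *\<^sub>R s)) = u \<bullet> (A *v u)
          + r * (u \<bullet> (A *v s) + s \<bullet> (A *v u)) + r^2 * (s \<bullet> (A *v s))"
        by (simp add: matrix_vector_right_distrib matrix_vector_mult_scaleR inner_add_left
            inner_add_right power2_eq_square algebra_simps)
      moreover have "norm (u + r *\<^sub>R s - d)^2 = norm (u - d)^2 + 2 * r * ((u - d) \<bullet> s) + r^2 * norm s^2"
        unfolding power2_norm_eq_inner by (simp add: algebra_simps inner_commute power2_eq_square)
      then have "norm (u + r *\<^sub>R s - d)^2 / t
          = norm (u - d)^2 / t + r * (2 / t * ((u - d) \<bullet> s)) + r^2 * (norm s^2 / t)"
        using t by (simp only: add_divide_distrib) simp
      ultimately show "0 \<le> r * (u \<bullet> (A *v s) + s \<bullet> (A *v u) + 2 / t * ((u - d) \<bullet> s))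
          + r^2 * (s \<bullet> (A *v s) + norm s^2 / t)"
        by (simp add: distrib_left)
    qed
  qed
qed

lemma subsequence_prox_deriv_rel:
  assumes \<tau>: "\<And>k. \<tau> k > 0" "\<tau> \<longlonglongrightarrow> 0" and d: "\<And>k. norm (ds k) \<le> B"
    and prox: "\<And>k. xs k \<in> prox_set t \<phi> (xb + t *\<^sub>R vb + \<tau> k *\<^sub>R ds k)"
  obtains r d u where "strict_mono r" "(ds \<circ> r) \<longlonglongrightarrow> d"
    "((\<lambda>k. (1 / \<tau> k) *\<^sub>R (xs k - xb)) \<circ> r) \<longlonglongrightarrow> u" "prox_deriv_rel d u"
proof -
  define us where "us = (\<lambda>k. (1 / \<tau> k) *\<^sub>R (xs k - xb))"
  have us: "xb + \<tau> k *\<^sub>R us k = xs k" for k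
    using \<tau>(1)[of k] by (simp add: us_def)
  have "norm (us k) \<le> 2 * B / (1 - t * R)" for k
  proof -
    have "norm (xs k - xb) \<le> 2 * norm (\<tau> k *\<^sub>R ds k) / (1 - t * R)"
      using prox_set_dist[OF t prox[of k]] by simp
    then have "norm (us k) \<le> 2 * norm (ds k) / (1 - t * R)"
      using \<tau>(1)[of k] by (simp add: us_def pos_divide_le_eq mult.commute mult.left_commute)
    also have "\<dots> \<le> 2 * B / (1 - t * R)"
      using d[of k] t by (intro divide_right_mono) auto
    finally show ?thesis .
  qed
  then have mem: "\<forall>k. (ds k, us k) \<in> cball 0 B \<times> cball 0 (2 * B / (1 - t * R))"
    using d by (auto simp: dist_norm)
  have "compact (cball (0::real^'n) B \<times> cball (0::real^'n) (2 * B / (1 - t * R)))"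
    by (intro compact_Times) auto
  then obtain l r where r: "strict_mono r" "((\<lambda>k. (ds k, us k)) \<circ> r) \<longlonglongrightarrow> l"
    using seq_compactE[OF compact_imp_seq_compact mem] by blast
  obtain d u where l: "l = (d, u)" by (cases l)
  have lim: "(ds \<circ> r) \<longlonglongrightarrow> d" "(us \<circ> r) \<longlonglongrightarrow> u"
    using tendsto_fst[OF r(2)] tendsto_snd[OF r(2)] by (simp_all add: l o_def)
  have "prox_deriv_rel d u"
  proof (rule limit_prox_deriv_rel[OF _ _ lim])
    show "(\<tau> \<circ> r) \<longlonglongrightarrow> 0" by (rule LIMSEQ_subseq_LIMSEQ[OF \<tau>(2) r(1)])
    show "xb + (\<tau> \<circ> r) k *\<^sub>R (us \<circ> r) k \<in> prox_set t \<phi> (xb + t *\<^sub>R vb + (\<tau> \<circ> r) k *\<^sub>R (ds \<circ> r) k)" for k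
      using prox us by simp
  qed (use \<tau> in auto)
  then show thesis
    using that[OF r(1) lim(1)] lim(2) by (simp add: us_def)
qed

text \<open>The solution arises as a cluster point of difference quotients of proximal points in the
  constant direction \<open>d\<close>.\<close>

lemma prox_deriv_rel_ex: "\<exists>u. prox_deriv_rel d u"
proof -
  define \<tau> where "\<tau> = (\<lambda>k. inverse (real (Suc k)))"
  have \<tau>: "\<And>k. \<tau> k > 0" "\<tau> \<longlonglongrightarrow> 0"
    unfolding \<tau>_def by (simp, rule LIMSEQ_inverse_real_of_nat)
  have "\<forall>k. \<exists>x. x \<in> prox_set t \<phi> (xb + t *\<^sub>R vb + \<tau> k *\<^sub>R d)"
    using prox_set_nonempty[OF t] by blast
  from choice[OF this] obtain xs where xs: "\<And>k. xs k \<in> prox_set t \<phi> (xb + t *\<^sub>R vb + \<tau> k *\<^sub>R d)"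
    by blast
  show ?thesis
  proof (rule subsequence_prox_deriv_rel[OF \<tau> order_refl xs])
    fix r :: "nat \<Rightarrow> nat" and d' u
    assume "((\<lambda>k. d) \<circ> r) \<longlonglongrightarrow> d'" "prox_deriv_rel d' u"
    moreover from this(1) have "d' = d"
      using LIMSEQ_unique[OF _ tendsto_const] by (auto simp: o_def)
    ultimately show ?thesis by blast
  qed
qed

text \<open>The stationarity relation is linear and uniquely solvable, hence the graph of a linear
  \<open>L\<close>. Were \<open>L\<close> not the derivative, violating points would yield
  directions and quotients that cluster at a pair \<open>d\<close>, \<open>u\<close> of the relation
  with \<open>u\<close> bounded away from \<open>L d\<close>.\<close>

lemma prox_has_derivative:
  assumes uniq: "\<delta> > 0" "\<And>z. norm (z - (xb + t *\<^sub>R vb)) < \<delta> \<Longrightarrow> prox t \<phi> z \<in> prox_set t \<phi> z"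
  obtains L where "(prox t \<phi> has_derivative L) (at (xb + t *\<^sub>R vb))"
proof -
  define zb where "zb = xb + t *\<^sub>R vb"
  have Pzb: "prox t \<phi> zb = xb"
    unfolding zb_def by (rule prox_at_base[OF t])
  from prox_deriv_rel_ex have "\<forall>d. \<exists>u. prox_deriv_rel d u" by blast
  from choice[OF this] obtain L where L: "\<And>d. prox_deriv_rel d (L d)" by blast
  have L_eq: "L d = u" if "prox_deriv_rel d u" for d u
    using prox_deriv_rel_unique[OF L that] .
  have "linear L"
  proof
    fix d d'
    have "prox_deriv_rel (d + d') (L d + L d')"
      using L[of d] L[of d'] S unfolding prox_deriv_rel_def
    proof (intro conjI ballI)
      fix s assume "s \<in> S"
      then have "L d \<bullet> (A *v s) + s \<bullet> (A *v L d) + 2 / t * ((L d - d) \<bullet> s) = 0"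
        "L d' \<bullet> (A *v s) + s \<bullet> (A *v L d') + 2 / t * ((L d' - d') \<bullet> s) = 0"
        using L by (auto simp: prox_deriv_rel_def)
      then have "(L d \<bullet> (A *v s) + s \<bullet> (A *v L d) + 2 / t * ((L d - d) \<bullet> s))
         + (L d' \<bullet> (A *v s) + s \<bullet> (A *v L d') + 2 / t * ((L d' - d') \<bullet> s)) = 0" by simp
      then show "(L d + L d') \<bullet> (A *v s) + s \<bullet> (A *v (L d + L d')) + 2 / t * ((L d + L d' - (d + d')) \<bullet> s) = 0"
        by (simp add: matrix_vector_right_distrib inner_add_left inner_add_right inner_diff_left
            right_diff_distrib distrib_left)
    qed (auto intro: subspace_add)
    then show "L (d + d') = L d + L d'" by (rule L_eq)
  next
    fix c d
    have "prox_deriv_rel (c *\<^sub>R d) (c *\<^sub>R L d)"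
      unfolding prox_deriv_rel_def
    proof (intro conjI ballI)
      fix s assume "s \<in> S"
      then have "c * (L d \<bullet> (A *v s) + s \<bullet> (A *v L d) + 2 / t * ((L d - d) \<bullet> s)) = 0"
        using L by (auto simp: prox_deriv_rel_def)
      then show "(c *\<^sub>R L d) \<bullet> (A *v s) + s \<bullet> (A *v (c *\<^sub>R L d)) + 2 / t * ((c *\<^sub>R L d - c *\<^sub>R d) \<bullet> s) = 0"
        by (simp add: matrix_vector_mult_scaleR inner_diff_left distrib_left right_diff_distrib mult_ac)
    qed (use L S in \<open>auto simp: prox_deriv_rel_def subspace_scale\<close>)
    then show "L (c *\<^sub>R d) = c *\<^sub>R L d" by (rule L_eq)
  qed
  then have bl: "bounded_linear L" by (simp add: linear_conv_bounded_linear)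
  have "(prox t \<phi> has_derivative L) (at zb)"
    unfolding has_derivative_at_alt
  proof (intro conjI bl allI impI, rule ccontr)
    fix r :: real assume r: "0 < r"
      and neg: "\<not> (\<exists>\<eta>>0. \<forall>y. norm (y - zb) < \<eta> \<longrightarrow>
        norm (prox t \<phi> y - prox t \<phi> zb - L (y - zb)) \<le> r * norm (y - zb))"
    \<comment> \<open>The radius stays below \<open>\<delta>\<close>, where \<open>prox\<close> is
      known to be a minimizer and not an unspecified value of \<open>THE\<close>.\<close>
    have "\<exists>y. norm (y - zb) < min \<delta> (inverse (real (Suc k))) \<and>
        norm (prox t \<phi> y - prox t \<phi> zb - L (y - zb)) > r * norm (y - zb)" for k
      using neg uniq(1) by (auto simp: not_le dest!: spec[of _ "min \<delta> (inverse (real (Suc k)))"])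
    then obtain y where y: "\<And>k. norm (y k - zb) < \<delta>" "\<And>k. norm (y k - zb) < inverse (real (Suc k))"
      "\<And>k. norm (prox t \<phi> (y k) - xb - L (y k - zb)) > r * norm (y k - zb)"
      unfolding Pzb by (metis min_less_iff_conj)
    define \<tau> where "\<tau> = (\<lambda>k. norm (y k - zb))"
    have \<tau>pos: "\<tau> k > 0" for k
    proof -
      have "y k \<noteq> zb"
        using y(3)[of k] Pzb bl by (auto simp: linear_simps)
      then show ?thesis by (simp add: \<tau>_def)
    qed
    have \<tau>0: "\<tau> \<longlonglongrightarrow> 0"
    proof (rule tendsto_sandwich[OF _ _ tendsto_const LIMSEQ_inverse_real_of_nat])
      show "\<forall>\<^sub>F k in sequentially. 0 \<le> \<tau> k" by (simp add: \<tau>_def)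
      show "\<forall>\<^sub>F k in sequentially. \<tau> k \<le> inverse (real (Suc k))"
        using y(2) by (simp add: \<tau>_def less_imp_le)
    qed
    define ds where "ds = (\<lambda>k. (1 / \<tau> k) *\<^sub>R (y k - zb))"
    have yk: "y k = xb + t *\<^sub>R vb + \<tau> k *\<^sub>R ds k" for k
      using \<tau>pos[of k] by (simp add: ds_def zb_def)
    have "norm (ds k) \<le> 1" for k
      using \<tau>pos[of k] by (simp add: ds_def \<tau>_def)
    moreover have "prox t \<phi> (y k) \<in> prox_set t \<phi> (xb + t *\<^sub>R vb + \<tau> k *\<^sub>R ds k)" for k
      using uniq(2)[of "y k"] y(1)[of k] unfolding yk[symmetric] by (simp add: zb_def)
    ultimately obtain q d u where q: "strict_mono q" "(ds \<circ> q) \<longlonglongrightarrow> d"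
      "((\<lambda>k. (1 / \<tau> k) *\<^sub>R (prox t \<phi> (y k) - xb)) \<circ> q) \<longlonglongrightarrow> u" "prox_deriv_rel d u"
      using subsequence_prox_deriv_rel[OF \<tau>pos \<tau>0, of ds 1 "\<lambda>k. prox t \<phi> (y k)"] by blast
    have "r \<le> norm ((1 / \<tau> k) *\<^sub>R (prox t \<phi> (y k) - xb) - L (ds k))" for k
    proof -
      have "(1 / \<tau> k) *\<^sub>R (prox t \<phi> (y k) - xb) - L (ds k)
          = (1 / \<tau> k) *\<^sub>R (prox t \<phi> (y k) - xb - L (y k - zb))"
        using bl by (simp add: ds_def linear_simps scaleR_diff_right)
      then have "norm ((1 / \<tau> k) *\<^sub>R (prox t \<phi> (y k) - xb) - L (ds k))
          = norm (prox t \<phi> (y k) - xb - L (y k - zb)) / \<tau> k"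
        using \<tau>pos[of k] by simp
      then show ?thesis
        using y(3)[of k] \<tau>pos[of k] by (simp add: pos_le_divide_eq) (simp add: \<tau>_def)
    qed
    then have "r \<le> norm (u - L d)"
      using tendsto_norm[OF tendsto_diff[OF q(3) bounded_linear.tendsto[OF bl q(2)]]]
      by (intro tendsto_lowerbound[OF _ _ sequentially_bot]) (auto simp: o_def)
    then show False
      using L_eq[OF q(4)] r by simp
  qed
  then show thesis using that by (simp add: zb_def)
qed

end

lemma (in prox_regular_point) prox_differentiable_at_base:
  assumes t: "0 < t" "t * R < 1" and "twice_epi_diff \<phi> xb vb" "generalized_quadratic_sd \<phi> xb vb"
  shows "prox_differentiable_at t \<phi> (xb + t *\<^sub>R vb)"
proof -
  obtain A S where "subspace S"
    "\<And>u. sec_subderiv \<phi> xb vb u = (if u \<in> S then ereal (u \<bullet> (A *v u)) else \<infinity>)"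
    using assms(4) unfolding generalized_quadratic_sd_def by blast
  then interpret prox_epi_point \<phi> xb vb a R e t A S
    using assms by unfold_locales auto
  obtain \<delta> where \<delta>: "\<delta> > 0" and uniq: "\<And>z x x'. norm (z - (xb + t *\<^sub>R vb)) < \<delta> \<Longrightarrow>
      x \<in> prox_set t \<phi> z \<Longrightarrow> x' \<in> prox_set t \<phi> z \<Longrightarrow> x' = x"
    using prox_unique_near[OF t] by metis
  have ex1: "\<exists>!x. x \<in> prox_set t \<phi> z" if "norm (z - (xb + t *\<^sub>R vb)) < \<delta>" for z
    using prox_set_nonempty[OF t, of z] uniq[OF that] by blast
  have "prox t \<phi> z \<in> prox_set t \<phi> z" if "norm (z - (xb + t *\<^sub>R vb)) < \<delta>" for z
    unfolding prox_def using theI'[OF ex1[OF that]] .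
  then obtain L where "(prox t \<phi> has_derivative L) (at (xb + t *\<^sub>R vb))"
    using prox_has_derivative[OF \<delta>] by blast
  then show ?thesis
    unfolding prox_differentiable_at_def differentiable_def
    using ex1 \<delta> by (intro conjI exI[of _ "ball (xb + t *\<^sub>R vb) \<delta>"] exI[of _ L])
      (auto simp: dist_norm norm_minus_commute)
qed

section \<open>Partial smoothness\<close>

text \<open>Frechet differentiability admits directions that vary along the sequence; this is needed
  for points of the manifold that only approach a tangent direction.\<close>

lemma has_derivative_quotient_tendsto:
  assumes der: "(f has_derivative f') (at x)" and \<tau>: "\<And>k. \<tau> k > 0" "\<tau> \<longlonglongrightarrow> 0" and u: "us \<longlonglongrightarrow> u"
  shows "(\<lambda>k. (1 / \<tau> k) *\<^sub>R (f (x + \<tau> k *\<^sub>R us k) - f x)) \<longlonglongrightarrow> f' u"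
proof -
  interpret f': bounded_linear f'
    by (rule has_derivative_bounded_linear[OF der])
  obtain B where B: "B > 0" "\<And>k. norm (us k) \<le> B"
    using convergent_imp_Bseq[OF convergentI[OF u]] by (auto elim: BseqE)
  have small: "(\<lambda>k. (1 / \<tau> k) *\<^sub>R (f (x + \<tau> k *\<^sub>R us k) - f x) - f' (us k)) \<longlonglongrightarrow> 0"
    unfolding tendsto_iff
  proof (intro allI impI)
    fix r :: real assume r: "r > 0"
    then have "r / (2 * B) > 0" using B by simp
    then obtain d where d: "d > 0" "\<And>y. norm (y - x) < d \<Longrightarrow>
        norm (f y - f x - f' (y - x)) \<le> r / (2 * B) * norm (y - x)"
      using der unfolding has_derivative_at_alt by blast
    have "\<forall>\<^sub>F k in sequentially. \<tau> k < d / B"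
      using \<tau>(2) d(1) B(1) by (intro order_tendstoD) auto
    then show "\<forall>\<^sub>F k in sequentially. dist ((1 / \<tau> k) *\<^sub>R (f (x + \<tau> k *\<^sub>R us k) - f x) - f' (us k)) 0 < r"
    proof eventually_elim
      case (elim k)
      have tk: "\<tau> k > 0" by (rule \<tau>(1))
      have "norm (\<tau> k *\<^sub>R us k) \<le> \<tau> k * B"
        using tk B(2)[of k] by simp
      also have "\<dots> < d" using elim B(1) by (simp add: field_simps)
      finally have "norm (f (x + \<tau> k *\<^sub>R us k) - f x - f' (\<tau> k *\<^sub>R us k)) \<le> r / (2 * B) * norm (\<tau> k *\<^sub>R us k)"
        using d(2)[of "x + \<tau> k *\<^sub>R us k"] by simp
      also have "\<dots> \<le> r / (2 * B) * (\<tau> k * B)"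
        using r B tk by (intro mult_left_mono) auto
      also have "\<dots> < \<tau> k * r" using B tk r by simp
      finally have "norm (f (x + \<tau> k *\<^sub>R us k) - f x - f' (\<tau> k *\<^sub>R us k)) / \<tau> k < r"
        using tk by (simp add: pos_divide_less_eq mult.commute)
      moreover have "(1 / \<tau> k) *\<^sub>R (f (x + \<tau> k *\<^sub>R us k) - f x) - f' (us k)
          = (1 / \<tau> k) *\<^sub>R (f (x + \<tau> k *\<^sub>R us k) - f x - f' (\<tau> k *\<^sub>R us k))"
        using tk by (simp add: f'.scaleR scaleR_diff_right)
      ultimately show ?case
        using tk r by simp
    qed
  qed
  then show ?thesis
    using tendsto_add[OF small f'.tendsto[OF u]] by simp
qed

lemma orthogonal_projection_exists:
  fixes L :: "'a::euclidean_space set"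
  assumes "subspace L"
  obtains \<pi> where "bounded_linear \<pi>" "\<And>u. \<pi> u \<in> L" "\<And>u l. l \<in> L \<Longrightarrow> (u - \<pi> u) \<bullet> l = 0"
proof -
  obtain B where B: "B \<subseteq> L" "pairwise orthogonal B" "\<And>x. x \<in> B \<Longrightarrow> norm x = 1"
    "independent B" "span B = L"
    using orthonormal_basis_subspace[OF assms] by metis
  have fin: "finite B" using B(4) by (rule finiteI_independent)
  define \<pi> where "\<pi> = (\<lambda>u. \<Sum>b\<in>B. (u \<bullet> b) *\<^sub>R b)"
  have orth: "(u - \<pi> u) \<bullet> b = 0" if "b \<in> B" for u b
  proof -
    have "\<pi> u \<bullet> b = (\<Sum>c\<in>B. (u \<bullet> c) * (c \<bullet> b))"
      by (simp add: \<pi>_def inner_sum_left)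
    also have "\<dots> = (\<Sum>c\<in>B. if c = b then u \<bullet> b else 0)"
      using B(2,3) that
      by (intro sum.cong refl) (auto simp: pairwise_def orthogonal_def dot_square_norm)
    also have "\<dots> = u \<bullet> b" using fin that by simp
    finally show ?thesis by (simp add: inner_diff_left)
  qed
  show thesis
  proof
    show "bounded_linear \<pi>"
      unfolding \<pi>_def by (intro bounded_linear_sum bounded_linear_scaleR_const bounded_linear_inner_left)
    show "\<pi> u \<in> L" for u
      unfolding \<pi>_def using B(1) assms by (intro subspace_sum subspace_scale) auto
    show "(u - \<pi> u) \<bullet> l = 0" if "l \<in> L" for u l
      using that orth orthogonal_to_span[of l B "u - \<pi> u"] unfolding B(5) orthogonal_def by blast
  qed
qed

lemma add_par_in_affine_hull:
  assumes "v \<in> S" "c \<in> par S"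
  shows "v + c \<in> affine hull S"
proof -
  have v: "v \<in> affine hull S" using assms(1) by (rule hull_inc)
  have "par S \<subseteq> (\<lambda>x. x - v) ` (affine hull S)"
    unfolding par_def
  proof (rule span_minimal)
    show "subspace ((\<lambda>x. x - v) ` (affine hull S))"
      by (rule affine_diffs_subspace_subtract[OF affine_affine_hull v])
    show "{a - b |a b. a \<in> S \<and> b \<in> S} \<subseteq> (\<lambda>x. x - v) ` (affine hull S)"
    proof
      fix w assume "w \<in> {a - b |a b. a \<in> S \<and> b \<in> S}"
      then obtain p q where w: "w = p - q" "p \<in> S" "q \<in> S" by blast
      have "v + 1 *\<^sub>R (p - q) \<in> affine hull S"
        using w v by (intro mem_affine_3_minus affine_affine_hull) (auto intro: hull_inc)
      then show "w \<in> (\<lambda>x. x - v) ` (affine hull S)"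
        by (intro image_eqI[of _ _ "v + w"]) (auto simp: w)
    qed
  qed
  then show ?thesis using assms(2) by force
qed

text \<open>\<open>\<psi>\<close> flattens \<open>M\<close> to the subspace \<open>L\<close>,
  \<open>\<sigma>\<close> is its inverse, \<open>\<pi>\<close> the orthogonal projection onto
  \<open>L\<close>, and \<open>g\<close> a smooth representative of \<open>\<phi>\<close> on
  \<open>M\<close>. The order \<open>k\<close> will be \<open>p - 1\<close>, because the
  parametrization below involves first derivatives of maps of class \<open>p\<close>.\<close>

locale partly_smooth_chart =
  fixes \<phi> :: "real^'n \<Rightarrow> ereal" and xb vb :: "real^'n" and M V L :: "(real^'n) set"
    and \<psi> \<sigma> :: "real^'n \<Rightarrow> real^'n" and g :: "real^'n \<Rightarrow> real"
    and \<psi>' \<sigma>' :: "real^'n \<Rightarrow> real^'n \<Rightarrow> real^'n" and g' :: "real^'n \<Rightarrow> real^'n \<Rightarrow> real"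
    and \<pi> :: "real^'n \<Rightarrow> real^'n" and k :: nat
  assumes V: "open V" "xb \<in> V" "open (\<psi> ` V)" and xbM: "xb \<in> M" and k: "k \<ge> 1"
    and \<sigma>\<psi>: "\<And>x. x \<in> V \<Longrightarrow> \<sigma> (\<psi> x) = x"
    and d\<psi>: "\<And>x. x \<in> V \<Longrightarrow> (\<psi> has_derivative \<psi>' x) (at x)"
    and d\<sigma>: "\<And>y. y \<in> \<psi> ` V \<Longrightarrow> (\<sigma> has_derivative \<sigma>' y) (at y)"
    and dg: "\<And>x. x \<in> V \<Longrightarrow> (g has_derivative g' x) (at x)"
    and C\<psi>: "\<And>v. Ck_on k V (\<lambda>x. \<psi>' x v)"
    and C\<sigma>: "Ck_on k (\<psi> ` V) \<sigma>" "\<And>v. Ck_on k (\<psi> ` V) (\<lambda>x. \<sigma>' x v)"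
    and Cg: "\<And>v. Ck_on k V (\<lambda>x. g' x v)"
    and L: "subspace L" and M_iff: "\<And>x. x \<in> V \<Longrightarrow> x \<in> M \<longleftrightarrow> \<psi> x \<in> L"
    and \<phi>g: "\<And>x. x \<in> M \<Longrightarrow> x \<in> V \<Longrightarrow> \<phi> x = ereal (g x)"
    and lim_eq: "\<And>x. lim_subdiff \<phi> x = reg_subdiff \<phi> x"
    and ri: "vb \<in> rel_interior (lim_subdiff \<phi> xb)"
    and par_eq: "par (reg_subdiff \<phi> xb) = normal_space M xb"
    and isc: "\<exists>Vi. open Vi \<and> vb \<in> Vi \<and> isc_rel M (\<lambda>x'. Vi \<inter> lim_subdiff \<phi> x') xb"
    and \<pi>: "bounded_linear \<pi>" "\<And>u. \<pi> u \<in> L" "\<And>u l. l \<in> L \<Longrightarrow> (u - \<pi> u) \<bullet> l = 0"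
begin

section \<open>Parametrization of manifold points and candidate subgradients\<close>

abbreviation W where "W \<equiv> \<psi> ` V"

definition yb where "yb = \<psi> xb"

definition grad :: "real^'n \<Rightarrow> real^'n" where "grad x = (\<Sum>b\<in>Basis. g' x b *\<^sub>R b)"

text \<open>Normal coordinate of the given subgradient: as \<open>\<sigma>' yb\<close> inverts
  \<open>\<psi>' xb\<close>, the adjoint of \<open>\<psi>' xb\<close> maps \<open>\<eta>b\<close> to
  \<open>vb - grad xb\<close>.\<close>

definition \<eta>b where "\<eta>b = adjoint (\<sigma>' yb) (vb - grad xb)"

definition u0 where "u0 = yb + \<eta>b"

text \<open>Points \<open>x\<close> of the manifold together with candidate subgradients, i.e. with vectors \<open>v\<close> such
  that \<open>v - \<nabla>g(x)\<close> is normal to the manifold, are parametrized by \<open>u = y + \<eta>\<close>, where \<open>y \<in> L\<close> is the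
  chart coordinate of \<open>x\<close> and \<open>\<eta>\<close> is orthogonal to \<open>L\<close>.\<close>

definition pt :: "real^'n \<Rightarrow> real^'n" where "pt u = \<sigma> (\<pi> u)"

definition subgrad :: "real^'n \<Rightarrow> real^'n" where
  "subgrad u = grad (pt u) + (\<Sum>b\<in>Basis. (\<psi>' (pt u) b \<bullet> (u - \<pi> u)) *\<^sub>R b)"

lemma \<psi>\<sigma>: "y \<in> W \<Longrightarrow> \<sigma> y \<in> V \<and> \<psi> (\<sigma> y) = y"
  using \<sigma>\<psi> by auto

lemma linear_\<psi>': "x \<in> V \<Longrightarrow> linear (\<psi>' x)"
  by (rule has_derivative_linear[OF d\<psi>])

lemma linear_\<sigma>': "y \<in> W \<Longrightarrow> linear (\<sigma>' y)"
  by (rule has_derivative_linear[OF d\<sigma>])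

lemma grad_inner: "x \<in> V \<Longrightarrow> grad x \<bullet> w = g' x w"
proof -
  assume "x \<in> V"
  then interpret g': bounded_linear "g' x"
    by (rule has_derivative_bounded_linear[OF dg])
  have "g' x w = g' x (\<Sum>b\<in>Basis. (w \<bullet> b) *\<^sub>R b)" by (simp add: euclidean_representation)
  also have "\<dots> = (\<Sum>b\<in>Basis. (w \<bullet> b) * g' x b)" by (simp add: g'.sum g'.scaleR)
  finally show ?thesis
    by (simp add: grad_def inner_sum_left inner_commute[of w] mult.commute)
qed

lemma \<psi>'_\<sigma>': "y \<in> W \<Longrightarrow> \<psi>' (\<sigma> y) (\<sigma>' y w) = w"
proof -
  assume y: "y \<in> W"
  have "((\<lambda>x. \<psi> (\<sigma> x)) has_derivative (\<lambda>w. \<psi>' (\<sigma> y) (\<sigma>' y w))) (at y)"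
    using y \<psi>\<sigma> by (intro has_derivative_compose[OF d\<sigma> d\<psi>]) auto
  moreover have "((\<lambda>x. \<psi> (\<sigma> x)) has_derivative (\<lambda>w. w)) (at y)"
    by (rule has_derivative_transform_within_open[OF has_derivative_ident V(3) y]) (use \<psi>\<sigma> in auto)
  ultimately show ?thesis by (metis has_derivative_unique)
qed

lemma \<sigma>'_\<psi>': "x \<in> V \<Longrightarrow> \<sigma>' (\<psi> x) (\<psi>' x w) = w"
proof -
  assume x: "x \<in> V"
  have "((\<lambda>x. \<sigma> (\<psi> x)) has_derivative (\<lambda>w. \<sigma>' (\<psi> x) (\<psi>' x w))) (at x)"
    using x by (intro has_derivative_compose[OF d\<psi> d\<sigma>]) auto
  moreover have "((\<lambda>x. \<sigma> (\<psi> x)) has_derivative (\<lambda>w. w)) (at x)"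
    by (rule has_derivative_transform_within_open[OF has_derivative_ident V(1) x]) (use \<sigma>\<psi> in auto)
  ultimately show ?thesis by (metis has_derivative_unique)
qed

lemma yb: "yb \<in> W" "yb \<in> L" "\<sigma> yb = xb"
  using V(2) M_iff xbM \<sigma>\<psi> by (auto simp: yb_def)

lemma \<sigma>_in_M: "y \<in> W \<Longrightarrow> y \<in> L \<Longrightarrow> \<sigma> y \<in> M"
  using \<psi>\<sigma> M_iff by auto

text \<open>Identifies the sum in \<open>subgrad\<close>. The sum form contains only derivatives in
  fixed directions, which is what \<open>Ck_on\<close> controls.\<close>

lemma adjoint_\<psi>'_eq: "x \<in> V \<Longrightarrow> (\<Sum>b\<in>Basis. (\<psi>' x b \<bullet> \<eta>) *\<^sub>R b) = adjoint (\<psi>' x) \<eta>"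
  by (subst (2) euclidean_representation[symmetric])
    (simp add: adjoint_clauses[OF linear_\<psi>'] inner_commute)

text \<open>The curve with chart coordinate \<open>y + \<tau> l\<close> stays in the manifold, where
  \<open>\<phi>\<close> equals \<open>g\<close>; dividing the subgradient inequality by
  \<open>\<tau>\<close> compares the slopes from one side. Applied to \<open>l\<close> and
  \<open>- l\<close> this becomes an equality.\<close>

lemma subgradient_normal_le:
  assumes y: "y \<in> W" "y \<in> L" and v: "v \<in> reg_subdiff \<phi> (\<sigma> y)" and l: "l \<in> L"
  shows "v \<bullet> \<sigma>' y l \<le> g' (\<sigma> y) (\<sigma>' y l)"
proof -
  define x where "x = \<sigma> y"
  define w where "w = \<sigma>' y l"
  have xV: "x \<in> V" and xM: "x \<in> M"
    using y \<psi>\<sigma> \<sigma>_in_M by (auto simp: x_def)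
  define \<tau> where "\<tau> = (\<lambda>k. inverse (real (Suc k)))"
  have \<tau>: "\<And>k. \<tau> k > 0" "\<tau> \<longlonglongrightarrow> 0"
    unfolding \<tau>_def by (simp, rule LIMSEQ_inverse_real_of_nat)
  define xs where "xs = (\<lambda>k. \<sigma> (y + \<tau> k *\<^sub>R l))"
  define ws where "ws = (\<lambda>k. (1 / \<tau> k) *\<^sub>R (xs k - x))"
  have xs_eq: "xs k = x + \<tau> k *\<^sub>R ws k" for k
    using \<tau>(1)[of k] by (simp add: ws_def)
  have ws: "ws \<longlonglongrightarrow> w"
    using has_derivative_quotient_tendsto[OF d\<sigma>[OF y(1)] \<tau> tendsto_const[of l]]
    by (simp add: ws_def xs_def x_def w_def)
  have xs: "xs \<longlonglongrightarrow> x"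
    unfolding xs_eq using tendsto_add[OF tendsto_const tendsto_scaleR[OF \<tau>(2) ws], of x] by simp
  have gq: "(\<lambda>k. (1 / \<tau> k) * (g (xs k) - g x)) \<longlonglongrightarrow> g' x w"
    using has_derivative_quotient_tendsto[OF dg[OF xV] \<tau> ws] by (simp add: xs_eq)
  have "(\<lambda>k. y + \<tau> k *\<^sub>R l) \<longlonglongrightarrow> y + 0 *\<^sub>R l"
    by (intro tendsto_intros \<tau>)
  then have inW: "\<forall>\<^sub>F k in sequentially. y + \<tau> k *\<^sub>R l \<in> W"
    using topological_tendstoD[OF _ V(3)] y(1) by simp
  have ineq: "v \<bullet> w - r * norm w \<le> g' x w" if r: "r > 0" for r
  proof (rule tendsto_le[OF sequentially_bot gq])
    show "(\<lambda>k. v \<bullet> ws k - r * norm (ws k)) \<longlonglongrightarrow> v \<bullet> w - r * norm w"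
      by (intro tendsto_intros ws)
    obtain \<delta> where \<delta>: "\<delta> > 0" "\<And>z. norm (z - x) < \<delta> \<Longrightarrow>
        \<phi> x + ereal (v \<bullet> (z - x) - r * norm (z - x)) \<le> \<phi> z"
      using v r unfolding reg_subdiff_def x_def by blast
    show "\<forall>\<^sub>F k in sequentially. v \<bullet> ws k - r * norm (ws k) \<le> (1 / \<tau> k) * (g (xs k) - g x)"
      using inW tendstoD[OF xs \<delta>(1)]
    proof eventually_elim
      case (elim k)
      have "y + \<tau> k *\<^sub>R l \<in> L" using L y(2) l by (simp add: subspace_add subspace_scale)
      then have "xs k \<in> V" "xs k \<in> M"
        using elim(1) \<psi>\<sigma> \<sigma>_in_M by (auto simp: xs_def)
      then have "g x + (v \<bullet> (xs k - x) - r * norm (xs k - x)) \<le> g (xs k)"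
        using \<delta>(2)[of "xs k"] elim(2) \<phi>g xV xM by (simp add: dist_norm)
      then have "v \<bullet> (xs k - x) - r * norm (xs k - x) \<le> g (xs k) - g x" by simp
      then have "(1 / \<tau> k) * (v \<bullet> (xs k - x) - r * norm (xs k - x)) \<le> (1 / \<tau> k) * (g (xs k) - g x)"
        using \<tau>(1)[of k] by (intro mult_left_mono) auto
      moreover have "v \<bullet> ws k - r * norm (ws k) = (1 / \<tau> k) * (v \<bullet> (xs k - x) - r * norm (xs k - x))"
        using \<tau>(1)[of k] unfolding ws_def by (simp add: right_diff_distrib)
      ultimately show ?case by simp
    qed
  qed
  have "v \<bullet> w \<le> g' x w"
  proof (rule field_le_epsilon)
    fix r :: real assume r: "r > 0"
    have "norm w / (norm w + 1) \<le> 1" by (simp add: pos_divide_le_eq add_nonneg_pos)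
    then have "r * (norm w / (norm w + 1)) \<le> r * 1" using r by (intro mult_left_mono) auto
    moreover have "v \<bullet> w - r / (norm w + 1) * norm w \<le> g' x w"
      using r by (intro ineq divide_pos_pos) (auto simp: add_nonneg_pos)
    ultimately show "v \<bullet> w \<le> g' x w + r" by simp
  qed
  then show ?thesis by (simp add: x_def w_def)
qed

lemma subgradient_normal:
  assumes y: "y \<in> W" "y \<in> L" and v: "v \<in> reg_subdiff \<phi> (\<sigma> y)" and l: "l \<in> L"
  shows "(v - grad (\<sigma> y)) \<bullet> \<sigma>' y l = 0"
proof -
  have x: "\<sigma> y \<in> V" using y \<psi>\<sigma> by auto
  have "- l \<in> L" using L l by (simp add: subspace_neg)
  from subgradient_normal_le[OF y v this] have "g' (\<sigma> y) (\<sigma>' y l) \<le> v \<bullet> \<sigma>' y l"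
    using linear_neg[OF linear_\<sigma>'[OF y(1)]] linear_neg[OF has_derivative_linear[OF dg[OF x]]] by simp
  with subgradient_normal_le[OF y v l] show ?thesis
    using grad_inner[OF x] by (simp add: inner_diff_left)
qed

lemma vb: "vb \<in> reg_subdiff \<phi> xb"
  using ri rel_interior_subset lim_eq by blast

lemma \<eta>b_orthogonal: "l \<in> L \<Longrightarrow> \<eta>b \<bullet> l = 0"
  using subgradient_normal[OF yb(1,2), of vb l] vb
  by (simp add: \<eta>b_def adjoint_clauses[OF linear_\<sigma>'[OF yb(1)]] yb(3))

lemma \<pi>_L: "l \<in> L \<Longrightarrow> \<pi> l = l"
proof -
  assume l: "l \<in> L"
  then have "l - \<pi> l \<in> L" using L \<pi>(2) by (simp add: subspace_diff)
  from \<pi>(3)[OF this] have "(l - \<pi> l) \<bullet> (l - \<pi> l) = 0" .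
  then show ?thesis by simp
qed

lemma \<pi>_orthogonal: "(\<And>l. l \<in> L \<Longrightarrow> \<eta> \<bullet> l = 0) \<Longrightarrow> \<pi> \<eta> = 0"
proof -
  assume \<eta>: "\<And>l. l \<in> L \<Longrightarrow> \<eta> \<bullet> l = 0"
  have "(\<eta> - \<pi> \<eta>) \<bullet> \<pi> \<eta> = 0" by (rule \<pi>(3)[OF \<pi>(2)])
  then have "\<pi> \<eta> \<bullet> \<pi> \<eta> = 0" using \<eta>[OF \<pi>(2), of \<eta>] by (simp add: inner_diff_left)
  then show ?thesis by simp
qed

lemma \<pi>_u0: "\<pi> u0 = yb"
proof -
  have "\<pi> u0 = \<pi> yb + \<pi> \<eta>b" unfolding u0_def using \<pi>(1) by (simp add: linear_simps)
  then show ?thesis using \<pi>_L[OF yb(2)] \<pi>_orthogonal[OF \<eta>b_orthogonal] by simp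
qed

lemma pt_u0: "pt u0 = xb"
  by (simp add: pt_def \<pi>_u0 yb)

lemma subgrad_eq: "\<pi> u \<in> W \<Longrightarrow> subgrad u = grad (pt u) + adjoint (\<psi>' (pt u)) (u - \<pi> u)"
  unfolding subgrad_def pt_def using adjoint_\<psi>'_eq \<psi>\<sigma> by simp

lemma subgrad_u0: "subgrad u0 = vb"
proof -
  have "adjoint (\<psi>' xb) \<eta>b = vb - grad xb"
  proof (rule vector_eq_ldot[THEN iffD1, rule_format])
    fix w
    show "w \<bullet> adjoint (\<psi>' xb) \<eta>b = w \<bullet> (vb - grad xb)"
      using adjoint_works[OF linear_\<psi>'[OF V(2)]] adjoint_works[OF linear_\<sigma>'[OF yb(1)]] \<sigma>'_\<psi>'[OF V(2)]
      by (simp add: \<eta>b_def yb_def[symmetric])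
  qed
  then show ?thesis
    using subgrad_eq[of u0] yb(1) by (simp add: \<pi>_u0 pt_u0) (simp add: u0_def)
qed

definition \<Omega> where "\<Omega> = \<pi> -` W"

lemma open_\<Omega>: "open \<Omega>"
  unfolding \<Omega>_def using \<pi>(1) V(3)
  by (intro open_vimage) (auto intro: linear_continuous_on)

lemma u0_\<Omega>: "u0 \<in> \<Omega>"
  by (simp add: \<Omega>_def \<pi>_u0 yb)

lemma pt_V: "u \<in> \<Omega> \<Longrightarrow> pt u \<in> V" and pt_M: "u \<in> \<Omega> \<Longrightarrow> pt u \<in> M"
  using \<psi>\<sigma> \<sigma>_in_M[OF _ \<pi>(2)] by (auto simp: \<Omega>_def pt_def)

lemma Ck_pt: "Ck_on k \<Omega> pt"
  unfolding pt_def
  by (rule Ck_on_compose[OF open_\<Omega> V(3) _ C\<sigma>(1)])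
    (auto simp: \<Omega>_def intro: Ck_on_bounded_linear[OF \<pi>(1) open_\<Omega>[unfolded \<Omega>_def]])

lemma Ck_subgrad: "Ck_on k \<Omega> subgrad"
proof -
  have pt: "pt ` \<Omega> \<subseteq> V" using pt_V by auto
  have "Ck_on k \<Omega> (\<lambda>u. u - \<pi> u)"
    by (intro Ck_on_bounded_linear[OF _ open_\<Omega>] bounded_linear_sub bounded_linear_ident \<pi>(1))
  then have "Ck_on k \<Omega> (\<lambda>u. \<psi>' (pt u) b \<bullet> (u - \<pi> u))" for b
    by (rule Ck_on_inner[OF open_\<Omega> Ck_on_compose[OF open_\<Omega> V(1) pt C\<psi> Ck_pt]])
  then have "Ck_on k \<Omega> (\<lambda>u. (\<psi>' (pt u) b \<bullet> (u - \<pi> u)) *\<^sub>R b)" for b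
    by (rule Ck_on_scaleR[OF open_\<Omega> _ Ck_on_const])
  then have 1: "Ck_on k \<Omega> (\<lambda>u. \<Sum>b\<in>Basis. (\<psi>' (pt u) b \<bullet> (u - \<pi> u)) *\<^sub>R b)"
    by (rule Ck_on_sum[OF open_\<Omega>])
  have "Ck_on k \<Omega> (\<lambda>u. g' (pt u) b *\<^sub>R b)" for b
    by (rule Ck_on_scaleR[OF open_\<Omega> Ck_on_compose[OF open_\<Omega> V(1) pt Cg Ck_pt] Ck_on_const])
  then have 2: "Ck_on k \<Omega> (\<lambda>u. grad (pt u))"
    unfolding grad_def by (rule Ck_on_sum[OF open_\<Omega>])
  show ?thesis
    unfolding subgrad_def by (rule Ck_on_add[OF open_\<Omega> 2 1])
qed

text \<open>Difference quotients of chart coordinates along \<open>M\<close> lie in the closed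
  subspace \<open>L\<close>, so \<open>\<psi>' xb\<close> maps tangent vectors into
  \<open>L\<close>, and each of them has the form \<open>\<sigma>' yb l\<close>.\<close>

lemma normal_spaceI:
  assumes "\<And>l. l \<in> L \<Longrightarrow> c \<bullet> \<sigma>' yb l = 0"
  shows "c \<in> normal_space M xb"
  unfolding normal_space_def
proof (intro CollectI ballI)
  fix v assume "v \<in> tangent_cone M xb"
  then obtain xs \<tau> where *: "\<And>k. xs k \<in> M" "\<And>k. \<tau> k > 0" "\<tau> \<longlonglongrightarrow> 0" "xs \<longlonglongrightarrow> xb"
    "(\<lambda>k. (1 / \<tau> k) *\<^sub>R (xs k - xb)) \<longlonglongrightarrow> v"
    unfolding tangent_cone_def by blast
  have "xb + \<tau> k *\<^sub>R ((1 / \<tau> k) *\<^sub>R (xs k - xb)) = xs k" for k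
    using *(2)[of k] by simp
  with has_derivative_quotient_tendsto[OF d\<psi>[OF V(2)] *(2,3,5)]
  have lim: "(\<lambda>k. (1 / \<tau> k) *\<^sub>R (\<psi> (xs k) - \<psi> xb)) \<longlonglongrightarrow> \<psi>' xb v" by simp
  have "\<forall>\<^sub>F k in sequentially. xs k \<in> V"
    using topological_tendstoD[OF *(4) V(1,2)] .
  then have "\<forall>\<^sub>F k in sequentially. (1 / \<tau> k) *\<^sub>R (\<psi> (xs k) - \<psi> xb) \<in> L"
  proof eventually_elim
    case (elim k)
    then show ?case
      using M_iff *(1) L V(2) xbM by (intro subspace_scale subspace_diff) auto
  qed
  then have "\<psi>' xb v \<in> L"
    using Lim_in_closed_set[OF closed_subspace[OF L] _ sequentially_bot lim] by blast
  from assms[OF this] show "c \<bullet> v = 0"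
    using \<sigma>'_\<psi>'[OF V(2)] by (simp add: yb_def)
qed

text \<open>Adding the tangent space \<open>T\<close> to the translated subdifferential
  \<open>D\<close> before separating from 0 forces the separating vector to be normal. As
  \<open>D\<close> is orthogonal to \<open>T\<close>, the sum contains 0 only if \<open>D\<close>
  does, that is, only if the candidate is a subgradient.\<close>

lemma separating_normal:
  assumes u: "u \<in> \<Omega>" and notin: "subgrad u \<notin> reg_subdiff \<phi> (pt u)"
    and ne: "reg_subdiff \<phi> (pt u) \<noteq> {}"
  obtains c where "norm c = 1" "\<And>l. l \<in> L \<Longrightarrow> c \<bullet> \<sigma>' (\<pi> u) l = 0"
    "\<And>v. v \<in> reg_subdiff \<phi> (pt u) \<Longrightarrow> c \<bullet> (v - subgrad u) \<ge> 0"
proof -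
  define y where "y = \<pi> u"
  have y: "y \<in> W" "y \<in> L" using u \<pi>(2) by (auto simp: \<Omega>_def y_def)
  have x: "pt u = \<sigma> y" "\<sigma> y \<in> V" using \<psi>\<sigma> y by (auto simp: pt_def y_def)
  interpret \<sigma>': linear "\<sigma>' y" using linear_\<sigma>'[OF y(1)] .
  define D where "D = {v - subgrad u |v. v \<in> reg_subdiff \<phi> (pt u)}"
  define T where "T = \<sigma>' y ` L"
  have subT: "subspace T" unfolding T_def using L by (simp add: linear_subspace_image \<sigma>'.linear_axioms)
  have "convex D"
  proof -
    have "D = (\<lambda>v. v - subgrad u) ` reg_subdiff \<phi> (pt u)" unfolding D_def by blast
    then show ?thesis using convex_translation_subtract[OF convex_reg_subdiff] by simp
  qed
  then have conv: "convex {d + w |d w. d \<in> D \<and> w \<in> T}"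
  proof -
    have "{d + w |d w. d \<in> D \<and> w \<in> T} = (\<Union>x\<in>D. \<Union>y\<in>T. {x + y})" by blast
    then show ?thesis
      using convex_sums[OF \<open>convex D\<close> subspace_imp_convex[OF subT]] by simp
  qed
  have orth: "d \<bullet> w = 0" if "d \<in> D" "w \<in> T" for d w
  proof -
    obtain v l where *: "d = v - subgrad u" "v \<in> reg_subdiff \<phi> (\<sigma> y)" "w = \<sigma>' y l" "l \<in> L"
      using \<open>d \<in> D\<close> \<open>w \<in> T\<close> by (auto simp: D_def T_def x)
    have "adjoint (\<psi>' (\<sigma> y)) (u - y) \<bullet> \<sigma>' y l = (u - y) \<bullet> l"
      by (simp add: adjoint_clauses[OF linear_\<psi>'[OF x(2)]] \<psi>'_\<sigma>'[OF y(1)])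
    also have "\<dots> = 0" unfolding y_def by (rule \<pi>(3)[OF *(4)])
    finally show ?thesis
      using subgradient_normal[OF y *(2,4)] subgrad_eq[of u] y(1)
      by (simp add: * x y_def[symmetric] inner_diff_left inner_add_left)
  qed
  have "0 \<notin> {d + w |d w. d \<in> D \<and> w \<in> T}"
  proof
    assume "0 \<in> {d + w |d w. d \<in> D \<and> w \<in> T}"
    then obtain d w where dw: "d \<in> D" "w \<in> T" "d + w = 0" by force
    then have "d \<bullet> d = 0" using orth[OF dw(1,2)] by (metis add_eq_0_iff inner_minus_right neg_0_equal_iff_equal)
    then show False using dw(1) notin by (auto simp: D_def)
  qed
  from separating_hyperplane_set_0[OF conv this] obtain c where c: "c \<noteq> 0"
    "\<And>d w. d \<in> D \<Longrightarrow> w \<in> T \<Longrightarrow> 0 \<le> c \<bullet> (d + w)" by blast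
  have cD: "0 \<le> c \<bullet> d" if "d \<in> D" for d
    using c(2)[OF that subspace_0[OF subT]] by simp
  obtain d0 where d0: "d0 \<in> D" using ne by (auto simp: D_def)
  have cT: "c \<bullet> w = 0" if w: "w \<in> T" for w
  proof (rule ccontr)
    assume nz: "c \<bullet> w \<noteq> 0"
    \<comment> \<open>For this multiple of \<open>w\<close> the pairing of \<open>c\<close> with the
      sum is -1.\<close>
    have "(- (c \<bullet> d0 + 1) / (c \<bullet> w)) *\<^sub>R w \<in> T" using subT w by (simp add: subspace_scale)
    from c(2)[OF d0 this] nz show False by (simp add: inner_add_right)
  qed
  show thesis
  proof
    show "norm ((1 / norm c) *\<^sub>R c) = 1" using c(1) by simp
    show "((1 / norm c) *\<^sub>R c) \<bullet> \<sigma>' (\<pi> u) l = 0" if "l \<in> L" for l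
      using cT that by (simp add: T_def y_def)
    show "((1 / norm c) *\<^sub>R c) \<bullet> (v - subgrad u) \<ge> 0" if "v \<in> reg_subdiff \<phi> (pt u)" for v
      using cD[of "v - subgrad u"] that by (auto simp: D_def)
  qed
qed

text \<open>If the candidate subgradients along a sequence were not subgradients, separating them from the
  convex subdifferentials would give in the limit a unit normal vector \<open>c\<close>; the subgradient
  \<open>vb - s c\<close>, available for small \<open>s > 0\<close> by strict complementarity, is approximated by
  subgradients along the sequence, which contradicts the separation.\<close>

lemma subgrad_in_subdiff:
  obtains \<delta> where "\<delta> > 0" "\<And>u. norm (u - u0) < \<delta> \<Longrightarrow> u \<in> \<Omega> \<and> subgrad u \<in> reg_subdiff \<phi> (pt u)"
proof -
  have "\<exists>\<delta>>0. \<forall>u. norm (u - u0) < \<delta> \<longrightarrow> u \<in> \<Omega> \<and> subgrad u \<in> reg_subdiff \<phi> (pt u)"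
  proof (rule ccontr)
    assume neg: "\<not> ?thesis"
    obtain r where r: "r > 0" "ball u0 r \<subseteq> \<Omega>"
      using open_\<Omega> u0_\<Omega> open_contains_ball by blast
    have "\<forall>j. \<exists>u. norm (u - u0) < min r (inverse (real (Suc j))) \<and> subgrad u \<notin> reg_subdiff \<phi> (pt u)"
    proof
      fix j
      have "min r (inverse (real (Suc j))) > 0" using r(1) by simp
      then obtain u where u: "norm (u - u0) < min r (inverse (real (Suc j)))"
        "\<not> (u \<in> \<Omega> \<and> subgrad u \<in> reg_subdiff \<phi> (pt u))"
        using neg by blast
      then have "u \<in> \<Omega>" using r(2) by (auto simp: dist_norm norm_minus_commute)
      with u show "\<exists>u. norm (u - u0) < min r (inverse (real (Suc j))) \<and> subgrad u \<notin> reg_subdiff \<phi> (pt u)"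
        by blast
    qed
    from choice[OF this] obtain us where us: "\<And>j. norm (us j - u0) < min r (inverse (real (Suc j)))"
      "\<And>j. subgrad (us j) \<notin> reg_subdiff \<phi> (pt (us j))" by blast
    have us\<Omega>: "us j \<in> \<Omega>" for j
      using us(1)[of j] r(2) by (auto simp: dist_norm norm_minus_commute)
    have "(\<lambda>j. us j - u0) \<longlonglongrightarrow> 0"
    proof (rule Lim_null_comparison[OF _ LIMSEQ_inverse_real_of_nat])
      show "\<forall>\<^sub>F j in sequentially. norm (us j - u0) \<le> inverse (real (Suc j))"
        using us(1) by (simp add: less_imp_le)
    qed
    then have lim: "us \<longlonglongrightarrow> u0" by (simp add: LIM_zero_iff)
    have cont: "(\<lambda>j. F (us j)) \<longlonglongrightarrow> F u0" if "continuous_on \<Omega> F" for F :: "real^'n \<Rightarrow> real^'n"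
      using continuous_on_tendsto_compose[OF that lim u0_\<Omega>] us\<Omega> by simp
    have xlim: "(\<lambda>j. pt (us j)) \<longlonglongrightarrow> xb"
      using cont[OF Ck_on_continuous_on[OF Ck_pt]] by (simp add: pt_u0)
    have vlim: "(\<lambda>j. subgrad (us j)) \<longlonglongrightarrow> vb"
      using cont[OF Ck_on_continuous_on[OF Ck_subgrad]] by (simp add: subgrad_u0)
    have \<sigma>lim: "(\<lambda>j. \<sigma>' (\<pi> (us j)) l) \<longlonglongrightarrow> \<sigma>' yb l" for l
    proof -
      have "continuous_on \<Omega> (\<lambda>u. \<sigma>' (\<pi> u) l)"
        using continuous_on_compose2[OF Ck_on_continuous_on[OF C\<sigma>(2)] linear_continuous_on[OF \<pi>(1)]]
        by (auto simp: \<Omega>_def)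
      from cont[OF this] show ?thesis by (simp add: \<pi>_u0)
    qed
    obtain Vi where Vi: "open Vi" "vb \<in> Vi" "isc_rel M (\<lambda>x'. Vi \<inter> lim_subdiff \<phi> x') xb"
      using isc by blast
    have approx: "\<exists>as. (\<forall>\<^sub>F j in sequentially. as j \<in> reg_subdiff \<phi> (pt (us j))) \<and> as \<longlonglongrightarrow> v"
      if v: "v \<in> Vi" "v \<in> reg_subdiff \<phi> xb" for v
    proof -
      have "v \<in> Vi \<inter> lim_subdiff \<phi> xb" using v by (simp add: lim_eq)
      moreover have "\<forall>j. pt (us j) \<in> M" using pt_M us\<Omega> by blast
      ultimately obtain as where "\<forall>\<^sub>F j in sequentially. as j \<in> Vi \<inter> lim_subdiff \<phi> (pt (us j))"
        "as \<longlonglongrightarrow> v"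
        using Vi(3)[unfolded isc_rel_def, rule_format, of v "\<lambda>j. pt (us j)"] xlim by blast
      then show ?thesis
        by (intro exI[of _ as]) (auto simp: lim_eq elim: eventually_mono)
    qed
    \<comment> \<open>Where the subdifferential is empty an arbitrary unit vector is taken. By
      \<open>approx\<close> at \<open>vb\<close> this concerns only finitely many indices.\<close>
    have "\<forall>j. \<exists>c. norm c = 1 \<and> (reg_subdiff \<phi> (pt (us j)) \<noteq> {} \<longrightarrow>
        (\<forall>l\<in>L. c \<bullet> \<sigma>' (\<pi> (us j)) l = 0) \<and> (\<forall>v\<in>reg_subdiff \<phi> (pt (us j)). c \<bullet> (v - subgrad (us j)) \<ge> 0))"
    proof
      fix j
      show "\<exists>c. norm c = 1 \<and> (reg_subdiff \<phi> (pt (us j)) \<noteq> {} \<longrightarrow>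
        (\<forall>l\<in>L. c \<bullet> \<sigma>' (\<pi> (us j)) l = 0) \<and> (\<forall>v\<in>reg_subdiff \<phi> (pt (us j)). c \<bullet> (v - subgrad (us j)) \<ge> 0))"
      proof (cases "reg_subdiff \<phi> (pt (us j)) = {}")
        case True
        then show ?thesis using vector_choose_size[of 1] by auto
      next
        case False
        from separating_normal[OF us\<Omega> us(2) False] show ?thesis by metis
      qed
    qed
    from choice[OF this] obtain cs where cs: "\<And>j. norm (cs j) = 1"
      "\<And>j l. reg_subdiff \<phi> (pt (us j)) \<noteq> {} \<Longrightarrow> l \<in> L \<Longrightarrow> cs j \<bullet> \<sigma>' (\<pi> (us j)) l = 0"
      "\<And>j v. v \<in> reg_subdiff \<phi> (pt (us j)) \<Longrightarrow> cs j \<bullet> (v - subgrad (us j)) \<ge> 0"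
      by blast
    have "\<forall>j. cs j \<in> sphere 0 1" using cs(1) by (simp add: dist_norm)
    then obtain c q where q: "strict_mono (q :: nat \<Rightarrow> nat)" "(cs \<circ> q) \<longlonglongrightarrow> c" "c \<in> sphere 0 1"
      using seq_compactE[OF compact_imp_seq_compact[OF compact_sphere]] by metis
    have c1: "norm c = 1" using q(3) by simp
    have sub: "(\<lambda>j. F (q j)) \<longlonglongrightarrow> l" if "F \<longlonglongrightarrow> l" for F :: "nat \<Rightarrow> real^'n" and l
      using LIMSEQ_subseq_LIMSEQ[OF that q(1)] by (simp add: o_def)
    have ev: "\<forall>\<^sub>F j in sequentially. P (q j)" if "\<forall>\<^sub>F j in sequentially. P j" for P
      using eventually_subseq[OF q(1) that] .
    have clim: "(\<lambda>j. cs (q j)) \<longlonglongrightarrow> c" using q(2) by (simp add: o_def)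
    have "c \<bullet> \<sigma>' yb l = 0" if l: "l \<in> L" for l
    proof -
      obtain as where "\<forall>\<^sub>F j in sequentially. as j \<in> reg_subdiff \<phi> (pt (us j))"
        using approx[OF Vi(2) vb] by blast
      then have "\<forall>\<^sub>F j in sequentially. cs j \<bullet> \<sigma>' (\<pi> (us j)) l = 0"
        by eventually_elim (use cs(2) l in blast)
      from ev[OF this] have "(\<lambda>j. cs (q j) \<bullet> \<sigma>' (\<pi> (us (q j))) l) \<longlonglongrightarrow> 0"
        by (rule tendsto_eventually)
      moreover have "(\<lambda>j. cs (q j) \<bullet> \<sigma>' (\<pi> (us (q j))) l) \<longlonglongrightarrow> c \<bullet> \<sigma>' yb l"
        by (intro tendsto_inner clim sub[OF \<sigma>lim])
      ultimately show ?thesis using LIMSEQ_unique by blast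
    qed
    then have "c \<in> par (reg_subdiff \<phi> xb)"
      unfolding par_eq by (rule normal_spaceI)
    then have "(- s) *\<^sub>R c \<in> par (reg_subdiff \<phi> xb)" for s
      unfolding par_def by (rule span_scale)
    then have aff: "vb + (- s) *\<^sub>R c \<in> affine hull (reg_subdiff \<phi> xb)" for s
      by (rule add_par_in_affine_hull[OF vb])
    obtain e1 where e1: "e1 > 0" "ball vb e1 \<inter> affine hull (reg_subdiff \<phi> xb) \<subseteq> reg_subdiff \<phi> xb"
      using ri unfolding mem_rel_interior_ball lim_eq by blast
    obtain e2 where e2: "e2 > 0" "ball vb e2 \<subseteq> Vi"
      using Vi(1,2) open_contains_ball by blast
    \<comment> \<open>The step must stay inside the ball given by the relative interior and inside
      \<open>Vi\<close>, where inner semicontinuity applies.\<close>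
    define s where "s = min e1 e2 / 2"
    have s: "s > 0" "s < e1" "s < e2" using e1(1) e2(1) by (auto simp: s_def)
    define v where "v = vb + (- s) *\<^sub>R c"
    have "dist vb v = s" using s c1 by (simp add: v_def dist_norm)
    then have "v \<in> Vi" "v \<in> reg_subdiff \<phi> xb"
      using e1(2) e2(2) s aff[of s] by (auto simp: v_def)
    from approx[OF this] obtain as where as: "\<forall>\<^sub>F j in sequentially. as j \<in> reg_subdiff \<phi> (pt (us j))"
      "as \<longlonglongrightarrow> v" by blast
    from as(1) have "\<forall>\<^sub>F j in sequentially. 0 \<le> cs j \<bullet> (as j - subgrad (us j))"
      by eventually_elim (rule cs(3))
    note nonneg = ev[OF this]
    have "(\<lambda>j. cs (q j) \<bullet> (as (q j) - subgrad (us (q j)))) \<longlonglongrightarrow> c \<bullet> (v - vb)"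
      by (intro tendsto_inner tendsto_diff clim sub[OF as(2)] sub[OF vlim])
    then have "0 \<le> c \<bullet> (v - vb)"
      by (rule tendsto_lowerbound[OF _ nonneg sequentially_bot])
    then have "s * (c \<bullet> c) \<le> 0" by (simp add: v_def)
    moreover have "c \<bullet> c = 1" using c1 by (simp add: dot_square_norm)
    ultimately show False using s by simp
  qed
  then show thesis using that by blast
qed

text \<open>Injectivity of the derivative of \<open>pt u + t *\<^sub>R subgrad u\<close> at
  \<open>u0\<close>. Paired with \<open>w = \<sigma>' yb (\<pi> d)\<close>, the normal part of
  \<open>DB d\<close> drops out and the rest is at most \<open>t * K * norm w^2\<close>, so
  \<open>w = 0\<close>; then the normal part vanishes too.\<close>

lemma subgrad_derivative_bound:
  obtains DB K where "(subgrad has_derivative DB) (at u0)" "K > 0"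
    "\<And>t d. 0 < t \<Longrightarrow> t * K < 1 \<Longrightarrow> \<sigma>' yb (\<pi> d) + t *\<^sub>R DB d = 0 \<Longrightarrow> d = 0"
proof -
  obtain k' where "k = Suc k'" using k by (cases k) auto
  then obtain DB' where "\<And>x. x \<in> \<Omega> \<Longrightarrow> (subgrad has_derivative DB' x) (at x)"
    using Ck_on_SucE[OF _ open_\<Omega>] Ck_subgrad by blast
  then have DB: "(subgrad has_derivative DB' u0) (at u0)" (is "(_ has_derivative ?DB) _")
    using u0_\<Omega> by blast
  interpret DB: bounded_linear ?DB by (rule has_derivative_bounded_linear[OF DB])
  interpret \<psi>': bounded_linear "\<psi>' xb" by (rule has_derivative_bounded_linear[OF d\<psi>[OF V(2)]])
  interpret \<sigma>': bounded_linear "\<sigma>' yb" by (rule has_derivative_bounded_linear[OF d\<sigma>[OF yb(1)]])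
  \<comment> \<open>In directions orthogonal to \<open>L\<close> the manifold point stays fixed and
    \<open>subgrad\<close> is affine, so its derivative is read off from constant difference
    quotients.\<close>
  have DB_orth: "?DB \<eta> = adjoint (\<psi>' xb) \<eta>" if \<eta>: "\<And>l. l \<in> L \<Longrightarrow> \<eta> \<bullet> l = 0" for \<eta>
  proof -
    define \<tau> where "\<tau> = (\<lambda>k. inverse (real (Suc k)))"
    have \<tau>: "\<And>k. \<tau> k > 0" "\<tau> \<longlonglongrightarrow> 0"
      unfolding \<tau>_def by (simp, rule LIMSEQ_inverse_real_of_nat)
    have "(1 / \<tau> k) *\<^sub>R (subgrad (u0 + \<tau> k *\<^sub>R \<eta>) - subgrad u0) = adjoint (\<psi>' xb) \<eta>" for k
    proof -
      have p: "\<pi> (u0 + \<tau> k *\<^sub>R \<eta>) = yb"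
        using \<pi>(1) \<pi>_orthogonal[OF \<eta>] \<pi>_u0 by (simp add: linear_simps)
      then have "pt (u0 + \<tau> k *\<^sub>R \<eta>) = xb" by (simp add: pt_def yb)
      then have "subgrad (u0 + \<tau> k *\<^sub>R \<eta>) = grad xb + adjoint (\<psi>' xb) (\<eta>b + \<tau> k *\<^sub>R \<eta>)"
        using subgrad_eq[of "u0 + \<tau> k *\<^sub>R \<eta>"] p yb(1) by (simp add: u0_def)
      moreover have "subgrad u0 = grad xb + adjoint (\<psi>' xb) \<eta>b"
        using subgrad_eq[of u0] yb(1) by (simp add: \<pi>_u0 pt_u0) (simp add: u0_def)
      ultimately show ?thesis
        using \<tau>(1)[of k] adjoint_linear[OF linear_\<psi>'[OF V(2)]]
        by (simp add: linear_add linear_scale)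
    qed
    then have "(\<lambda>k. adjoint (\<psi>' xb) \<eta>) \<longlonglongrightarrow> ?DB \<eta>"
      using has_derivative_quotient_tendsto[OF DB \<tau> tendsto_const[of \<eta>]] by simp
    then show ?thesis by (simp add: LIMSEQ_const_iff)
  qed
  \<comment> \<open>Only the composition with \<open>\<psi>' xb\<close> has to be bounded, because
    the tangential part \<open>\<pi> d\<close> equals \<open>\<psi>' xb w\<close>.\<close>
  obtain K where K: "K > 0" "\<And>w. norm (?DB (\<psi>' xb w)) \<le> norm w * K"
    using bounded_linear.pos_bounded[OF bounded_linear_compose[OF DB.bounded_linear_axioms \<psi>'.bounded_linear_axioms]]
    by blast
  show thesis
  proof (rule that[OF DB K(1)])
    fix t :: real and d
    assume t: "0 < t" "t * K < 1" and zero: "\<sigma>' yb (\<pi> d) + t *\<^sub>R ?DB d = 0"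
    define w where "w = \<sigma>' yb (\<pi> d)"
    have \<psi>w: "\<psi>' xb w = \<pi> d"
      using \<psi>'_\<sigma>'[OF yb(1), of "\<pi> d"] by (simp add: w_def yb(3))
    have "?DB d = ?DB (\<pi> d) + ?DB (d - \<pi> d)" by (simp add: DB.add[symmetric])
    also have "?DB (d - \<pi> d) = adjoint (\<psi>' xb) (d - \<pi> d)"
      by (rule DB_orth[OF \<pi>(3)])
    finally have DBd: "?DB d = ?DB (\<psi>' xb w) + adjoint (\<psi>' xb) (d - \<pi> d)" by (simp add: \<psi>w)
    have "adjoint (\<psi>' xb) (d - \<pi> d) \<bullet> w = 0"
      by (simp add: adjoint_clauses[OF linear_\<psi>'[OF V(2)]] \<psi>w \<pi>(3)[OF \<pi>(2)])
    moreover have "(w + t *\<^sub>R ?DB d) \<bullet> w = 0" using zero by (simp add: w_def)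
    ultimately have "norm w^2 = - (t * (?DB (\<psi>' xb w) \<bullet> w))"
      by (simp add: DBd inner_add_left power2_norm_eq_inner algebra_simps)
    also have "\<dots> \<le> t * (norm (?DB (\<psi>' xb w)) * norm w)"
      using t mult_left_mono[OF norm_cauchy_schwarz[of "- ?DB (\<psi>' xb w)" w], of t] by simp
    also have "\<dots> \<le> t * ((norm w * K) * norm w)"
      using t K(2) by (intro mult_left_mono mult_right_mono) auto
    finally have "(1 - t * K) * norm w^2 \<le> 0" by (simp add: power2_eq_square algebra_simps)
    then have w0: "w = 0" using t by (simp add: mult_le_0_iff)
    then have "\<pi> d = 0" using \<psi>w by (simp add: \<psi>'.zero)
    moreover from this have "adjoint (\<psi>' xb) d = 0"
      using zero t w0 DBd by (simp add: w_def[symmetric] \<psi>'.zero DB.zero)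
    then have "d \<bullet> \<psi>' xb (\<sigma>' yb d) = 0"
      using adjoint_clauses(2)[OF linear_\<psi>'[OF V(2)], of d "\<sigma>' yb d"] by simp
    then show "d = 0" using \<psi>'_\<sigma>'[OF yb(1), of d] by (simp add: yb(3))
  qed
qed

end

text \<open>For \<open>z\<close> near the base point, the manifold point \<open>X z\<close> read off
  from the local inverse of \<open>\<Phi>\<close> solves the resolvent inclusion and hence is the
  proximal point; its smoothness is that of \<open>pt\<close> and the local inverse.\<close>

lemma partly_smooth_prox_Ck:
  fixes \<phi> :: "real^'n \<Rightarrow> ereal"
  assumes "p \<ge> 2" and \<phi>: "proper_fun \<phi>" "closed_fun \<phi>" "prox_bounded \<phi>" "prox_regular \<phi>"
    and ri: "vb \<in> rel_interior (lim_subdiff \<phi> xb)"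
    and M: "Cp_submanifold p M" "xb \<in> M" and ps: "partly_smooth p \<phi> xb vb M"
  shows "\<exists>t0>0. \<forall>t. 0 < t \<and> t < t0 \<longrightarrow> (\<exists>U. open U \<and> xb + t *\<^sub>R vb \<in> U \<and>
    (\<forall>z\<in>U. \<exists>!x. x \<in> prox_set t \<phi> z) \<and> Ck_on (p - 1) U (prox t \<phi>))"
proof -
  obtain k where p: "p = Suc k" and k: "k \<ge> 1"
    using assms(1) by (cases p) auto
  obtain V1 L and \<psi> :: "real^'n \<Rightarrow> real^'n" where V1: "open V1" "xb \<in> V1" "subspace L" "Ck_on p V1 \<psi>" "inj_on \<psi> V1"
    "open (\<psi> ` V1)" "Ck_on p (\<psi> ` V1) (inv_into V1 \<psi>)" "\<psi> ` (M \<inter> V1) = \<psi> ` V1 \<inter> L"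
    using M unfolding Cp_submanifold_def by blast
  obtain V2 and g :: "real^'n \<Rightarrow> real" where V2: "open V2" "xb \<in> V2" "Ck_on p V2 g"
    "\<And>y. y \<in> M \<Longrightarrow> y \<in> V2 \<Longrightarrow> \<phi> y = ereal (g y)"
    using ps unfolding partly_smooth_def by blast
  define \<sigma> where "\<sigma> = inv_into V1 \<psi>"
  define V where "V = V1 \<inter> V2"
  have \<sigma>\<psi>: "\<sigma> (\<psi> x) = x" if "x \<in> V1" for x
    using V1(5) that by (simp add: \<sigma>_def)
  have img: "\<psi> ` V = \<psi> ` V1 \<inter> \<sigma> -` V2"
    using \<sigma>\<psi> by (auto simp: V_def)
  have openW: "open (\<psi> ` V)"
    unfolding img using Ck_on_continuous_on[OF V1(7)] V1(6) V2(1)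
    by (intro continuous_open_preimage) (auto simp: \<sigma>_def)
  have VV: "V \<subseteq> V1" "V \<subseteq> V2" "\<psi> ` V \<subseteq> \<psi> ` V1" by (auto simp: V_def)
  obtain \<psi>' where \<psi>': "\<And>x. x \<in> V1 \<Longrightarrow> (\<psi> has_derivative \<psi>' x) (at x)" "\<And>v. Ck_on k V1 (\<lambda>x. \<psi>' x v)"
    using Ck_on_SucE[OF V1(4)[unfolded p] V1(1)] by blast
  obtain \<sigma>' where \<sigma>': "\<And>x. x \<in> \<psi> ` V1 \<Longrightarrow> (\<sigma> has_derivative \<sigma>' x) (at x)"
    "\<And>v. Ck_on k (\<psi> ` V1) (\<lambda>x. \<sigma>' x v)"
    using Ck_on_SucE[OF V1(7)[unfolded p] V1(6)] unfolding \<sigma>_def by blast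
  obtain g' where g': "\<And>x. x \<in> V2 \<Longrightarrow> (g has_derivative g' x) (at x)" "\<And>v. Ck_on k V2 (\<lambda>x. g' x v)"
    using Ck_on_SucE[OF V2(3)[unfolded p] V2(1)] by blast
  obtain \<pi> where \<pi>: "bounded_linear \<pi>" "\<And>u. \<pi> u \<in> L" "\<And>u l. l \<in> L \<Longrightarrow> (u - \<pi> u) \<bullet> l = 0"
    using orthogonal_projection_exists[OF V1(3)] by blast
  have M_iff: "x \<in> M \<longleftrightarrow> \<psi> x \<in> L" if x: "x \<in> V" for x
  proof
    assume "x \<in> M"
    then have "\<psi> x \<in> \<psi> ` (M \<inter> V1)" using x VV by blast
    then show "\<psi> x \<in> L" using V1(8) by blast
  next
    assume "\<psi> x \<in> L"
    then have "\<psi> x \<in> \<psi> ` (M \<inter> V1)" using x VV V1(8) by blast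
    then show "x \<in> M" using V1(5) x VV by (auto dest: inj_onD)
  qed
  interpret partly_smooth_chart \<phi> xb vb M V L \<psi> \<sigma> g \<psi>' \<sigma>' g' \<pi> k
  proof (rule partly_smooth_chart.intro)
    show "open V" "xb \<in> V" using V1(1,2) V2(1,2) by (auto simp: V_def)
    show "Ck_on k (\<psi> ` V) \<sigma>"
      unfolding \<sigma>_def using Ck_on_mono[OF V1(7), of k] Ck_on_subset[OF _ VV(3)] p by simp
    show "Ck_on k V (\<lambda>x. \<psi>' x v)" for v by (rule Ck_on_subset[OF \<psi>'(2) VV(1)])
    show "Ck_on k (\<psi> ` V) (\<lambda>x. \<sigma>' x v)" for v by (rule Ck_on_subset[OF \<sigma>'(2) VV(3)])
    show "Ck_on k V (\<lambda>x. g' x v)" for v by (rule Ck_on_subset[OF g'(2) VV(2)])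
    show "lim_subdiff \<phi> x = reg_subdiff \<phi> x" for x
      by (rule prox_regular_lim_subdiff_eq[OF \<phi>(1,4)])
    show "par (reg_subdiff \<phi> xb) = normal_space M xb"
      "\<exists>Vi. open Vi \<and> vb \<in> Vi \<and> isc_rel M (\<lambda>x'. Vi \<inter> lim_subdiff \<phi> x') xb"
      using ps by (auto simp: partly_smooth_def)
  qed (use openW M(2) k \<sigma>\<psi> \<psi>'(1) \<sigma>'(1) g'(1) VV V1(3) M_iff V2(4) ri \<pi> in auto)
  have vb_lim: "vb \<in> lim_subdiff \<phi> xb" using vb lim_eq by simp
  have "prox_regular_at \<phi> xb vb" using \<phi>(4) vb_lim by (simp add: prox_regular_def)
  then obtain a R e where "prox_regular_point \<phi> xb vb a R e"
    using prox_regular_pointI[OF \<phi>(1-3) _ vb_lim] by blast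
  then interpret P: prox_regular_point \<phi> xb vb a R e .
  obtain DB K where DB: "(subgrad has_derivative DB) (at u0)" "K > 0"
    "\<And>t d. 0 < t \<Longrightarrow> t * K < 1 \<Longrightarrow> \<sigma>' yb (\<pi> d) + t *\<^sub>R DB d = 0 \<Longrightarrow> d = 0"
    using subgrad_derivative_bound by blast
  obtain \<delta>1 where \<delta>1: "\<delta>1 > 0" "\<And>u. norm (u - u0) < \<delta>1 \<Longrightarrow> u \<in> \<Omega> \<and> subgrad u \<in> reg_subdiff \<phi> (pt u)"
    using subgrad_in_subdiff by blast
  define \<Omega>1 where "\<Omega>1 = ball u0 \<delta>1"
  have \<Omega>1: "open \<Omega>1" "u0 \<in> \<Omega>1" "\<Omega>1 \<subseteq> \<Omega>" "\<And>u. u \<in> \<Omega>1 \<Longrightarrow> subgrad u \<in> reg_subdiff \<phi> (pt u)"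
    using \<delta>1 by (auto simp: \<Omega>1_def dist_norm norm_minus_commute)
  have ga: "g xb = a" using P.val \<phi>g[OF xbM V(2)] by simp
  show ?thesis
  \<comment> \<open>\<open>1 / R\<close> serves existence and uniqueness of proximal points,
    \<open>1 / K\<close> the invertibility of the derivative of \<open>\<Phi>\<close>.\<close>
  proof (intro exI[of _ "min (1 / R) (1 / K)"] conjI allI impI)
    show "0 < min (1 / R) (1 / K)" using P.R DB(2) by simp
    fix t assume "0 < t \<and> t < min (1 / R) (1 / K)"
    then have t: "0 < t" "t * R < 1" "t * K < 1"
      using P.R DB(2) by (auto simp: field_simps)
    define \<Phi> where "\<Phi> = (\<lambda>u. pt u + t *\<^sub>R subgrad u)"
    have C\<Phi>: "Ck_on k \<Omega>1 \<Phi>"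
      unfolding \<Phi>_def
      by (rule Ck_on_subset[OF Ck_on_add[OF open_\<Omega> Ck_pt Ck_on_scaleR_const[OF open_\<Omega> Ck_subgrad]] \<Omega>1(3)])
    have "(pt has_derivative (\<lambda>d. \<sigma>' yb (\<pi> d))) (at u0)"
      unfolding pt_def
      using has_derivative_compose[OF bounded_linear_imp_has_derivative[OF \<pi>(1)], of \<sigma> "\<sigma>' yb" u0] d\<sigma>[OF yb(1)]
      by (simp add: \<pi>_u0)
    then have D\<Phi>: "(\<Phi> has_derivative (\<lambda>d. \<sigma>' yb (\<pi> d) + t *\<^sub>R DB d)) (at u0)"
      unfolding \<Phi>_def by (intro has_derivative_add has_derivative_scaleR_right DB(1))
    have \<Phi>u0: "\<Phi> u0 = xb + t *\<^sub>R vb" by (simp add: \<Phi>_def pt_u0 subgrad_u0)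
    obtain U' V' \<Psi> where inv: "open U'" "U' \<subseteq> \<Omega>1" "u0 \<in> U'" "open V'" "\<Phi> u0 \<in> V'"
      "\<And>z. z \<in> V' \<Longrightarrow> \<Psi> z \<in> U' \<and> \<Phi> (\<Psi> z) = z" "\<Psi> (\<Phi> u0) = u0" "Ck_on k V' \<Psi>"
      by (rule Ck_inverse_function_theorem[OF \<Omega>1(1,2) k C\<Phi> D\<Phi> DB(3)[OF t(1,3)]], assumption, rule that)
    obtain \<delta> where \<delta>: "\<delta> > 0" "\<And>z x x'. norm (z - (xb + t *\<^sub>R vb)) < \<delta> \<Longrightarrow> x \<in> prox_set t \<phi> z \<Longrightarrow>
       (1 / t) *\<^sub>R (z - x') \<in> lim_subdiff \<phi> x' \<Longrightarrow> norm (x' - xb) < \<delta> \<Longrightarrow>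
       \<phi> x' < ereal (a + \<delta>) \<Longrightarrow> x' = x"
      by (rule P.prox_unique_near[OF t(1,2)], rule that)
    define X where "X = (\<lambda>z. pt (\<Psi> z))"
    have \<Psi>\<Omega>: "\<Psi> ` V' \<subseteq> \<Omega>" using inv(2,6) \<Omega>1(3) by blast
    have CX: "Ck_on k V' X"
      unfolding X_def by (rule Ck_on_compose[OF inv(4) open_\<Omega> \<Psi>\<Omega> Ck_pt inv(8)])
    have zbV: "xb + t *\<^sub>R vb \<in> V'" using inv(5) \<Phi>u0 by simp
    have Xzb: "X (xb + t *\<^sub>R vb) = xb" using inv(7) by (simp add: X_def \<Phi>u0 pt_u0)
    have "continuous_on V' X" using CX by (rule Ck_on_continuous_on)
    then have Xlim: "(X \<longlongrightarrow> xb) (nhds (xb + t *\<^sub>R vb))"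
      using inv(4) zbV Xzb by (metis continuous_on_eq_continuous_at isCont_def tendsto_at_iff_tendsto_nhds)
    have cg: "isCont g xb" using dg[OF V(2)] by (rule has_derivative_continuous)
    \<comment> \<open>The value of \<open>\<phi>\<close> at \<open>X z\<close> must be close to
      \<open>a\<close>. Although \<open>\<phi>\<close> may be discontinuous, it agrees with the
      continuous \<open>g\<close> at the manifold point \<open>X z\<close>.\<close>
    have "((\<lambda>z. g (X z)) \<longlongrightarrow> a) (nhds (xb + t *\<^sub>R vb))"
      using isCont_tendsto_compose[OF cg Xlim] unfolding ga .
    then have "\<forall>\<^sub>F z in nhds (xb + t *\<^sub>R vb). g (X z) < a + \<delta>"
      using \<delta>(1) by (intro order_tendstoD) auto
    moreover have "\<forall>\<^sub>F z in nhds (xb + t *\<^sub>R vb). norm (X z - xb) < \<delta>"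
      using tendstoD[OF Xlim \<delta>(1)] by (simp add: dist_norm)
    moreover have "\<forall>\<^sub>F z in nhds (xb + t *\<^sub>R vb). norm (z - (xb + t *\<^sub>R vb)) < \<delta>"
      using \<delta>(1) eventually_nhds_metric[of _ "xb + t *\<^sub>R vb"] by (auto simp: dist_norm)
    moreover have "\<forall>\<^sub>F z in nhds (xb + t *\<^sub>R vb). z \<in> V'"
      using inv(4) zbV by (rule eventually_nhds_in_open)
    ultimately have "\<forall>\<^sub>F z in nhds (xb + t *\<^sub>R vb). g (X z) < a + \<delta> \<and> norm (X z - xb) < \<delta> \<and>
        norm (z - (xb + t *\<^sub>R vb)) < \<delta> \<and> z \<in> V'"
      by eventually_elim simp
    then obtain U where U: "open U" "xb + t *\<^sub>R vb \<in> U" "\<And>z. z \<in> U \<Longrightarrow> g (X z) < a + \<delta> \<and>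
        norm (X z - xb) < \<delta> \<and> norm (z - (xb + t *\<^sub>R vb)) < \<delta> \<and> z \<in> V'"
      unfolding eventually_nhds by blast
    have prox_eq: "x = X z" if z: "z \<in> U" and x: "x \<in> prox_set t \<phi> z" for x z
    proof (rule sym, rule \<delta>(2)[OF _ x])
      have zU: "g (X z) < a + \<delta>" "norm (X z - xb) < \<delta>" "norm (z - (xb + t *\<^sub>R vb)) < \<delta>" "z \<in> V'"
        using U(3)[OF z] by auto
      then show "norm (z - (xb + t *\<^sub>R vb)) < \<delta>" "norm (X z - xb) < \<delta>" by auto
      have u: "\<Psi> z \<in> \<Omega>1" "\<Phi> (\<Psi> z) = z" using inv(2,6) zU(4) by auto
      then have "\<phi> (X z) = ereal (g (X z))"
        unfolding X_def using \<Omega>1(3) pt_V pt_M by (intro \<phi>g) auto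
      then show "\<phi> (X z) < ereal (a + \<delta>)" using zU(1) by simp
      have "z - X z = t *\<^sub>R subgrad (\<Psi> z)" using u(2) by (simp add: \<Phi>_def X_def algebra_simps)
      then have "(1 / t) *\<^sub>R (z - X z) = subgrad (\<Psi> z)" using t(1) by simp
      then show "(1 / t) *\<^sub>R (z - X z) \<in> lim_subdiff \<phi> (X z)"
        using \<Omega>1(4)[OF u(1)] by (simp add: lim_eq X_def)
    qed
    have ps_eq: "prox_set t \<phi> z = {X z}" if "z \<in> U" for z
      using P.prox_set_nonempty[OF t(1,2), of z] prox_eq[OF that] by blast
    have "Ck_on k U X" using U(3) by (intro Ck_on_subset[OF CX]) auto
    then have "Ck_on (p - 1) U (prox t \<phi>)"
      using ps_eq by (subst Ck_on_cong[where h = X]) (auto simp: prox_def p)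
    then show "\<exists>U. open U \<and> xb + t *\<^sub>R vb \<in> U \<and> (\<forall>z\<in>U. \<exists>!x. x \<in> prox_set t \<phi> z) \<and>
        Ck_on (p - 1) U (prox t \<phi>)"
      using U(1,2) ps_eq by (intro exI[of _ U]) auto
  qed
qed

section \<open>Both conditions combined, and the Douglas-Rachford map\<close>

lemma prox_Ck_near:
  fixes \<phi> :: "real^'n \<Rightarrow> ereal"
  assumes "p \<ge> 2" and \<phi>: "proper_fun \<phi>" "closed_fun \<phi>" "prox_bounded \<phi>" "prox_regular \<phi>"
    and vb: "vb \<in> lim_subdiff \<phi> xb"
  shows "\<exists>t0>0. \<forall>t. 0 < t \<and> t < t0 \<longrightarrow> prox t \<phi> (xb + t *\<^sub>R vb) = xb \<and>
    ((vb \<in> rel_interior (lim_subdiff \<phi> xb) \<and>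
        (\<exists>M. Cp_submanifold p M \<and> xb \<in> M \<and> partly_smooth p \<phi> xb vb M)) \<or>
     (twice_epi_diff \<phi> xb vb \<and> generalized_quadratic_sd \<phi> xb vb \<and>
        closed (prox_nondiff_set t \<phi>) \<and> Ck_on (p - 1) (- prox_nondiff_set t \<phi>) (prox t \<phi>))
     \<longrightarrow> (\<exists>U. open U \<and> xb + t *\<^sub>R vb \<in> U \<and> (\<forall>z\<in>U. \<exists>!x. x \<in> prox_set t \<phi> z) \<and>
           Ck_on (p - 1) U (prox t \<phi>)))"
proof -
  let ?smooth = "vb \<in> rel_interior (lim_subdiff \<phi> xb) \<and>
    (\<exists>M. Cp_submanifold p M \<and> xb \<in> M \<and> partly_smooth p \<phi> xb vb M)"
  let ?concl = "\<lambda>t. \<exists>U. open U \<and> xb + t *\<^sub>R vb \<in> U \<and> (\<forall>z\<in>U. \<exists>!x. x \<in> prox_set t \<phi> z) \<and>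
    Ck_on (p - 1) U (prox t \<phi>)"
  \<comment> \<open>Partial smoothness does not involve \<open>t\<close>, so its threshold is fixed
    by a case distinction before \<open>t\<close> is chosen. The second condition refers to
    \<open>t\<close> itself; for it \<open>t * R < 1\<close> is enough.\<close>
  have "\<exists>t1>0. \<forall>t. 0 < t \<and> t < t1 \<longrightarrow> ?smooth \<longrightarrow> ?concl t"
  proof (cases ?smooth)
    case True
    then obtain M where "Cp_submanifold p M" "xb \<in> M" "partly_smooth p \<phi> xb vb M" by blast
    from partly_smooth_prox_Ck[OF assms(1) \<phi> conjunct1[OF True] this] True show ?thesis by simp
  next
    case False
    show ?thesis by (intro exI[of _ 1] conjI[OF zero_less_one] allI impI) (erule notE[OF False])
  qed
  then obtain t1 where t1: "t1 > 0" "\<forall>t. 0 < t \<and> t < t1 \<longrightarrow> ?smooth \<longrightarrow> ?concl t"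
    by (elim exE conjE)
  have "prox_regular_at \<phi> xb vb" using \<phi>(4) vb by (simp add: prox_regular_def)
  then obtain a R e where "prox_regular_point \<phi> xb vb a R e"
    using prox_regular_pointI[OF \<phi>(1-3) _ vb] by blast
  then interpret prox_regular_point \<phi> xb vb a R e .
  show ?thesis
  proof (intro exI[of _ "min t1 (1 / R)"] conjI allI impI)
    show "0 < min t1 (1 / R)" using t1(1) R by simp
    fix t assume "0 < t \<and> t < min t1 (1 / R)"
    then have t: "0 < t" "t < t1" "t * R < 1" using R by (auto simp: field_simps)
    show "prox t \<phi> (xb + t *\<^sub>R vb) = xb" by (rule prox_at_base[OF t(1,3)])
    assume "?smooth \<or> (twice_epi_diff \<phi> xb vb \<and> generalized_quadratic_sd \<phi> xb vb \<and>
        closed (prox_nondiff_set t \<phi>) \<and> Ck_on (p - 1) (- prox_nondiff_set t \<phi>) (prox t \<phi>))"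
    then show "?concl t"
    proof
      assume "?smooth"
      then show ?thesis using t1(2)[rule_format, OF conjI[OF t(1,2)]] by simp
    next
      assume *: "twice_epi_diff \<phi> xb vb \<and> generalized_quadratic_sd \<phi> xb vb \<and>
        closed (prox_nondiff_set t \<phi>) \<and> Ck_on (p - 1) (- prox_nondiff_set t \<phi>) (prox t \<phi>)"
      then have "prox_differentiable_at t \<phi> (xb + t *\<^sub>R vb)"
        by (intro prox_differentiable_at_base[OF t(1,3)]) auto
      moreover have "\<exists>!x. x \<in> prox_set t \<phi> z" if "z \<in> - prox_nondiff_set t \<phi>" for z
        using that by (auto simp: prox_nondiff_set_def prox_differentiable_at_def)
      \<comment> \<open>The complement of the nondifferentiability set is open by assumption,
        contains the base point by the differentiability just shown, and consists of points with a
        unique proximal point.\<close>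
      ultimately show ?thesis
        using * by (intro exI[of _ "- prox_nondiff_set t \<phi>"]) (auto simp: prox_nondiff_set_def open_Compl)
    qed
  qed
qed

theorem theorem4p8:
  fixes f h :: "real^'n \<Rightarrow> ereal" and xs w :: "real^'n" and p :: nat
  assumes "p \<ge> 2"
    and "proper_fun f" "closed_fun f" "prox_bounded f" "prox_regular f"
    and "proper_fun h" "closed_fun h" "prox_bounded h" "prox_regular h"
    and "- w \<in> lim_subdiff f xs" and "w \<in> lim_subdiff h xs"
  shows "\<exists>t0>0. \<forall>t. 0 < t \<and> t < t0 \<longrightarrow>
     (( - w \<in> rel_interior (lim_subdiff f xs) \<and> w \<in> rel_interior (lim_subdiff h xs) \<and>
        (\<exists>Mf. Cp_submanifold p Mf \<and> xs \<in> Mf \<and> partly_smooth p f xs (- w) Mf) \<and>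
        (\<exists>Mh. Cp_submanifold p Mh \<and> xs \<in> Mh \<and> partly_smooth p h xs w Mh))
      \<or>
      (twice_epi_diff f xs (- w) \<and> generalized_quadratic_sd f xs (- w) \<and>
       twice_epi_diff h xs w \<and> generalized_quadratic_sd h xs w \<and>
       closed (prox_nondiff_set t f) \<and> closed (prox_nondiff_set t h) \<and>
       Ck_on (p - 1) (- prox_nondiff_set t f) (prox t f) \<and>
       Ck_on (p - 1) (- prox_nondiff_set t h) (prox t h)))
     \<longrightarrow> (\<exists>U. open U \<and> xs + t *\<^sub>R w \<in> U \<and>
            (\<forall>z\<in>U. (\<exists>!x. x \<in> prox_set t h z) \<and>
                    (\<exists>!x. x \<in> prox_set t f (2 *\<^sub>R prox t h z - z))) \<and>
            Ck_on (p - 1) U (F_DRS t f h))"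
proof -
  let ?hyp = "\<lambda>\<phi> v t. (v \<in> rel_interior (lim_subdiff \<phi> xs) \<and>
        (\<exists>M. Cp_submanifold p M \<and> xs \<in> M \<and> partly_smooth p \<phi> xs v M)) \<or>
     (twice_epi_diff \<phi> xs v \<and> generalized_quadratic_sd \<phi> xs v \<and>
        closed (prox_nondiff_set t \<phi>) \<and> Ck_on (p - 1) (- prox_nondiff_set t \<phi>) (prox t \<phi>))"
  let ?concl = "\<lambda>\<phi> v t. \<exists>U. open U \<and> xs + t *\<^sub>R v \<in> U \<and> (\<forall>z\<in>U. \<exists>!x. x \<in> prox_set t \<phi> z) \<and>
    Ck_on (p - 1) U (prox t \<phi>)"
  obtain tf where tf: "tf > 0" "\<And>t. 0 < t \<and> t < tf \<Longrightarrow> ?hyp f (- w) t \<Longrightarrow> ?concl f (- w) t"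
    using prox_Ck_near[OF assms(1-5,10)] by blast
  obtain th where th: "th > 0" "\<And>t. 0 < t \<and> t < th \<Longrightarrow> prox t h (xs + t *\<^sub>R w) = xs"
    "\<And>t. 0 < t \<and> t < th \<Longrightarrow> ?hyp h w t \<Longrightarrow> ?concl h w t"
    using prox_Ck_near[OF assms(1,6-9,11)] by blast
  show ?thesis
  proof (intro exI[of _ "min tf th"] conjI allI impI)
    show "0 < min tf th" using tf(1) th(1) by simp
    fix t
    assume "0 < t \<and> t < min tf th"
    then have t: "0 < t \<and> t < tf" "0 < t \<and> t < th" by auto
    assume "( - w \<in> rel_interior (lim_subdiff f xs) \<and> w \<in> rel_interior (lim_subdiff h xs) \<and>
        (\<exists>Mf. Cp_submanifold p Mf \<and> xs \<in> Mf \<and> partly_smooth p f xs (- w) Mf) \<and>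
        (\<exists>Mh. Cp_submanifold p Mh \<and> xs \<in> Mh \<and> partly_smooth p h xs w Mh))
      \<or>
      (twice_epi_diff f xs (- w) \<and> generalized_quadratic_sd f xs (- w) \<and>
       twice_epi_diff h xs w \<and> generalized_quadratic_sd h xs w \<and>
       closed (prox_nondiff_set t f) \<and> closed (prox_nondiff_set t h) \<and>
       Ck_on (p - 1) (- prox_nondiff_set t f) (prox t f) \<and>
       Ck_on (p - 1) (- prox_nondiff_set t h) (prox t h))"
    then have "?hyp f (- w) t" "?hyp h w t" by argo+
    then have "?concl f (- w) t" "?concl h w t"
      using tf(2)[OF t(1)] th(3)[OF t(2)] by auto
    then obtain Uf Uh where Uf: "open Uf" "xs + t *\<^sub>R (- w) \<in> Uf" "\<forall>z\<in>Uf. \<exists>!x. x \<in> prox_set t f z"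
        "Ck_on (p - 1) Uf (prox t f)"
      and Uh: "open Uh" "xs + t *\<^sub>R w \<in> Uh" "\<forall>z\<in>Uh. \<exists>!x. x \<in> prox_set t h z"
        "Ck_on (p - 1) Uh (prox t h)"
      by blast
    define r where "r = (\<lambda>z. 2 *\<^sub>R prox t h z - z)"
    have Cr: "Ck_on (p - 1) Uh r"
      unfolding r_def
      by (rule Ck_on_diff[OF Uh(1) Ck_on_scaleR_const[OF Uh(1,4)] Ck_on_bounded_linear[OF bounded_linear_ident Uh(1)]])
    define U where "U = Uh \<inter> r -` Uf"
    have U: "open U" "U \<subseteq> Uh" "r ` U \<subseteq> Uf"
      unfolding U_def using continuous_open_preimage[OF Ck_on_continuous_on[OF Cr] Uh(1) Uf(1)] by auto
    \<comment> \<open>The reflection sends the base point of \<open>h\<close> for \<open>w\<close>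
      to the base point of \<open>f\<close> for \<open>- w\<close>, so the two local results can be
      composed.\<close>
    have "r (xs + t *\<^sub>R w) = xs + t *\<^sub>R (- w)"
      using th(2)[OF t(2)] by (simp add: r_def scaleR_2)
    then have "xs + t *\<^sub>R w \<in> U" using Uh(2) Uf(2) by (simp add: U_def)
    moreover have "\<forall>z\<in>U. (\<exists>!x. x \<in> prox_set t h z) \<and> (\<exists>!x. x \<in> prox_set t f (2 *\<^sub>R prox t h z - z))"
      using Uh(3) Uf(3) by (simp add: U_def r_def)
    moreover have "Ck_on (p - 1) U (F_DRS t f h)"
    proof -
      have "Ck_on (p - 1) U (\<lambda>z. prox t h z - prox t f (r z))"
        by (rule Ck_on_diff[OF U(1) Ck_on_subset[OF Uh(4) U(2)]
              Ck_on_compose[OF U(1) Uf(1) U(3) Uf(4) Ck_on_subset[OF Cr U(2)]]])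
      then show ?thesis
        by (subst Ck_on_cong[where h = "\<lambda>z. prox t h z - prox t f (r z)"]) (auto simp: F_DRS_def r_def)
    qed
    ultimately show "\<exists>U. open U \<and> xs + t *\<^sub>R w \<in> U \<and>
            (\<forall>z\<in>U. (\<exists>!x. x \<in> prox_set t h z) \<and>
                    (\<exists>!x. x \<in> prox_set t f (2 *\<^sub>R prox t h z - z))) \<and>
            Ck_on (p - 1) U (F_DRS t f h)"
      using U(1) by blast
  qed
qed

end
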